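(* Let $H^{m',n'}_{p',q'}\left[t\,\Big|\begin{array}{c}(\alpha'_j,A'_j)_1^{p'}\\(\beta'_j,B'_j)_1^{q'}\end{array}\right]$ be a Fox $H$-function with real $\alpha'_j,\beta'_j$ and positive $A'_j,B'_j$ which is defined and positive for every $t>0$. Assume $m'n'>0$ and $$\chi'=\sum_{j=1}^{n'}A'_j-\sum_{j=n'+1}^{p'}A'_j+\sum_{j=1}^{m'}B'_j-\sum_{j=m'+1}^{q'}B'_j>0 .$$ Let $k\in\mathbb{N}$ and let $\omega_1,\dots,\omega_{2k},\lambda_1,\dots,\lambda_{2k}$ be real numbers such that, for every $j=1,\dots,k$, $\omega_{2j}>0$, $\lambda_{2j}>0$, $$\omega_{2j-1}+\omega_{2j}\min_{l=1,\dots,m'}\left\{\frac{\beta'_l}{B'_l}\right\}>0,\qquad \lambda_{2j-1}+\lambda_{2j}\min_{l=1,\dots,m'}\left\{\frac{\beta'_l}{B'_l}\right\}>0 .$$ Define the list $(\alpha''_j,A''_j)_1^{p'+2k}$ by $$(\alpha''_j,A''_j)_1^{2k}=\Big(\big(1-\omega_{2(k-j)+1},\omega_{2(k-j+1)}\big),\big(1-\lambda_{2(k-j)+1},\lambda_{2(k-j+1)}\big)\Big)_1^k,\qquad (\alpha''_j,A''_j)_{2k+1}^{p'+2k}=(\alpha'_j,A'_j)_1^{p'} .$$ Then $$H^{m',n'+2k}_{p'+2k,q'+k}\left[t\,\Big|\begin{array}{c}(\alpha''_j,A''_j)_1^{p'+2k}\\(\beta'_j,B'_j)_1^{q'},\,(1-\omega_{2j-1}-\lambda_{2j-1},\omega_{2j}+\lambda_{2j})_1^k\end{array}\right]>0\qquad\text{for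 every }t>0.$$
   Context: $\mathbb{N}=\{1,2,\dots\}$, $\mathbb{N}_0=\mathbb{N}\cup\{0\}$. The notation $(x_j,X_j)_1^l$ stands for the list $(x_1,X_1),\dots,(x_l,X_l)$ (the empty list if $l=0$), and $((x_j,X_j),(y_j,Y_j))_1^l$ for the list $(x_1,X_1),(y_1,Y_1),\dots,(x_l,X_l),(y_l,Y_l)$; lists separated by commas are concatenated. Fox $H$-function. For $0\le n\le p$, $0\le m\le q$, $A_j,B_j>0$, $\alpha_j,\beta_j\in\mathbb{C}$ with $A_j(l+\beta_{j'})\ne B_{j'}(\alpha_j-l'-1)$ for all $1\le j\le n$, $1\le j'\le m$, $l,l'\in\mathbb{N}_0$, put $$\Xi^{m,n}_{p,q}(s)=\frac{\prod_{j=1}^m\Gamma(\beta_j+B_js)\prod_{j=1}^n\Gamma(1-\alpha_j-A_js)}{\prod_{j=m+1}^q\Gamma(1-\beta_j-B_js)\prod_{j=n+1}^p\Gamma(\alpha_j+A_js)}$$ (empty products are $1$), and $$H^{m,n}_{p,q}\left[z\,\Big|\begin{array}{c}(\alpha_j,A_j)_1^p\\(\beta_j,B_j)_1^q\end{array}\right]=\frac{1}{2\pi i}\int_{\mathcal C}\Xi^{m,n}_{p,q}(s)\,z^{-s}\,ds .$$ Let $\chi=\sum_{j=1}^nA_j-\sum_{j=n+1}^pA_j+\sum_{j=1}^mB_j-\sum_{j=m+1}^qB_j$. When $\chi>0$ (as is the case for all $H$-functions here) and $z>0$, $\mathcal C$ is a contour going from $\gamma-i\infty$ to $\gamma+i\infty$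 ($\gamma\in\mathbb{R}$), leaving all poles of $\Gamma(\beta_j+B_js)$, $1\le j\le m$, on its left and all poles of $\Gamma(1-\alpha_j-A_js)$, $1\le j\le n$, on its right; the integral converges and does not depend on the choice of such a contour. *)

theory Defs
  imports "HOL-Complex_Analysis.Complex_Analysis" "HOL-Library.Complex_Order"
begin

text \<open>
  The parameters of \<open>H\<^sup>m\<^sup>,\<^sup>n\<^sub>p\<^sub>,\<^sub>q\<close> are two lists: \<open>as\<close>, of length \<open>p\<close>, consists of the pairs
  \<open>(\<alpha>\<^sub>j, A\<^sub>j)\<close>, and \<open>bs\<close>, of length \<open>q\<close>, of the pairs \<open>(\<beta>\<^sub>j, B\<^sub>j)\<close>. List positions are
  counted from 0, while the list notation \<open>(x\<^sub>j, X\<^sub>j)\<^sub>1\<^sup>l\<close> is indexed from 1.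
\<close>

type_synonym fox_list = "(complex \<times> real) list"

definition pair_list :: "nat \<Rightarrow> (nat \<Rightarrow> real) \<Rightarrow> (nat \<Rightarrow> real) \<Rightarrow> fox_list" where
  "pair_list l x X = map (\<lambda>j. (complex_of_real (x j), X j)) [1..<Suc l]"

definition fox_H_params :: "nat \<Rightarrow> nat \<Rightarrow> fox_list \<Rightarrow> fox_list \<Rightarrow> bool" where
  "fox_H_params m n as bs \<longleftrightarrow>
     n \<le> length as \<and> m \<le> length bs \<and>
     (\<forall>(\<alpha>, A) \<in> set as. A > 0) \<and> (\<forall>(\<beta>, B) \<in> set bs. B > 0) \<and>
     (\<forall>(\<alpha>, A) \<in> set (take n as). \<forall>(\<beta>, B) \<in> set (take m bs). \<forall>l l' :: nat.
        of_real A * (of_nat l + \<beta>) \<noteq> of_real B * (\<alpha> - of_nat l' - 1))"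

text \<open>
  Since \<open>Gamma\<close> is 0 at its poles and \<open>x / 0 = 0\<close>, the quotient below vanishes wherever a
  denominator factor has a pole, in accordance with \<open>1 / \<Gamma>\<close> being an entire function.
\<close>

definition fox_Xi :: "nat \<Rightarrow> nat \<Rightarrow> fox_list \<Rightarrow> fox_list \<Rightarrow> complex \<Rightarrow> complex" where
  "fox_Xi m n as bs s =
     ((\<Prod>(\<beta>, B) \<leftarrow> take m bs. Gamma (\<beta> + of_real B * s)) *
      (\<Prod>(\<alpha>, A) \<leftarrow> take n as. Gamma (1 - \<alpha> - of_real A * s))) /
     ((\<Prod>(\<beta>, B) \<leftarrow> drop m bs. Gamma (1 - \<beta> - of_real B * s)) *
      (\<Prod>(\<alpha>, A) \<leftarrow> drop n as. Gamma (\<alpha> + of_real A * s)))"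

text \<open>
  A contour from \<open>\<gamma> - i\<infinity>\<close> to \<open>\<gamma> + i\<infinity>\<close>: a simple piecewise continuously differentiable curve
  that coincides with the vertical line \<open>Re s = \<gamma>\<close> outside a bounded part. Its left and right
  sides are the components of its complement containing the points \<open>x\<close> of the real axis with
  \<open>x\<close> near \<open>-\<infinity>\<close> and near \<open>+\<infinity>\<close>, respectively.
\<close>

definition vertical_contour :: "real \<Rightarrow> (real \<Rightarrow> complex) \<Rightarrow> bool" where
  "vertical_contour \<gamma> c \<longleftrightarrow>
     c piecewise_C1_differentiable_on UNIV \<and> inj c \<and>
     (\<exists>T. \<forall>t. \<bar>t\<bar> \<ge> T \<longrightarrow> c t = Complex \<gamma> t)"

definition left_side :: "(real \<Rightarrow> complex) \<Rightarrow> complex set" where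
  "left_side c =
     {s. \<forall>\<^sub>F x :: real in at_bot. connected_component (- range c) (of_real x) s}"

definition right_side :: "(real \<Rightarrow> complex) \<Rightarrow> complex set" where
  "right_side c =
     {s. \<forall>\<^sub>F x :: real in at_top. connected_component (- range c) (of_real x) s}"

definition fox_contour ::
  "nat \<Rightarrow> nat \<Rightarrow> fox_list \<Rightarrow> fox_list \<Rightarrow> (real \<Rightarrow> complex) \<Rightarrow> bool" where
  "fox_contour m n as bs c \<longleftrightarrow>
     (\<exists>\<gamma>. vertical_contour \<gamma> c) \<and>
     (\<forall>(\<beta>, B) \<in> set (take m bs).
        {s. is_pole (\<lambda>s. Gamma (\<beta> + of_real B * s)) s} \<subseteq> left_side c) \<and>
     (\<forall>(\<alpha>, A) \<in> set (take n as).
        {s. is_pole (\<lambda>s. Gamma (1 - \<alpha> - of_real A * s)) s} \<subseteq> right_side c)"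

definition has_line_integral ::
  "(complex \<Rightarrow> complex) \<Rightarrow> complex \<Rightarrow> (real \<Rightarrow> complex) \<Rightarrow> bool" where
  "has_line_integral f I c \<longleftrightarrow>
     ((\<lambda>t. f (c t) * vector_derivative c (at t)) has_integral I) UNIV"

text \<open>
  The definition is meant for admissible parameters with \<open>\<chi> > 0\<close> and for \<open>z > 0\<close>; then the
  integral converges and its value does not depend on the contour \<open>c\<close>.
\<close>

definition fox_H :: "nat \<Rightarrow> nat \<Rightarrow> fox_list \<Rightarrow> fox_list \<Rightarrow> real \<Rightarrow> complex" where
  "fox_H m n as bs z =
     (THE h. \<exists>c I. fox_contour m n as bs c \<and>
        has_line_integral (\<lambda>s. fox_Xi m n as bs s * of_real z powr (- s)) I c \<and>
        h = 1 / (2 * of_real pi * \<i>) * I)"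

text \<open>
  Inequalities between complex numbers are those of \<open>HOL-Library.Complex_Order\<close>: \<open>0 < w\<close>
  means that \<open>w\<close> is real and positive.
\<close>

end

theory Submission
  imports Defs
begin

text \<open>
  On the parameter side the new function arises from the old one by multiplying \<open>\<Xi>\<close> with
  \<open>Beta (\<omega>\<^sub>1 - \<omega>\<^sub>2 s) (\<lambda>\<^sub>1 - \<lambda>\<^sub>2 s)\<close> for each \<open>j\<close>. If the contour stays in the half-plane where both
  arguments have positive real part, then inserting the Beta integral and exchanging the integrations
  gives \<open>H''(x) = \<integral> u\<^bsup>\<omega>\<^sub>1-1\<^esup> (1 - u)\<^bsup>\<lambda>\<^sub>1-1\<^esup> H'(x u\<^bsup>\<omega>\<^sub>2\<^esup> (1 - u)\<^bsup>\<lambda>\<^sub>2\<^esup>) du\<close> over \<open>0 < u < 1\<close>, which is positive.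
  The condition on \<open>min \<beta>'\<^sub>l / B'\<^sub>l\<close> says that the poles to be kept on the left lie in this half-plane, so
  such a contour exists. Since the poles are real, but left and right ones may alternate, it has to
  wind between them.

  The value of the integral is the same for all admissible contours: the loop formed by two truncated
  contours has winding number 0 about every pole, because a pole on a given side can be moved
  off to infinity without crossing the contour, and \<open>\<chi> > 0\<close> makes the integrand decay exponentially in
  vertical strips.
\<close>

subsection \<open>The complex Beta integral\<close>

text \<open>\<open>fox_H\<close> is a definite description over all admissible contours. Positivity
  of the old function therefore yields the sign of an integral along a chosen curve only after
  uniqueness is known for arbitrary simple curves, and this forces the use of winding numbers
  although all poles are real. One contour serves both functions, because the old poles are among
  the new ones. It is kept in the half-plane \<open>Re s < U\<close>, where \<open>U\<close> is the
  least of the quotients \<open>\<omega> (2 * j - 1) / \<omega> (2 * j)\<close> and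
  \<open>lam (2 * j - 1) / lam (2 * j)\<close>; the poles brought in by the Beta factors satisfy
  \<open>Re s \<ge> U\<close>. The added parameters enter \<chi> once with each sign and so leave it
  unchanged. Only \<chi> > 0 is available, so the decay of the integrand has to be known with its
  exact exponential rate. The exchange of integrations rests on one majorant for the whole strip
  around the contour: the Beta kernel at its right edge, where both arguments have the smallest real
  part.\<close>

lemma nonpos_Ints_Re_le: "z \<in> \<int>\<^sub>\<le>\<^sub>0 \<Longrightarrow> Re z \<le> 0"
  by (auto elim!: nonpos_Ints_cases)

lemma norm_of_real_powr: "x > 0 \<Longrightarrow> norm (of_real x powr (z::complex)) = x powr Re z"
  by (simp add: norm_powr_real_powr)

text \<open>Euler's integral with the integrand extended by 0 to the whole line, the form in which
  translation invariance and Fubini's theorem for \<open>lborel\<close> apply.\<close>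

lemma integrable_Gamma_integrand:
  fixes z :: complex
  assumes "Re z > 0"
  defines "f \<equiv> \<lambda>t. if 0 < t then of_real t powr (z - 1) * of_real (exp (- t)) else 0"
  shows "integrable lborel f" "integral\<^sup>L lborel f = Gamma z"
proof -
  have meas [measurable]: "f \<in> borel_measurable borel"
    unfolding f_def powr_def by measurable
  have "set_integrable lebesgue {0<..} (\<lambda>t. complex_of_real t powr (z - 1) / of_real (exp t))"
    using absolutely_integrable_Gamma_integral'[OF assms(1)] .
  then have "integrable lebesgue f"
    unfolding set_integrable_def
    by (rule Bochner_Integration.integrable_cong[THEN iffD1, rotated 2])
       (auto simp: f_def indicator_def exp_minus field_simps)
  then show int: "integrable lborel f"
    by (subst (asm) integrable_completion) auto
  have "((\<lambda>t. of_real t powr (z - 1) / of_real (exp t)) has_integral Gamma z) {0<..}"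
    by (rule Gamma_integral_complex') fact
  then have "((\<lambda>t. if t \<in> {0<..} then of_real t powr (z - 1) / of_real (exp t) else 0) has_integral Gamma z) UNIV"
    by (subst has_integral_restrict_UNIV)
  also have "(\<lambda>t. if t \<in> {0<..} then complex_of_real t powr (z - 1) / of_real (exp t) else 0) = f"
    by (auto simp: f_def fun_eq_iff exp_minus field_simps)
  finally show "integral\<^sup>L lborel f = Gamma z"
    using has_integral_integral_lborel[OF int] has_integral_unique by blast
qed

definition Beta_kernel :: "complex \<Rightarrow> complex \<Rightarrow> real \<Rightarrow> complex" where
  "Beta_kernel z w u =
     (if 0 < u \<and> u < 1 then of_real u powr (z - 1) * of_real (1 - u) powr (w - 1) else 0)"

lemma Beta_kernel_measurable [measurable]: "Beta_kernel z w \<in> borel_measurable borel"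
  unfolding Beta_kernel_def powr_def by measurable

lemma norm_Beta_kernel:
  "norm (Beta_kernel z w u) = (if 0 < u \<and> u < 1 then u powr (Re z - 1) * (1 - u) powr (Re w - 1) else 0)"
  by (simp add: Beta_kernel_def norm_mult norm_of_real_powr del: of_real_diff)

lemma Beta_kernel_of_real:
  "Beta_kernel (of_real x) (of_real y) u = of_real (norm (Beta_kernel (of_real x) (of_real y) u))"
proof (cases "0 < u \<and> u < 1")
  case True
  have "complex_of_real v powr (complex_of_real y - 1) = of_real (v powr (y - 1))" if "v > 0" for v y
    using powr_of_real[of v "y - 1"] that by simp
  with True show ?thesis
    by (simp add: norm_Beta_kernel) (simp add: Beta_kernel_def del: of_real_diff)
qed (auto simp: Beta_kernel_def)

lemma integrable_Beta_kernel:
  assumes "Re z > 0" "Re w > 0"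
  shows "integrable lborel (Beta_kernel z w)"
proof (rule Bochner_Integration.integrable_bound)
  show "integrable lborel (\<lambda>t. indicat_real {0..1} t *\<^sub>R (t powr (Re z - 1) * (1 - t) powr (Re w - 1)))"
    using integrable_Beta[OF assms] unfolding set_integrable_def .
  show "AE u in lborel. norm (Beta_kernel z w u) \<le> norm (indicat_real {0..1} u *\<^sub>R (u powr (Re z - 1) * (1 - u) powr (Re w - 1)))"
    by (rule AE_I2) (simp add: norm_Beta_kernel)
qed measurable

text \<open>\<open>Gamma z * Gamma w\<close> is the integral of the convolution of two Euler
  integrands. The substitution t = u v turns the convolution at u > 0 into the Beta integral times
  the Euler integrand of z + w, and integrating over u produces
  \<open>Gamma (z + w)\<close>.\<close>

theorem integral_Beta_kernel:
  fixes z w :: complex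
  assumes z: "Re z > 0" and w: "Re w > 0"
  shows "integral\<^sup>L lborel (Beta_kernel z w) = Beta z w"
proof -
  define \<phi> :: "complex \<Rightarrow> real \<Rightarrow> complex" where
    "\<phi> = (\<lambda>z t. if 0 < t then of_real t powr (z - 1) * of_real (exp (- t)) else 0)"
  have int: "integrable lborel (\<phi> z)" "integral\<^sup>L lborel (\<phi> z) = Gamma z" if "Re z > 0" for z
    using integrable_Gamma_integrand[OF that] by (simp_all add: \<phi>_def)
  have [measurable]: "\<phi> z \<in> borel_measurable borel" for z
    unfolding \<phi>_def powr_def by measurable
  \<comment> \<open>By translation invariance the inner integrals, of the function and of its norm,
    do not depend on \<open>t\<close>. This is what makes the double integrand integrable.\<close>
  have shift: "integrable lborel (\<lambda>u. \<phi> w (u - t))" "(\<integral>u. \<phi> w (u - t) \<partial>lborel) = Gamma w"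
    "(\<integral>u. norm (\<phi> w (u - t)) \<partial>lborel) = (\<integral>u. norm (\<phi> w u) \<partial>lborel)" for t
    using lborel_integrable_real_affine[OF int(1)[OF w], of 1 "-t"]
      lborel_integral_real_affine[of 1 "\<phi> w" "-t"] int(2)[OF w]
      lborel_integral_real_affine[of 1 "\<lambda>u. norm (\<phi> w u)" "-t"] by simp_all
  have "integrable (lborel \<Otimes>\<^sub>M lborel) (\<lambda>(t, u). \<phi> z t * \<phi> w (u - t))"
    by (rule lborel_pair.Fubini_integrable)
       (auto simp: norm_mult shift int z case_prod_unfold intro!: integrable_mult_left integrable_norm)
  from lborel_pair.Fubini_integral[OF this]
  have "(\<integral>u. (\<integral>t. \<phi> z t * \<phi> w (u - t) \<partial>lborel) \<partial>lborel) = (\<integral>t. (\<integral>u. \<phi> z t * \<phi> w (u - t) \<partial>lborel) \<partial>lborel)" .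
  also have "\<dots> = Gamma z * Gamma w"
    by (simp add: shift int z)
  also have "(\<lambda>u. \<integral>t. \<phi> z t * \<phi> w (u - t) \<partial>lborel)
           = (\<lambda>u. integral\<^sup>L lborel (Beta_kernel z w) * \<phi> (z + w) u)"
  proof
    fix u :: real
    show "(\<integral>t. \<phi> z t * \<phi> w (u - t) \<partial>lborel) = integral\<^sup>L lborel (Beta_kernel z w) * \<phi> (z + w) u"
    proof (cases "u > 0")
      case False
      then have "(\<lambda>t. \<phi> z t * \<phi> w (u - t)) = (\<lambda>t. 0)"
        by (auto simp: \<phi>_def)
      with False show ?thesis
        by (simp add: \<phi>_def)
    next
      case True
      \<comment> \<open>Here t = u v with Jacobian u. The powers of u combine to
        \<open>u powr (z + w - 1)\<close> and the exponentials to \<open>exp (- u)\<close>.\<close>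
      have "u *\<^sub>R (\<phi> z (u * v) * \<phi> w (u - u * v)) = Beta_kernel z w v * \<phi> (z + w) u" for v
      proof (cases "0 < v \<and> v < 1")
        case True
        have "complex_of_real u powr (z + w - 1) = of_real u powr (1 + (z - 1) + (w - 1))"
          by (simp add: algebra_simps)
        with \<open>u > 0\<close> have e: "of_real u * (of_real u powr (z - 1) * of_real v powr (z - 1) * (of_real u powr (w - 1) * of_real (1 - v) powr (w - 1)))
          = of_real u powr (z + w - 1) * (of_real v powr (z - 1) * complex_of_real (1 - v) powr (w - 1))"
          by (simp only: powr_add) simp
        have "u - u * v = u * (1 - v)" by (simp add: algebra_simps)
        moreover have "0 < u * v" "0 < u * (1 - v)" using True \<open>u > 0\<close> by auto
        moreover have "exp (- (u * v)) * exp (- (u * (1 - v))) = exp (- u)"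
          by (simp add: algebra_simps flip: exp_add)
        ultimately have "u *\<^sub>R (\<phi> z (u * v) * \<phi> w (u - u * v)) =
           of_real u * (of_real (u * v) powr (z - 1) * of_real (u * (1 - v)) powr (w - 1)) * of_real (exp (- u))"
          by (simp add: \<phi>_def scaleR_conv_of_real del: of_real_mult) (simp add: mult_ac flip: of_real_mult)
        also have "of_real (u * v) powr (z - 1) = of_real u powr (z - 1) * of_real v powr (z - 1)"
          using True \<open>u > 0\<close> by (simp add: powr_times_real)
        also have "of_real (u * (1 - v)) powr (w - 1) = of_real u powr (w - 1) * of_real (1 - v) powr (w - 1)"
          using True \<open>u > 0\<close> unfolding of_real_mult by (subst powr_times_real) auto
        also note e
        finally show ?thesis using True \<open>u > 0\<close>
          by (simp add: Beta_kernel_def \<phi>_def mult_ac)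
      next
        case False
        then have "\<not> (0 < u * v \<and> u * v < u)" using \<open>u > 0\<close>
          by (auto simp: zero_less_mult_iff)
        with False show ?thesis
          by (auto simp: Beta_kernel_def \<phi>_def)
      qed
      with True show ?thesis
        by (subst lborel_integral_real_affine[of u _ 0]) (simp_all flip: integral_mult_left_zero integral_scaleR_right)
    qed
  qed
  also have "(\<integral>u. integral\<^sup>L lborel (Beta_kernel z w) * \<phi> (z + w) u \<partial>lborel)
           = integral\<^sup>L lborel (Beta_kernel z w) * Gamma (z + w)"
    using z w by (simp add: int)
  finally show ?thesis
    using Gamma_eq_zero_iff[of "z + w"] z w by (auto simp: Beta_def field_simps dest: nonpos_Ints_Re_le)
qed

text \<open>The norm of \<open>Beta_kernel z w\<close> depends on the real parts only and is itself
  the kernel with parameters \<open>Re z\<close> and \<open>Re w\<close>.\<close>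

lemma norm_Beta_le:
  assumes "Re z > 0" "Re w > 0"
  shows "norm (Beta z w) \<le> Beta (Re z) (Re w)"
proof -
  have "norm (Beta z w) \<le> (\<integral>u. norm (Beta_kernel z w u) \<partial>lborel)"
    using integral_norm_bound[of lborel "Beta_kernel z w"] integral_Beta_kernel[OF assms] by simp
  also have "\<dots> = Re (integral\<^sup>L lborel (Beta_kernel (of_real (Re z)) (of_real (Re w))))"
  proof -
    have "Beta_kernel (of_real (Re z)) (of_real (Re w)) = (\<lambda>u. of_real (norm (Beta_kernel z w u)))"
      by (rule ext, subst Beta_kernel_of_real) (simp add: norm_Beta_kernel)
    then show ?thesis
      by simp
  qed
  also have "\<dots> = Beta (Re z) (Re w)"
    using assms by (subst integral_Beta_kernel) (auto simp: Beta_complex_of_real)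
  finally show ?thesis .
qed

text \<open>This is \<open>norm (Beta z a) \<le> Beta (Re z) a\<close> in disguise. It compares \<open>Gamma\<close> on a vertical line
  with \<open>Gamma\<close> on the lines through the integers, where the modulus is elementary.\<close>

lemma norm_Gamma_div_Gamma_mono:
  assumes "Re z > 0" "a > 0"
  shows "norm (Gamma z) / Gamma (Re z) \<le> norm (Gamma (z + of_real a)) / Gamma (Re z + a)"
proof -
  have nz: "Gamma (z + of_real a) \<noteq> 0"
    using assms by (auto simp: Gamma_eq_zero_iff dest: nonpos_Ints_Re_le)
  have "norm (Beta z (of_real a)) \<le> Beta (Re z) a"
    using norm_Beta_le[of z "of_real a"] assms by simp
  moreover have "norm (Beta z (of_real a)) = norm (Gamma z) * Gamma a / norm (Gamma (z + of_real a))"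
    using assms Gamma_real_pos[of a] by (simp add: Beta_def norm_mult norm_divide Gamma_complex_of_real)
  ultimately have "norm (Gamma z) * Gamma a / norm (Gamma (z + of_real a)) \<le> Gamma (Re z) * Gamma a / Gamma (Re z + a)"
    by (simp add: Beta_def)
  then show ?thesis
    using nz assms Gamma_real_pos[of a] Gamma_real_pos[of "Re z"] Gamma_real_pos[of "Re z + a"]
    by (simp add: field_simps)
qed

subsection \<open>Growth in vertical strips\<close>

text \<open>Requiring the bound only for \<open>e > \<delta>\<close> makes polynomial factors invisible, so that the crude
  bounds below, in place of Stirling's formula, give the exact rates of \<open>Gamma\<close> and \<open>rGamma\<close>.\<close>

definition vgrowth :: "real \<Rightarrow> (complex \<Rightarrow> complex) \<Rightarrow> bool" where
  "vgrowth \<delta> f \<longleftrightarrow> (\<forall>x1 x2. \<forall>e>\<delta>. \<exists>C T. \<forall>s. x1 \<le> Re s \<and> Re s \<le> x2 \<and> T \<le> \<bar>Im s\<bar> \<longrightarrow>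
      norm (f s) \<le> C * exp (e * \<bar>Im s\<bar>))"

lemma vgrowthE:
  assumes "vgrowth \<delta> f" "e > \<delta>"
  obtains C T where "C \<ge> 0" "\<And>s. x1 \<le> Re s \<Longrightarrow> Re s \<le> x2 \<Longrightarrow> T \<le> \<bar>Im s\<bar> \<Longrightarrow> norm (f s) \<le> C * exp (e * \<bar>Im s\<bar>)"
proof -
  obtain C T where "\<And>s. x1 \<le> Re s \<and> Re s \<le> x2 \<and> T \<le> \<bar>Im s\<bar> \<Longrightarrow> norm (f s) \<le> C * exp (e * \<bar>Im s\<bar>)"
    using assms unfolding vgrowth_def by metis
  moreover have "C * exp (e * \<bar>Im s\<bar>) \<le> max C 0 * exp (e * \<bar>Im s\<bar>)" for s
    by (intro mult_right_mono) auto
  ultimately show ?thesis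
    by (intro that[of "max C 0" T]) (simp, meson order_trans)
qed

lemma vgrowthI:
  assumes "\<And>x1 x2 e. e > \<delta> \<Longrightarrow> \<exists>C T. \<forall>s. x1 \<le> Re s \<longrightarrow> Re s \<le> x2 \<longrightarrow> T \<le> \<bar>Im s\<bar> \<longrightarrow>
      norm (f s) \<le> C * exp (e * \<bar>Im s\<bar>)"
  shows "vgrowth \<delta> f"
  unfolding vgrowth_def using assms by (metis (no_types, lifting))

text \<open>The comparison function may change with the strip. The bounds for \<open>Gamma\<close>
  and \<open>rGamma\<close> need this, since the integer shift used there depends on the
  strip.\<close>

lemma vgrowth_comparison:
  assumes "\<And>x1 x2. \<exists>g K T. vgrowth \<delta> g \<and> (\<forall>s. x1 \<le> Re s \<longrightarrow> Re s \<le> x2 \<longrightarrow> T \<le> \<bar>Im s\<bar> \<longrightarrow>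
      norm (f s) \<le> K * norm (g s))"
  shows "vgrowth \<delta> f"
proof (rule vgrowthI)
  fix x1 x2 e :: real assume e: "e > \<delta>"
  obtain g K T where g: "vgrowth \<delta> g"
    and K: "\<And>s. x1 \<le> Re s \<Longrightarrow> Re s \<le> x2 \<Longrightarrow> T \<le> \<bar>Im s\<bar> \<Longrightarrow> norm (f s) \<le> K * norm (g s)"
    using assms by metis
  from g e obtain C T' where C: "C \<ge> 0"
    "\<And>s. x1 \<le> Re s \<Longrightarrow> Re s \<le> x2 \<Longrightarrow> T' \<le> \<bar>Im s\<bar> \<Longrightarrow> norm (g s) \<le> C * exp (e * \<bar>Im s\<bar>)"
    by (rule vgrowthE[where ?x1.0 = x1 and ?x2.0 = x2]) blast
  show "\<exists>C T. \<forall>s. x1 \<le> Re s \<longrightarrow> Re s \<le> x2 \<longrightarrow> T \<le> \<bar>Im s\<bar> \<longrightarrow> norm (f s) \<le> C * exp (e * \<bar>Im s\<bar>)"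
  proof (rule exI[of _ "\<bar>K\<bar> * C"], rule exI[of _ "max T T'"], intro allI impI)
    fix s assume s: "x1 \<le> Re s" "Re s \<le> x2" "max T T' \<le> \<bar>Im s\<bar>"
    have "norm (f s) \<le> K * norm (g s)"
      using s by (intro K) auto
    also have "\<dots> \<le> \<bar>K\<bar> * norm (g s)"
      by (intro mult_right_mono) auto
    also have "\<dots> \<le> \<bar>K\<bar> * (C * exp (e * \<bar>Im s\<bar>))"
      using s by (intro mult_left_mono C) auto
    finally show "norm (f s) \<le> \<bar>K\<bar> * C * exp (e * \<bar>Im s\<bar>)"
      by (simp add: mult_ac)
  qed
qed

lemma vgrowth_exp_Im: "vgrowth \<delta> (\<lambda>s. of_real (exp (\<delta> * \<bar>Im s\<bar>)))"
proof (rule vgrowthI)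
  fix x1 x2 e :: real assume "e > \<delta>"
  then have "\<delta> * \<bar>y\<bar> \<le> e * \<bar>y\<bar>" for y :: real
    by (intro mult_right_mono) auto
  then show "\<exists>C T. \<forall>s. x1 \<le> Re s \<longrightarrow> Re s \<le> x2 \<longrightarrow> T \<le> \<bar>Im s\<bar> \<longrightarrow>
      norm (complex_of_real (exp (\<delta> * \<bar>Im s\<bar>))) \<le> C * exp (e * \<bar>Im s\<bar>)"
    by - (rule exI[of _ 1], rule exI[of _ 0], simp)
qed

lemma vgrowth_const: "vgrowth 0 (\<lambda>_. c)"
  using vgrowth_exp_Im[of 0] by (intro vgrowth_comparison) (auto intro!: exI[of _ "norm c"])

lemma vgrowth_affine_ident: "vgrowth 0 (\<lambda>s. s + c)"
proof (rule vgrowthI)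
  fix x1 x2 e :: real assume e: "e > 0"
  show "\<exists>C T. \<forall>s. x1 \<le> Re s \<longrightarrow> Re s \<le> x2 \<longrightarrow> T \<le> \<bar>Im s\<bar> \<longrightarrow> norm (s + c) \<le> C * exp (e * \<bar>Im s\<bar>)"
  \<comment> \<open>The summand 1 / e comes from y \<le> (1 + e y) / e \<le> exp (e y) / e with y =
    \<bar>Im s\<bar>.\<close>
  proof (rule exI[of _ "\<bar>x1\<bar> + \<bar>x2\<bar> + norm c + 1 / e"], rule exI[of _ 0], intro allI impI)
    fix s assume s: "x1 \<le> Re s" "Re s \<le> x2"
    have "norm (s + c) \<le> \<bar>x1\<bar> + \<bar>x2\<bar> + \<bar>Im s\<bar> + norm c"
      using s cmod_le[of s] norm_triangle_ineq[of s c] by linarith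
    also have "\<dots> \<le> (\<bar>x1\<bar> + \<bar>x2\<bar> + norm c) * 1 + (1 / e) * (1 + e * \<bar>Im s\<bar>)"
      using e by (simp add: field_simps)
    also have "\<dots> \<le> (\<bar>x1\<bar> + \<bar>x2\<bar> + norm c) * exp (e * \<bar>Im s\<bar>) + (1 / e) * exp (e * \<bar>Im s\<bar>)"
      using e by (intro add_mono mult_left_mono exp_ge_add_one_self) auto
    finally show "norm (s + c) \<le> (\<bar>x1\<bar> + \<bar>x2\<bar> + norm c + 1 / e) * exp (e * \<bar>Im s\<bar>)"
      by (simp add: algebra_simps)
  qed
qed

lemma vgrowth_mult:
  assumes "vgrowth \<delta> f" "vgrowth \<epsilon> g"
  shows "vgrowth (\<delta> + \<epsilon>) (\<lambda>s. f s * g s)"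
proof (rule vgrowthI)
  fix x1 x2 e :: real assume e: "e > \<delta> + \<epsilon>"
  \<comment> \<open>The slack in the exponent is shared equally between the two factors.\<close>
  define d where "d = (e - (\<delta> + \<epsilon>)) / 2"
  have d: "\<delta> + d > \<delta>" "\<epsilon> + d > \<epsilon>" "e = (\<delta> + d) + (\<epsilon> + d)"
    using e by (auto simp: d_def field_simps)
  from vgrowthE[OF assms(1) d(1)] obtain C T where C: "C \<ge> 0"
    "\<And>s. x1 \<le> Re s \<Longrightarrow> Re s \<le> x2 \<Longrightarrow> T \<le> \<bar>Im s\<bar> \<Longrightarrow> norm (f s) \<le> C * exp ((\<delta> + d) * \<bar>Im s\<bar>)"
    by metis
  from vgrowthE[OF assms(2) d(2)] obtain C' T' where C': "C' \<ge> 0"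
    "\<And>s. x1 \<le> Re s \<Longrightarrow> Re s \<le> x2 \<Longrightarrow> T' \<le> \<bar>Im s\<bar> \<Longrightarrow> norm (g s) \<le> C' * exp ((\<epsilon> + d) * \<bar>Im s\<bar>)"
    by metis
  show "\<exists>C T. \<forall>s. x1 \<le> Re s \<longrightarrow> Re s \<le> x2 \<longrightarrow> T \<le> \<bar>Im s\<bar> \<longrightarrow>
      norm (f s * g s) \<le> C * exp (e * \<bar>Im s\<bar>)"
  proof (rule exI[of _ "C * C'"], rule exI[of _ "max T T'"], intro allI impI)
    fix s assume s: "x1 \<le> Re s" "Re s \<le> x2" "max T T' \<le> \<bar>Im s\<bar>"
    have "norm (f s * g s) \<le> (C * exp ((\<delta> + d) * \<bar>Im s\<bar>)) * (C' * exp ((\<epsilon> + d) * \<bar>Im s\<bar>))"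
      unfolding norm_mult using s C C' by (intro mult_mono) auto
    also have "\<dots> = C * C' * exp (e * \<bar>Im s\<bar>)"
      by (simp only: d(3) distrib_right[of "\<delta> + d"] exp_add) (simp only: mult_ac)
    finally show "norm (f s * g s) \<le> C * C' * exp (e * \<bar>Im s\<bar>)" .
  qed
qed

text \<open>Negative \<open>B\<close> is included, since the factors
  \<open>Gamma (1 - \<alpha> - A s)\<close> are treated as the case \<open>B = - A\<close>.\<close>

lemma vgrowth_compose_affine:
  assumes f: "vgrowth \<delta> f" and B: "B \<noteq> 0"
  shows "vgrowth (\<delta> * \<bar>B\<bar>) (\<lambda>s. f (\<beta> + of_real B * s))"
proof (rule vgrowthI)
  fix x1 x2 e :: real assume e: "e > \<delta> * \<bar>B\<bar>"
  define e' where "e' = e / \<bar>B\<bar>"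
  have e': "e' > \<delta>" "e = e' * \<bar>B\<bar>"
    using e B by (auto simp: e'_def field_simps)
  define X where "X = \<bar>B\<bar> * (\<bar>x1\<bar> + \<bar>x2\<bar>) + \<bar>Re \<beta>\<bar>"
  from f e'(1) obtain C T where C: "C \<ge> 0"
    "\<And>s. - X \<le> Re s \<Longrightarrow> Re s \<le> X \<Longrightarrow> T \<le> \<bar>Im s\<bar> \<Longrightarrow> norm (f s) \<le> C * exp (e' * \<bar>Im s\<bar>)"
    by (rule vgrowthE[where ?x1.0 = "-X" and ?x2.0 = X]) blast
  show "\<exists>C T. \<forall>s. x1 \<le> Re s \<longrightarrow> Re s \<le> x2 \<longrightarrow> T \<le> \<bar>Im s\<bar> \<longrightarrow>
      norm (f (\<beta> + of_real B * s)) \<le> C * exp (e * \<bar>Im s\<bar>)"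
  \<comment> \<open>Replacing the modulus of the imaginary part of the argument by \<bar>B\<bar>
    \<bar>Im s\<bar> changes it by at most \<bar>Im \<beta>\<bar>. The rate \<open>e'\<close> may be
    negative, hence its absolute value in the constant.\<close>
  proof (rule exI[of _ "C * exp (\<bar>e'\<bar> * \<bar>Im \<beta>\<bar>)"], rule exI[of _ "(\<bar>T\<bar> + \<bar>Im \<beta>\<bar>) / \<bar>B\<bar>"], intro allI impI)
    fix s assume s: "x1 \<le> Re s" "Re s \<le> x2" "(\<bar>T\<bar> + \<bar>Im \<beta>\<bar>) / \<bar>B\<bar> \<le> \<bar>Im s\<bar>"
    let ?w = "\<beta> + of_real B * s"
    have "\<bar>B * Re s\<bar> \<le> \<bar>B\<bar> * (\<bar>x1\<bar> + \<bar>x2\<bar>)"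
      unfolding abs_mult using s by (intro mult_left_mono) auto
    then have 1: "- X \<le> Re ?w" "Re ?w \<le> X"
      unfolding X_def by simp_all
    have BI: "\<bar>B * Im s\<bar> = \<bar>B\<bar> * \<bar>Im s\<bar>" by (simp add: abs_mult)
    have "\<bar>T\<bar> + \<bar>Im \<beta>\<bar> \<le> \<bar>B\<bar> * \<bar>Im s\<bar>"
      using s(3) B by (simp add: field_simps)
    then have 2: "T \<le> \<bar>Im ?w\<bar>"
      using BI by simp
    have "\<bar>\<bar>Im ?w\<bar> - \<bar>B\<bar> * \<bar>Im s\<bar>\<bar> \<le> \<bar>Im \<beta>\<bar>"
      using BI by simp
    then have "\<bar>e'\<bar> * \<bar>\<bar>Im ?w\<bar> - \<bar>B\<bar> * \<bar>Im s\<bar>\<bar> \<le> \<bar>e'\<bar> * \<bar>Im \<beta>\<bar>"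
      by (intro mult_left_mono) auto
    moreover have "e' * (\<bar>Im ?w\<bar> - \<bar>B\<bar> * \<bar>Im s\<bar>) \<le> \<bar>e'\<bar> * \<bar>\<bar>Im ?w\<bar> - \<bar>B\<bar> * \<bar>Im s\<bar>\<bar>"
      by (metis abs_ge_self abs_mult)
    ultimately have "e' * \<bar>Im ?w\<bar> \<le> \<bar>e'\<bar> * \<bar>Im \<beta>\<bar> + e * \<bar>Im s\<bar>"
      by (simp add: e'(2) algebra_simps)
    then have "C * exp (e' * \<bar>Im ?w\<bar>) \<le> C * exp (\<bar>e'\<bar> * \<bar>Im \<beta>\<bar> + e * \<bar>Im s\<bar>)"
      using C(1) by (intro mult_left_mono) auto
    with C(2)[OF 1 2] show "norm (f ?w) \<le> C * exp (\<bar>e'\<bar> * \<bar>Im \<beta>\<bar>) * exp (e * \<bar>Im s\<bar>)"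
      by (simp add: exp_add mult_ac)
  qed
qed

lemma vgrowth_prod_list:
  assumes "\<And>x. x \<in> set xs \<Longrightarrow> vgrowth (d x) (f x)"
  shows "vgrowth (\<Sum>x\<leftarrow>xs. d x) (\<lambda>s. \<Prod>x\<leftarrow>xs. f x s)"
  using assms by (induction xs) (auto intro: vgrowth_mult vgrowth_const)

lemma vgrowth_pochhammer: "vgrowth 0 (\<lambda>s. pochhammer s n)"
proof (induction n)
  case (Suc n)
  from vgrowth_mult[OF Suc vgrowth_affine_ident[of "of_nat n"]] show ?case
    by (simp add: pochhammer_Suc)
qed (simp add: vgrowth_const)

section \<open>The modulus of Gamma on vertical lines\<close>

text \<open>The square of the modulus is Gamma (1 + i y) Gamma (1 - i y), because
  \<open>Gamma\<close> commutes with conjugation. The functional equation and the reflection formula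
  reduce this to i y pi / sin (pi i y).\<close>

lemma norm_Gamma_one_plus_ii:
  assumes "y \<noteq> 0"
  shows "norm (Gamma (1 + \<i> * of_real y)) ^ 2 = pi * \<bar>y\<bar> / sinh (pi * \<bar>y\<bar>)"
proof -
  let ?z = "1 + \<i> * complex_of_real y"
  have sin_ii: "sin (\<i> * of_real r) = \<i> * complex_of_real (sinh r)" for r
    unfolding sin_exp_eq' sinh_def
    by (simp add: scaleR_conv_of_real exp_minus flip: exp_of_real mult.assoc)
  have nz: "\<i> * of_real y \<notin> \<int>\<^sub>\<le>\<^sub>0"
    using assms by (auto elim!: nonpos_Ints_cases simp: complex_eq_iff)
  have "complex_of_real (norm (Gamma ?z) ^ 2) = Gamma ?z * cnj (Gamma ?z)"
    by (simp only: complex_norm_square)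
  also have "cnj (Gamma ?z) = Gamma (1 - \<i> * of_real y)"
    by (simp add: cnj_Gamma)
  also have "Gamma ?z * Gamma (1 - \<i> * of_real y) = \<i> * of_real y * Gamma (\<i> * of_real y) * Gamma (1 - \<i> * of_real y)"
    using Gamma_plus1[OF nz] by (simp add: add_ac)
  also have "\<i> * of_real y * Gamma (\<i> * of_real y) * Gamma (1 - \<i> * of_real y)
      = \<i> * of_real y * (of_real pi / sin (of_real pi * (\<i> * of_real y)))"
    by (simp only: mult.assoc Gamma_reflection_complex)
  also have "of_real pi * (\<i> * of_real y) = \<i> * complex_of_real (pi * y)"
    by simp
  also have "sin (\<i> * complex_of_real (pi * y)) = \<i> * of_real (sinh (pi * y))"
    by (rule sin_ii)
  also have "\<i> * of_real y * (of_real pi / (\<i> * of_real (sinh (pi * y)))) = complex_of_real (pi * y / sinh (pi * y))"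
    by (simp add: field_simps)
  finally have "norm (Gamma ?z) ^ 2 = pi * y / sinh (pi * y)"
    by (simp only: of_real_eq_iff)
  then show ?thesis
    by (cases "y \<ge> 0") auto
qed

text \<open>For x = pi \<bar>y\<bar> \<ge> 1 the exponential is at least 2, so sinh x lies between
  exp x / 4 and exp x. In the upper bound the square root of 4 pi \<bar>y\<bar> is replaced by 4 pi
  \<bar>y\<bar>, a loss that \<open>vgrowth\<close> does not see.\<close>

lemma exp_le_norm_Gamma_one_plus_ii:
  assumes "\<bar>y\<bar> \<ge> 1"
  shows "exp (- pi / 2 * \<bar>y\<bar>) \<le> norm (Gamma (1 + \<i> * of_real y))"
    and "norm (Gamma (1 + \<i> * of_real y)) \<le> 4 * pi * \<bar>y\<bar> * exp (- pi / 2 * \<bar>y\<bar>)"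
proof -
  let ?G = "norm (Gamma (1 + \<i> * of_real y))"
  let ?E = "exp (- pi / 2 * \<bar>y\<bar>)" and ?e = "exp (pi * \<bar>y\<bar>)"
  have py: "pi * \<bar>y\<bar> \<ge> 1"
    using mult_mono[of 1 pi 1 "\<bar>y\<bar>"] assms pi_ge_two by auto
  have G: "?G ^ 2 = pi * \<bar>y\<bar> / sinh (pi * \<bar>y\<bar>)"
    using assms by (intro norm_Gamma_one_plus_ii) auto
  have "?E ^ 2 = exp (- (pi * \<bar>y\<bar>))"
    by (simp only: power2_eq_square flip: exp_add) (simp add: field_simps)
  then have E: "?E ^ 2 = inverse ?e"
    by (simp add: exp_minus)
  have e2: "?e \<ge> 2" using py exp_ge_add_one_self[of "pi * \<bar>y\<bar>"] by linarith
  have "inverse ?e \<le> 1" using e2 by (simp add: field_simps)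
  then have i1: "?e / 4 \<le> (?e - inverse ?e) / 2"
    using e2 by simp
  have "(e - i) / 2 \<le> e" if "2 \<le> e" "0 < i" for e i :: real
    using that by simp
  from this[OF e2, of "inverse ?e"] have i2: "(?e - inverse ?e) / 2 \<le> ?e"
    by simp
  have "sinh (pi * \<bar>y\<bar>) = (?e - inverse ?e) / 2"
    by (simp add: sinh_def exp_minus)
  with i1 i2 have s: "?e / 4 \<le> sinh (pi * \<bar>y\<bar>)" "sinh (pi * \<bar>y\<bar>) \<le> ?e"
    by simp_all
  have s0: "sinh (pi * \<bar>y\<bar>) > 0" using s e2 by linarith
  have "?E ^ 2 \<le> ?G ^ 2"
    unfolding G E using s0 s py mult_mono[of "sinh (pi * \<bar>y\<bar>)" ?e 1 "pi * \<bar>y\<bar>"]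
    by (simp add: field_simps)
  then show "?E \<le> ?G"
    by (rule power2_le_imp_le) auto
  have "?G ^ 2 \<le> 4 * pi * \<bar>y\<bar> * ?E ^ 2"
    unfolding G E using s0 s py mult_left_mono[OF s(1), of "\<bar>y\<bar>"] by (simp add: field_simps)
  also have "\<dots> \<le> (4 * pi * \<bar>y\<bar>)\<^sup>2 * ?E ^ 2"
    using py by (intro mult_right_mono self_le_power) auto
  finally have "?G ^ 2 \<le> (4 * pi * \<bar>y\<bar> * ?E) ^ 2"
    by (simp add: power_mult_distrib)
  then show "?G \<le> 4 * pi * \<bar>y\<bar> * ?E"
    by (rule power2_le_imp_le) auto
qed

text \<open>The function depends on \<open>Im s\<close> alone and records \<open>Gamma\<close> on
  the line with real part \<open>Suc m\<close>. By the functional equation each step to the right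
  costs a linear factor, which has rate 0.\<close>

lemma vgrowth_Gamma_Im:
  "vgrowth (- pi / 2) (\<lambda>s. Gamma (of_nat (Suc m) + \<i> * of_real (Im s)))"
proof (induction m)
  case 0
  have "vgrowth (0 + (- pi / 2)) (\<lambda>s. (s + 0) * of_real (exp (- pi / 2 * \<bar>Im s\<bar>)))"
    by (rule vgrowth_mult[OF vgrowth_affine_ident vgrowth_exp_Im])
  then have *: "vgrowth (- pi / 2) (\<lambda>s. s * of_real (exp (- pi / 2 * \<bar>Im s\<bar>)))"
    by simp
  show ?case
  proof (rule vgrowth_comparison, intro exI conjI allI impI)
    show "vgrowth (- pi / 2) (\<lambda>s. s * of_real (exp (- pi / 2 * \<bar>Im s\<bar>)))" by fact
    fix s :: complex assume s: "1 \<le> \<bar>Im s\<bar>"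
    have "norm (Gamma (1 + \<i> * of_real (Im s))) \<le> 4 * pi * \<bar>Im s\<bar> * exp (- pi / 2 * \<bar>Im s\<bar>)"
      by (rule exp_le_norm_Gamma_one_plus_ii(2)[OF s])
    also have "\<dots> \<le> 4 * pi * norm s * exp (- pi / 2 * \<bar>Im s\<bar>)"
      by (intro mult_right_mono mult_left_mono abs_Im_le_cmod) auto
    finally show "norm (Gamma (of_nat (Suc 0) + \<i> * of_real (Im s)))
        \<le> 4 * pi * norm (s * of_real (exp (- pi / 2 * \<bar>Im s\<bar>)))"
      by (simp add: norm_mult)
  qed
next
  case (Suc m)
  have "vgrowth 0 (\<lambda>s. of_nat (Suc m) + \<i> * of_real (Im s))"
  proof (rule vgrowth_comparison, intro exI conjI allI impI)
    show "vgrowth 0 (\<lambda>s. s + 0)" by (rule vgrowth_affine_ident)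
    fix s :: complex assume s: "1 \<le> \<bar>Im s\<bar>"
    have "norm (of_nat (Suc m) + \<i> * of_real (Im s)) \<le> norm (of_nat (Suc m) :: complex) + norm (\<i> * complex_of_real (Im s))"
      by (rule norm_triangle_ineq)
    also have "\<dots> = real (Suc m) * 1 + \<bar>Im s\<bar>"
      by (simp add: norm_mult del: of_nat_Suc)
    also have "\<dots> \<le> real (Suc m) * norm s + norm s"
      using s abs_Im_le_cmod[of s] by (intro add_mono mult_left_mono) auto
    finally show "norm (of_nat (Suc m) + \<i> * of_real (Im s)) \<le> (real (Suc m) + 1) * norm (s + 0)"
      by (simp add: algebra_simps)
  qed
  from vgrowth_mult[OF this Suc]
  have *: "vgrowth (- pi / 2) (\<lambda>s. (of_nat (Suc m) + \<i> * of_real (Im s)) * Gamma (of_nat (Suc m) + \<i> * of_real (Im s)))"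
    by simp
  also have "(\<lambda>s. (of_nat (Suc m) + \<i> * of_real (Im s)) * Gamma (of_nat (Suc m) + \<i> * of_real (Im s)))
     = (\<lambda>s. Gamma (of_nat (Suc (Suc m)) + \<i> * of_real (Im s)))"
  proof
    fix s :: complex
    have "of_nat (Suc m) + \<i> * of_real (Im s) \<notin> \<int>\<^sub>\<le>\<^sub>0"
      by (auto dest!: nonpos_Ints_Re_le)
    from Gamma_plus1[OF this] show "(of_nat (Suc m) + \<i> * of_real (Im s)) * Gamma (of_nat (Suc m) + \<i> * of_real (Im s))
        = Gamma (of_nat (Suc (Suc m)) + \<i> * of_real (Im s))"
      by (simp add: add_ac)
  qed
  finally show ?case .
qed

lemma Gamma_bounded_interval:
  assumes "a > (0::real)"
  obtains K where "K \<ge> 0" "\<And>x. x \<in> {a..b} \<Longrightarrow> \<bar>Gamma x\<bar> \<le> K"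
proof -
  have "continuous_on {a..b} (Gamma :: real \<Rightarrow> real)"
    using assms by (intro continuous_on_Gamma) (auto simp: continuous_on_id elim!: nonpos_Ints_cases)
  then have "bounded (Gamma ` {a..b})"
    by (intro compact_imp_bounded compact_continuous_image) auto
  then show ?thesis
    using that by (auto simp: bounded_pos) (meson less_imp_le atLeastAtMost_iff)
qed

lemma norm_pochhammer_ge_1:
  fixes s :: complex
  assumes "\<bar>Im s\<bar> \<ge> 1"
  shows "norm (pochhammer s n) \<ge> 1"
proof (induction n)
  case (Suc n)
  have "1 * 1 \<le> norm (pochhammer s n) * norm (s + of_nat n)"
    using Suc assms abs_Im_le_cmod[of "s + of_nat n"] by (intro mult_mono) auto
  then show ?case by (simp add: pochhammer_Suc norm_mult)
qed simp

text \<open>A shift by \<open>n\<close> brings the strip to \<open>Re \<ge> 1\<close>. There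
  \<open>norm_Gamma_div_Gamma_mono\<close> compares with the line of real part \<open>Suc m\<close>,
  which lies strictly to the right of the shifted strip; the remaining real Gamma value ranges over
  a compact interval.\<close>

theorem vgrowth_Gamma: "vgrowth (- pi / 2) Gamma"
proof (rule vgrowth_comparison)
  fix x1 x2 :: real
  obtain n :: nat where n: "1 - x1 \<le> real n" using real_arch_simple by blast
  obtain m :: nat where m: "x2 + real n \<le> real m" using real_arch_simple by blast
  let ?m = "real (Suc m)"
  obtain K where K: "K \<ge> 0" "\<And>x. x \<in> {1..?m} \<Longrightarrow> \<bar>Gamma x\<bar> \<le> K"
    using Gamma_bounded_interval[of 1 ?m] by auto
  show "\<exists>g K T. vgrowth (- pi / 2) g \<and> (\<forall>s. x1 \<le> Re s \<longrightarrow> Re s \<le> x2 \<longrightarrow> T \<le> \<bar>Im s\<bar> \<longrightarrow> norm (Gamma s) \<le> K * norm (g s))"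
  proof (intro exI conjI allI impI)
    show "vgrowth (- pi / 2) (\<lambda>s. Gamma (of_nat (Suc m) + \<i> * of_real (Im s)))"
      by (rule vgrowth_Gamma_Im)
    fix s assume s: "x1 \<le> Re s" "Re s \<le> x2" "1 \<le> \<bar>Im s\<bar>"
    let ?w = "s + of_nat n"
    have w: "1 \<le> Re ?w" "Re ?w \<le> real m" using s n m by auto
    have "rGamma s = pochhammer s n * rGamma ?w"
      by (rule pochhammer_rGamma)
    then have "Gamma s = Gamma ?w / pochhammer s n"
      by (simp add: Gamma_def field_simps)
    then have "norm (Gamma s) = norm (Gamma ?w) / norm (pochhammer s n)"
      by (simp add: norm_divide)
    also have "\<dots> \<le> norm (Gamma ?w)"
      using norm_pochhammer_ge_1[OF s(3), of n] by (simp add: divide_le_eq mult_le_cancel_left1)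
    also have "\<dots> \<le> Gamma (Re ?w) / Gamma ?m * norm (Gamma (of_nat (Suc m) + \<i> * of_real (Im s)))"
    proof -
      have "?w + complex_of_real (?m - Re ?w) = of_nat (Suc m) + \<i> * of_real (Im s)"
        by (simp add: complex_eq_iff)
      moreover have "norm (Gamma ?w) / Gamma (Re ?w) \<le> norm (Gamma (?w + of_real (?m - Re ?w))) / Gamma (Re ?w + (?m - Re ?w))"
        using w by (intro norm_Gamma_div_Gamma_mono) auto
      ultimately have "norm (Gamma ?w) / Gamma (Re ?w) \<le> norm (Gamma (of_nat (Suc m) + \<i> * of_real (Im s))) / Gamma ?m"
        by (simp only:) simp
      moreover have "Gamma (Re ?w) > 0" using w by (intro Gamma_real_pos) auto
      ultimately show ?thesis by (simp add: field_simps del: of_nat_Suc)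
    qed
    also have "\<dots> \<le> K / Gamma ?m * norm (Gamma (of_nat (Suc m) + \<i> * of_real (Im s)))"
      using w K(2)[of "Re ?w"] Gamma_real_pos[of ?m]
      by (intro mult_right_mono divide_right_mono) (auto simp del: of_nat_Suc)
    finally show "norm (Gamma s) \<le> K / Gamma ?m * norm (Gamma (of_nat (Suc m) + \<i> * of_real (Im s)))" .
  qed
qed

text \<open>The same comparison with a line to the left: the lower bound for \<open>Gamma\<close> on
  \<open>Re = 1\<close> carries over to the strip shifted to \<open>Re \<ge> 2\<close>, where the
  distance from that line is positive. The shift now multiplies by \<open>pochhammer s n\<close>, of
  rate 0.\<close>

theorem vgrowth_rGamma: "vgrowth (pi / 2) rGamma"
proof (rule vgrowth_comparison)
  fix x1 x2 :: real
  obtain n :: nat where n: "2 - x1 \<le> real n" using real_arch_simple by blast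
  have "continuous_on {2..x2 + real n} (rGamma :: real \<Rightarrow> real)"
    by (intro continuous_on_rGamma continuous_on_id)
  then have "bounded (rGamma ` {2..x2 + real n})"
    by (intro compact_imp_bounded compact_continuous_image) auto
  then obtain K where K: "K > 0" "\<And>x. x \<in> {2..x2 + real n} \<Longrightarrow> \<bar>rGamma x\<bar> \<le> K"
    by (auto simp: bounded_pos)
  have "vgrowth (0 + pi / 2) (\<lambda>s. pochhammer s n * of_real (exp (pi / 2 * \<bar>Im s\<bar>)))"
    by (rule vgrowth_mult[OF vgrowth_pochhammer vgrowth_exp_Im])
  then have *: "vgrowth (pi / 2) (\<lambda>s. pochhammer s n * of_real (exp (pi / 2 * \<bar>Im s\<bar>)))"
    by simp
  show "\<exists>g K T. vgrowth (pi / 2) g \<and> (\<forall>s. x1 \<le> Re s \<longrightarrow> Re s \<le> x2 \<longrightarrow> T \<le> \<bar>Im s\<bar> \<longrightarrow> norm (rGamma s) \<le> K * norm (g s))"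
  proof (intro exI conjI allI impI)
    show "vgrowth (pi / 2) (\<lambda>s. pochhammer s n * of_real (exp (pi / 2 * \<bar>Im s\<bar>)))" by fact
    fix s assume s: "x1 \<le> Re s" "Re s \<le> x2" "1 \<le> \<bar>Im s\<bar>"
    let ?w = "s + of_nat n"
    have w: "2 \<le> Re ?w" "Re ?w \<le> x2 + real n" using s n by auto
    have pos: "Gamma (Re ?w) > 0" using w by (intro Gamma_real_pos) auto
    have "exp (- pi / 2 * \<bar>Im s\<bar>) \<le> norm (Gamma (1 + \<i> * of_real (Im s)))"
      by (rule exp_le_norm_Gamma_one_plus_ii(1)[OF s(3)])
    also have "\<dots> \<le> norm (Gamma ?w) / Gamma (Re ?w)"
    proof -
      have "1 + \<i> * of_real (Im s) + of_real (Re ?w - 1) = ?w"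
        by (simp add: complex_eq_iff)
      moreover have "norm (Gamma (1 + \<i> * of_real (Im s))) / Gamma (Re (1 + \<i> * of_real (Im s))) \<le>
          norm (Gamma (1 + \<i> * of_real (Im s) + of_real (Re ?w - 1))) / Gamma (Re (1 + \<i> * of_real (Im s)) + (Re ?w - 1))"
        using w by (intro norm_Gamma_div_Gamma_mono) auto
      ultimately have "norm (Gamma (1 + \<i> * of_real (Im s))) / Gamma (Re (1 + \<i> * of_real (Im s))) \<le>
          norm (Gamma ?w) / Gamma (Re (1 + \<i> * of_real (Im s)) + (Re ?w - 1))"
        by (simp only:)
      then show ?thesis
        by simp
    qed
    finally have "Gamma (Re ?w) * exp (- pi / 2 * \<bar>Im s\<bar>) \<le> norm (Gamma ?w)"
      using pos by (simp add: field_simps)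
    then have "inverse (norm (Gamma ?w)) \<le> inverse (Gamma (Re ?w) * exp (- pi / 2 * \<bar>Im s\<bar>))"
      using pos by (intro le_imp_inverse_le) auto
    then have "norm (rGamma ?w) \<le> rGamma (Re ?w) * exp (pi / 2 * \<bar>Im s\<bar>)"
      by (simp add: rGamma_inverse_Gamma norm_inverse exp_minus)
    also have "\<dots> \<le> K * exp (pi / 2 * \<bar>Im s\<bar>)"
      using K(2)[of "Re ?w"] w by (intro mult_right_mono) auto
    finally have "norm (pochhammer s n) * norm (rGamma ?w) \<le> norm (pochhammer s n) * (K * exp (pi / 2 * \<bar>Im s\<bar>))"
      by (intro mult_left_mono) auto
    then show "norm (rGamma s) \<le> K * norm (pochhammer s n * of_real (exp (pi / 2 * \<bar>Im s\<bar>)))"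
      by (subst pochhammer_rGamma[of s n]) (simp add: norm_mult mult_ac)
  qed
qed

subsection \<open>Independence of the contour\<close>

lemma vertical_contour_continuous: "vertical_contour \<gamma> c \<Longrightarrow> continuous_on S c"
  by (auto simp: vertical_contour_def piecewise_C1_differentiable_on_def intro: continuous_on_subset)

lemma vertical_contour_eventually:
  assumes "vertical_contour \<gamma> c"
  shows "\<forall>\<^sub>F t in at_top. c t = Complex \<gamma> t \<and> c (- t) = Complex \<gamma> (- t)"
proof -
  obtain T where T: "\<And>t. \<bar>t\<bar> \<ge> T \<Longrightarrow> c t = Complex \<gamma> t"
    using assms by (auto simp: vertical_contour_def)
  show ?thesis
    using eventually_ge_at_top[of "max T 0"] by eventually_elim (auto intro!: T)
qed

text \<open>The range is a compact arc together with two closed vertical rays. Closedness lets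
  components of the complement be treated as path components; the bound on \<open>Re\<close>
  confines the curve to a vertical strip.\<close>

lemma vertical_contour_range:
  assumes "vertical_contour \<gamma> c"
  shows "closed (range c)" "\<exists>X. \<forall>t. \<bar>Re (c t)\<bar> \<le> X"
proof -
  obtain T where T: "\<And>t. \<bar>t\<bar> \<ge> T \<Longrightarrow> c t = Complex \<gamma> t"
    using assms by (auto simp: vertical_contour_def)
  let ?T = "\<bar>T\<bar>"
  have comp: "compact (c ` {- ?T..?T})"
    by (intro compact_continuous_image vertical_contour_continuous[OF assms]) auto
  have cT: "c t \<in> c ` {- ?T..?T} \<or> (Re (c t) = \<gamma> \<and> ?T \<le> \<bar>Im (c t)\<bar>)" for t
  proof (cases "\<bar>t\<bar> \<le> ?T")
    case True
    then have "t \<in> {- ?T..?T}" by auto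
    then show ?thesis by blast
  next
    case False
    then show ?thesis using T[of t] by auto
  qed
  have "s \<in> range c" if "Re s = \<gamma>" "?T \<le> \<bar>Im s\<bar>" for s
    using T[of "Im s"] that by (metis abs_ge_self complex_surj order_trans rangeI)
  with cT have "range c = c ` {- ?T..?T} \<union> ({s. Re s = \<gamma>} \<inter> {s. ?T \<le> \<bar>Im s\<bar>})"
    by blast
  moreover have "closed \<dots>"
    by (intro closed_Un compact_imp_closed comp closed_Int closed_Collect_eq closed_Collect_le continuous_intros)
  ultimately show "closed (range c)" by simp
  obtain b where b: "\<And>s. s \<in> c ` {- ?T..?T} \<Longrightarrow> norm s \<le> b"
    using compact_imp_bounded[OF comp] by (auto simp: bounded_iff)
  have "\<bar>Re (c t)\<bar> \<le> max b \<bar>\<gamma>\<bar>" for t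
    using cT[of t] b[of "c t"] abs_Re_le_cmod[of "c t"] by fastforce
  then show "\<exists>X. \<forall>t. \<bar>Re (c t)\<bar> \<le> X" by blast
qed

text \<open>The piece of \<open>c\<close> over [-T, T], rescaled to the unit interval on which paths
  are parametrised.\<close>

definition trunc_path :: "(real \<Rightarrow> complex) \<Rightarrow> real \<Rightarrow> real \<Rightarrow> complex" where
  "trunc_path c T = c \<circ> (\<lambda>x. (2 * T) *\<^sub>R x + (- T))"

lemma valid_path_trunc_path:
  assumes "vertical_contour \<gamma> c"
  shows "valid_path (trunc_path c T)"
  unfolding valid_path_def trunc_path_def
  by (rule piecewise_C1_differentiable_affine)
     (use assms in \<open>auto simp: vertical_contour_def intro: piecewise_C1_differentiable_on_subset\<close>)

lemma pathstart_trunc_path [simp]: "pathstart (trunc_path c T) = c (- T)"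
  and pathfinish_trunc_path [simp]: "pathfinish (trunc_path c T) = c T"
  and path_image_trunc_path: "path_image (trunc_path c T) \<subseteq> range c"
  by (auto simp: trunc_path_def pathstart_def pathfinish_def path_image_def)

lemma has_contour_integral_trunc_path:
  assumes c: "vertical_contour \<gamma> c" and T: "T > 0"
    and I: "((\<lambda>t. f (c t) * vector_derivative c (at t)) has_integral I) {- T..T}"
  shows "(f has_contour_integral I) (trunc_path c T)"
proof -
  obtain S where S: "finite S" "c C1_differentiable_on (UNIV - S)"
    using c by (auto simp: vertical_contour_def piecewise_C1_differentiable_on_def)
  let ?g = "\<lambda>x. (2 * T) *\<^sub>R x + (- T)"
  let ?F = "\<lambda>t. f (c t) * vector_derivative c (at t)"
  have "((\<lambda>x. ?F (?g x)) has_integral (1 / (\<bar>2 * T\<bar> ^ DIM(real))) *\<^sub>R I)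
      ((\<lambda>x. (1 / (2 * T)) *\<^sub>R x + - ((1 / (2 * T)) *\<^sub>R (- T))) ` cbox (- T) T)"
    using T I by (intro has_integral_affinity) auto
  also have "(\<lambda>x. (1 / (2 * T)) *\<^sub>R x + - ((1 / (2 * T)) *\<^sub>R (- T))) ` cbox (- T) T = {0..1}"
    using T by (subst image_affinity_cbox) (auto simp: field_simps)
  finally have "((\<lambda>x. (2 * T) *\<^sub>R ?F (?g x)) has_integral (2 * T) *\<^sub>R ((1 / (\<bar>2 * T\<bar> ^ DIM(real))) *\<^sub>R I)) {0..1}"
    by (rule has_integral_cmul)
  then have *: "((\<lambda>x. (2 * T) *\<^sub>R ?F (?g x)) has_integral I) {0..1}"
    using T by simp
  show ?thesis
    unfolding has_contour_integral
  proof (rule has_integral_spike_finite[OF _ _ *])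
    \<comment> \<open>The chain rule is applied away from the finitely many break points of
      \<open>c\<close>, which do not affect the integral.\<close>
    show "finite (?g -` S)"
      using T by (intro finite_vimageI[OF S(1)]) (auto intro!: injI)
    fix x assume "x \<in> {0..1} - ?g -` S"
    then have "?g x \<in> UNIV - S" by auto
    then have "(c has_vector_derivative vector_derivative c (at (?g x))) (at (?g x))"
      using S(2) by (simp add: C1_differentiable_on_eq flip: vector_derivative_works)
    moreover have "(?g has_vector_derivative (2 * T)) (at x)"
      by (auto intro!: derivative_eq_intros)
    ultimately have "(trunc_path c T has_vector_derivative (2 * T) *\<^sub>R vector_derivative c (at (?g x))) (at x)"
      unfolding trunc_path_def by (intro vector_diff_chain_at)
    then show "f (trunc_path c T x) * vector_derivative (trunc_path c T) (at x) = (2 * T) *\<^sub>R ?F (?g x)"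
      by (simp add: vector_derivative_at trunc_path_def)
  qed
qed

section \<open>Winding numbers of closed-up contours\<close>

lemma Im_closed_segment:
  assumes "s \<in> closed_segment (Complex a y) (Complex b y)" shows "Im s = y"
proof -
  from assms obtain u where "s = (1 - u) *\<^sub>R Complex a y + u *\<^sub>R Complex b y"
    by (auto simp: in_segment)
  then have "Im s = (1 - u) * y + u * y" by simp
  then show ?thesis by (simp add: algebra_simps)
qed

lemma Re_closed_segment:
  assumes "s \<in> closed_segment (Complex x a) (Complex x b)" shows "Re s = x"
proof -
  from assms obtain u where "s = (1 - u) *\<^sub>R Complex x a + u *\<^sub>R Complex x b"
    by (auto simp: in_segment)
  then have "Re s = (1 - u) * x + u * x" by simp
  then show ?thesis by (simp add: algebra_simps)
qed

lemma Re_closed_segment_le: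
  assumes "s \<in> closed_segment z w" "\<bar>Re z\<bar> \<le> X" "\<bar>Re w\<bar> \<le> X" shows "\<bar>Re s\<bar> \<le> X"
proof -
  have "closed_segment z w \<subseteq> {s. Re s \<le> X} \<inter> {s. Re s \<ge> - X}"
    using assms(2,3)
    by (intro closed_segment_subset convex_Int convex_halfspace_Re_le convex_halfspace_Re_ge) auto
  with assms(1) have "s \<in> {s. Re s \<le> X} \<inter> {s. Re s \<ge> - X}" by blast
  then show ?thesis by auto
qed

text \<open>The middle point may lie outside the segment from \<open>a\<close> to \<open>d\<close>.
  The degenerate triangle through the three points lies in a horizontal line, a convex set avoiding
  \<open>p\<close>, so its winding number is 0.\<close>

lemma winding_number_horizontal:
  assumes "Im p \<noteq> y"
  shows "winding_number (linepath (Complex a y) (Complex d y)) p =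
    winding_number (linepath (Complex a y) (Complex b y)) p + winding_number (linepath (Complex b y) (Complex d y)) p"
proof -
  have p: "p \<notin> closed_segment (Complex u y) (Complex v y)" for u v
    using Im_closed_segment assms by blast
  let ?l = "\<lambda>u v. linepath (Complex u y) (Complex v y)"
  let ?t = "?l a b +++ (?l b d +++ ?l d a)"
  have sub: "closed_segment (Complex u y) (Complex v y) \<subseteq> {s. Im s = y}" for u v
    using Im_closed_segment by blast
  have "convex {s. Im s = y}"
    by (auto simp: convex_def algebra_simps simp flip: distrib_right)
  then have "winding_number ?t p = 0"
    by (rule winding_number_zero_outside[rotated])
       (use sub assms in \<open>auto simp: path_image_join\<close>)
  moreover have "winding_number ?t p = winding_number (?l a b) p + (winding_number (?l b d) p + winding_number (?l d a) p)"
    using p by (simp add: winding_number_join path_image_join)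
  moreover have "winding_number (?l d a) p = - winding_number (?l a d) p"
    using winding_number_reversepath[of "?l a d" p] p by simp
  ultimately show ?thesis by (simp add: algebra_simps)
qed

text \<open>A point that can be joined to \<open>x\<^sub>0\<close> without crossing the contour has the same winding
  number as \<open>x\<^sub>0\<close>, which lies outside the convex set containing the closed-up contour.\<close>

lemma winding_number_trunc_path_closed_up:
  assumes c: "vertical_contour \<gamma> c"
    and conn: "connected_component (- range c) (of_real x0) p"
    and H: "convex H" "of_real x0 \<notin> H" "range c \<subseteq> H"
  shows "\<exists>B. \<forall>T\<ge>B. \<forall>X. \<bar>X\<bar> \<ge> B \<longrightarrow> (\<forall>r. Complex X r \<in> H) \<longrightarrow>
    winding_number (trunc_path c T) p + winding_number (linepath (Complex \<gamma> T) (Complex X T)) p +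
    winding_number (linepath (Complex X T) (Complex X (- T))) p +
    winding_number (linepath (Complex X (- T)) (Complex \<gamma> (- T))) p = 0"
proof -
  have "open (- range c)"
    using vertical_contour_range(1)[OF c] by auto
  with conn have "path_component (- range c) (of_real x0) p"
    by (simp add: open_path_connected_component)
  then obtain g where g: "path g" "path_image g \<subseteq> - range c" "pathstart g = of_real x0" "pathfinish g = p"
    by (auto simp: path_component_def)
  obtain b where b: "\<And>s. s \<in> path_image g \<Longrightarrow> norm s \<le> b"
    using compact_imp_bounded[OF compact_path_image[OF g(1)]] by (auto simp: bounded_iff)
  obtain T0 where T0: "\<And>t. t \<ge> T0 \<Longrightarrow> c t = Complex \<gamma> t \<and> c (- t) = Complex \<gamma> (- t)"
    using vertical_contour_eventually[OF c] by (auto simp: eventually_at_top_linorder)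
  \<comment> \<open>\<open>b\<close> bounds the path \<open>g\<close> from \<open>x0\<close> to
    \<open>p\<close>, so beyond \<open>B\<close> the three closing segments cannot meet
    \<open>g\<close>.\<close>
  define B where "B = max (max T0 1) (b + 1)"
  show ?thesis
  proof (intro exI[of _ B] allI impI)
    fix T X assume T: "T \<ge> B" and X: "\<bar>X\<bar> \<ge> B" and XH: "\<forall>r. Complex X r \<in> H"
    let ?l1 = "linepath (Complex \<gamma> T) (Complex X T)"
    let ?l2 = "linepath (Complex X T) (Complex X (- T))"
    let ?l3 = "linepath (Complex X (- T)) (Complex \<gamma> (- T))"
    let ?L = "trunc_path c T +++ (?l1 +++ (?l2 +++ ?l3))"
    have cT: "c T = Complex \<gamma> T" "c (- T) = Complex \<gamma> (- T)"
      using T T0[of T] by (auto simp: B_def)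
    have p: "p \<in> path_image g" "of_real x0 \<in> path_image g"
      using pathfinish_in_path_image[of g] pathstart_in_path_image[of g] g by auto
    have far: "s \<notin> path_image g" if "\<bar>Re s\<bar> \<ge> B \<or> \<bar>Im s\<bar> \<ge> B" for s
      using b[of s] that abs_Re_le_cmod[of s] abs_Im_le_cmod[of s] by (auto simp: B_def)
    have d1: "path_image g \<inter> path_image ?l1 = {}" "path_image g \<inter> path_image ?l3 = {}"
      using far T by (fastforce dest: Im_closed_segment)+
    have d2: "path_image g \<inter> path_image ?l2 = {}"
      using far X by (fastforce dest: Re_closed_segment)
    have d3: "path_image g \<inter> path_image (trunc_path c T) = {}"
      using g(2) path_image_trunc_path[of c T] by blast
    have path: "path (trunc_path c T)"
      using valid_path_trunc_path[OF c] by (rule valid_path_imp_path)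
    have im: "path_image ?L = path_image (trunc_path c T) \<union> (path_image ?l1 \<union> (path_image ?l2 \<union> path_image ?l3))"
      by (simp add: path_image_join cT)
    have "Complex \<gamma> T \<in> H" "Complex \<gamma> (- T) \<in> H"
      using H(3) cT by (metis rangeI subsetD)+
    then have "path_image ?l1 \<subseteq> H" "path_image ?l2 \<subseteq> H" "path_image ?l3 \<subseteq> H"
      using XH H(1) by (simp_all add: closed_segment_subset)
    then have "path_image ?L \<subseteq> H"
      unfolding im using H(3) path_image_trunc_path[of c T] by blast
    then have "winding_number ?L (of_real x0) = 0"
      using H path by (intro winding_number_zero_outside[of ?L H]) (auto simp: cT)
    \<comment> \<open>\<open>g\<close> misses the whole loop, and the winding number is constant on
      connected sets off the loop.\<close>
    moreover have "winding_number ?L p = winding_number ?L (of_real x0)"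
      using d1 d2 d3 path p im
      by (intro winding_number_eq[of _ _ "path_image g"]) (auto simp: cT connected_path_image g)
    moreover have "winding_number ?L p = winding_number (trunc_path c T) p +
        (winding_number ?l1 p + (winding_number ?l2 p + winding_number ?l3 p))"
    proof -
      have "p \<notin> path_image (trunc_path c T)" "p \<notin> path_image ?l1" "p \<notin> path_image ?l2" "p \<notin> path_image ?l3"
        using d1 d2 d3 p by blast+
      then show ?thesis
        using path by (simp add: winding_number_join path_image_join cT del: path_image_linepath)
    qed
    ultimately show "winding_number (trunc_path c T) p + winding_number ?l1 p + winding_number ?l2 p + winding_number ?l3 p = 0"
      by (simp add: add_ac)
  qed
qed

definition trunc_loop ::
  "real \<Rightarrow> (real \<Rightarrow> complex) \<Rightarrow> real \<Rightarrow> (real \<Rightarrow> complex) \<Rightarrow> real \<Rightarrow> real \<Rightarrow> complex" where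
  "trunc_loop \<gamma> c \<gamma>' c' T =
     trunc_path c T +++ (linepath (Complex \<gamma> T) (Complex \<gamma>' T) +++
     (reversepath (trunc_path c' T) +++ linepath (Complex \<gamma>' (- T)) (Complex \<gamma> (- T))))"

text \<open>\<open>connected_component S\<close> relates only points of S, so a point that has a
  side is not on the curve.\<close>

lemma side_not_range:
  assumes "p \<in> left_side c \<or> p \<in> right_side c"
  shows "p \<notin> range c"
proof -
  from assms obtain x :: real where "connected_component (- range c) (of_real x) p"
    unfolding left_side_def right_side_def mem_Collect_eq
    using eventually_happens'[OF trivial_limit_at_bot_linorder] eventually_happens'[OF trivial_limit_at_top_linorder]
    by metis
  then show ?thesis using connected_component_in by fastforce
qed

text \<open>Both truncated contours are closed up through the same far vertical line
  \<open>Re = X\<close>, which gives winding number 0 for each. In the difference the detour through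
  that line cancels and the loop remains.\<close>

lemma winding_number_trunc_loop:
  assumes c: "vertical_contour \<gamma> c" and c': "vertical_contour \<gamma>' c'"
    and side: "p \<in> left_side c \<and> p \<in> left_side c' \<or> p \<in> right_side c \<and> p \<in> right_side c'"
  shows "\<forall>\<^sub>F T in at_top. p \<notin> path_image (trunc_loop \<gamma> c \<gamma>' c' T) \<and>
           winding_number (trunc_loop \<gamma> c \<gamma>' c' T) p = 0"
proof -
  obtain X1 where X1: "\<And>t. \<bar>Re (c t)\<bar> \<le> X1"
    using vertical_contour_range(2)[OF c] by blast
  obtain X2 where X2: "\<And>t. \<bar>Re (c' t)\<bar> \<le> X2"
    using vertical_contour_range(2)[OF c'] by blast
  define M where "M = max X1 X2"
  have M: "\<bar>Re (c t)\<bar> \<le> M" "\<bar>Re (c' t)\<bar> \<le> M" for t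
    using X1[of t] X2[of t] by (auto simp: M_def)
  have pc: "p \<notin> range c" "p \<notin> range c'"
    using side side_not_range[of p c] side_not_range[of p c'] by blast+
  \<comment> \<open>\<open>H\<close> is the half-plane bounded by the vertical line through
    \<open>x0\<close> that contains both curves. The detour \<open>Re = X\<close> is taken deep
    inside \<open>H\<close>, on the side of the curves opposite to \<open>x0\<close>.\<close>
  have "\<exists>x0 H. connected_component (- range c) (of_real x0) p \<and> connected_component (- range c') (of_real x0) p \<and>
      convex H \<and> of_real x0 \<notin> H \<and> range c \<subseteq> H \<and> range c' \<subseteq> H \<and> (\<forall>B. \<exists>X. \<bar>X\<bar> \<ge> B \<and> (\<forall>r. Complex X r \<in> H))"
    using side
  proof
    assume "p \<in> left_side c \<and> p \<in> left_side c'"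
    then have "\<forall>\<^sub>F x in at_bot. connected_component (- range c) (complex_of_real x) p"
      "\<forall>\<^sub>F x in at_bot. connected_component (- range c') (complex_of_real x) p"
      by (auto simp: left_side_def)
    then have "\<forall>\<^sub>F x in at_bot. connected_component (- range c) (complex_of_real x) p \<and>
        connected_component (- range c') (of_real x) p \<and> x < - M"
      by (intro eventually_conj eventually_gt_at_bot)
    then obtain x where x: "connected_component (- range c) (of_real x) p" "connected_component (- range c') (of_real x) p" "x < - M"
      using eventually_happens'[OF trivial_limit_at_bot_linorder] by blast
    have "Re (c t) > x \<and> Re (c' t) > x" for t
      using M[of t] x(3) by auto
    then have "range c \<subseteq> {s. Re s > x} \<and> range c' \<subseteq> {s. Re s > x}"
      by auto
    moreover have "\<exists>X. \<bar>X\<bar> \<ge> B \<and> (\<forall>r. Complex X r \<in> {s. Re s > x})" for B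
      by (intro exI[of _ "max B x + 1"]) auto
    ultimately show ?thesis
      using x by (intro exI[of _ x] exI[of _ "{s. Re s > x}"]) (auto simp: convex_halfspace_Re_gt)
  next
    assume "p \<in> right_side c \<and> p \<in> right_side c'"
    then have "\<forall>\<^sub>F x in at_top. connected_component (- range c) (complex_of_real x) p"
      "\<forall>\<^sub>F x in at_top. connected_component (- range c') (complex_of_real x) p"
      by (auto simp: right_side_def)
    then have "\<forall>\<^sub>F x in at_top. connected_component (- range c) (complex_of_real x) p \<and>
        connected_component (- range c') (of_real x) p \<and> x > M"
      by (intro eventually_conj eventually_gt_at_top)
    then obtain x where x: "connected_component (- range c) (of_real x) p" "connected_component (- range c') (of_real x) p" "x > M"
      using eventually_happens'[OF trivial_limit_at_top_linorder] by blast
    have "Re (c t) < x \<and> Re (c' t) < x" for t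
      using M[of t] x(3) by auto
    then have "range c \<subseteq> {s. Re s < x} \<and> range c' \<subseteq> {s. Re s < x}"
      by auto
    moreover have "\<exists>X. \<bar>X\<bar> \<ge> B \<and> (\<forall>r. Complex X r \<in> {s. Re s < x})" for B
      by (intro exI[of _ "- (\<bar>B\<bar> + \<bar>x\<bar> + 1)"]) auto
    ultimately show ?thesis
      using x by (intro exI[of _ x] exI[of _ "{s. Re s < x}"]) (auto simp: convex_halfspace_Re_lt)
  qed
  then obtain x0 H where x0: "connected_component (- range c) (of_real x0) p" "connected_component (- range c') (of_real x0) p"
    and H: "convex H" "of_real x0 \<notin> H" "range c \<subseteq> H" "range c' \<subseteq> H"
    and HX: "\<And>B. \<exists>X. \<bar>X\<bar> \<ge> B \<and> (\<forall>r. Complex X r \<in> H)"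
    by metis
  from winding_number_trunc_path_closed_up[OF c x0(1) H(1,2,3)] obtain B1 where B1: "\<And>T X. T \<ge> B1 \<Longrightarrow> \<bar>X\<bar> \<ge> B1 \<Longrightarrow> \<forall>r. Complex X r \<in> H \<Longrightarrow>
    winding_number (trunc_path c T) p + winding_number (linepath (Complex \<gamma> T) (Complex X T)) p +
    winding_number (linepath (Complex X T) (Complex X (- T))) p +
    winding_number (linepath (Complex X (- T)) (Complex \<gamma> (- T))) p = 0"
    by blast
  from winding_number_trunc_path_closed_up[OF c' x0(2) H(1,2,4)] obtain B2 where B2: "\<And>T X. T \<ge> B2 \<Longrightarrow> \<bar>X\<bar> \<ge> B2 \<Longrightarrow> \<forall>r. Complex X r \<in> H \<Longrightarrow>
    winding_number (trunc_path c' T) p + winding_number (linepath (Complex \<gamma>' T) (Complex X T)) p +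
    winding_number (linepath (Complex X T) (Complex X (- T))) p +
    winding_number (linepath (Complex X (- T)) (Complex \<gamma>' (- T))) p = 0"
    by blast
  obtain X where X: "\<bar>X\<bar> \<ge> max B1 B2" "\<forall>r. Complex X r \<in> H"
    using HX by blast
  show ?thesis
    using vertical_contour_eventually[OF c] vertical_contour_eventually[OF c']
      eventually_ge_at_top[of B1] eventually_ge_at_top[of B2] eventually_gt_at_top[of "\<bar>Im p\<bar>"]
  proof eventually_elim
    case (elim T)
    have np: "p \<notin> closed_segment (Complex u T) (Complex v T)" "p \<notin> closed_segment (Complex u (- T)) (Complex v (- T))" for u v
      using elim(5) by (auto dest!: Im_closed_segment)
    have pt: "p \<notin> path_image (trunc_path c T)" "p \<notin> path_image (trunc_path c' T)"
      using pc path_image_trunc_path by blast+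
    have pth: "path (trunc_path c T)" "path (trunc_path c' T)"
      using valid_path_trunc_path[OF c] valid_path_trunc_path[OF c'] by (auto intro: valid_path_imp_path)
    \<comment> \<open>\<open>x\<close>, \<open>v\<close> and \<open>w\<close> are the three sides of
      the detour through \<open>Re = X\<close>; \<open>g\<close> and \<open>h\<close> are the
      horizontal edges of the loop.\<close>
    have cancel: "a + (g + (- b + h)) = 0" if "a + (g + x) + v + (w + h) = 0" "b + x + v + w = 0" for a b g h v w x :: complex
      using that by algebra
    have "winding_number (trunc_loop \<gamma> c \<gamma>' c' T) p = winding_number (trunc_path c T) p +
        (winding_number (linepath (Complex \<gamma> T) (Complex \<gamma>' T)) p + (- winding_number (trunc_path c' T) p +
         winding_number (linepath (Complex \<gamma>' (- T)) (Complex \<gamma> (- T))) p))"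
      unfolding trunc_loop_def using pt np pth elim
      by (simp add: winding_number_join path_image_join winding_number_reversepath)
    also have "\<dots> = 0"
      using B1[of T X] B2[of T X] X elim
        winding_number_horizontal[of p T \<gamma> X \<gamma>'] winding_number_horizontal[of p "-T" X \<gamma> \<gamma>']
      by (intro cancel[of _ _ "winding_number (linepath (Complex \<gamma>' T) (Complex X T)) p"
           "winding_number (linepath (Complex X T) (Complex X (- T))) p"
           "winding_number (linepath (Complex X (- T)) (Complex \<gamma>' (- T))) p"]) auto
    finally show ?case
      unfolding trunc_loop_def using pt np elim by (simp add: path_image_join)
  qed
qed

text \<open>Cauchy's theorem makes the integral over \<open>trunc_loop\<close> vanish for large T,
  and the decay of \<open>f\<close> removes the two horizontal edges in the limit. What remains is
  the difference of the two line integrals.\<close>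

theorem line_integral_unique:
  assumes c: "vertical_contour \<gamma> c" and c': "vertical_contour \<gamma>' c'"
    and P: "closed P" "\<And>X. finite {p \<in> P. \<bar>Re p\<bar> \<le> X}"
    and holo: "f holomorphic_on (- P)"
    and growth: "vgrowth \<delta> f" "\<delta> < 0"
    and sides: "\<And>p. p \<in> P \<Longrightarrow> p \<in> left_side c \<and> p \<in> left_side c' \<or> p \<in> right_side c \<and> p \<in> right_side c'"
    and I: "has_line_integral f I c" and I': "has_line_integral f I' c'"
  shows "I = I'"
proof -
  obtain X1 where X1: "\<And>t. \<bar>Re (c t)\<bar> \<le> X1"
    using vertical_contour_range(2)[OF c] by blast
  obtain X2 where X2: "\<And>t. \<bar>Re (c' t)\<bar> \<le> X2"
    using vertical_contour_range(2)[OF c'] by blast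
  define M where "M = max X1 X2"
  have M: "\<bar>Re (c t)\<bar> \<le> M" "\<bar>Re (c' t)\<bar> \<le> M" for t
    using X1[of t] X2[of t] by (auto simp: M_def)
  have \<gamma>: "\<bar>\<gamma>\<bar> \<le> M" "\<bar>\<gamma>'\<bar> \<le> M"
  proof -
    have "\<forall>\<^sub>F t in at_top. c t = Complex \<gamma> t \<and> c' t = Complex \<gamma>' t"
      using vertical_contour_eventually[OF c] vertical_contour_eventually[OF c'] by eventually_elim auto
    then obtain t where "c t = Complex \<gamma> t" "c' t = Complex \<gamma>' t"
      using eventually_happens'[OF trivial_limit_at_top_linorder] by blast
    with M[of t] show "\<bar>\<gamma>\<bar> \<le> M" "\<bar>\<gamma>'\<bar> \<le> M" by auto
  qed
  \<comment> \<open>The rate \<delta> / 2 is larger than \<delta>, as \<open>vgrowth\<close>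
    demands, and still negative.\<close>
  obtain C T0 where C: "C \<ge> 0"
    "\<And>s. - M \<le> Re s \<Longrightarrow> Re s \<le> M \<Longrightarrow> T0 \<le> \<bar>Im s\<bar> \<Longrightarrow> norm (f s) \<le> C * exp (\<delta> / 2 * \<bar>Im s\<bar>)"
    using growth by (elim vgrowthE[where e = "\<delta> / 2" and ?x1.0 = "- M" and ?x2.0 = M]) auto
  \<comment> \<open>For the gauge integral over the whole line, integrals over large intervals
    converge by definition. Absolute convergence is not assumed of the given line integrals.\<close>
  have tail: "\<forall>\<^sub>F T in at_top. \<exists>z. ((\<lambda>t. f (e t) * vector_derivative e (at t)) has_integral z) {- T..T} \<and> norm (z - J) < \<epsilon>"
    if "has_line_integral f J e" "\<epsilon> > 0" for e J \<epsilon>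
  proof -
    from that(1) have int: "(\<lambda>t. f (e t) * vector_derivative e (at t)) integrable_on cbox a b" for a b
      unfolding has_line_integral_def has_integral_alt'[of _ _ UNIV] by simp
    from that(1) have "\<forall>\<epsilon>>0. \<exists>B>0. \<forall>a b. ball 0 B \<subseteq> cbox a b \<longrightarrow>
        norm (integral (cbox a b) (\<lambda>t. f (e t) * vector_derivative e (at t)) - J) < \<epsilon>"
      unfolding has_line_integral_def has_integral_alt'[of _ _ UNIV] by simp
    with that(2) obtain B where B: "\<And>a b. ball 0 B \<subseteq> cbox a b \<Longrightarrow>
        norm (integral (cbox a b) (\<lambda>t. f (e t) * vector_derivative e (at t)) - J) < \<epsilon>"
      by meson
    show ?thesis
      using eventually_ge_at_top[of B]
    proof eventually_elim
      case (elim T)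
      have "ball 0 B \<subseteq> cbox (- T) T"
        using elim by (auto simp: abs_le_iff)
      from B[OF this] integrable_integral[OF int[of "- T" T]] show ?case by auto
    qed
  qed
  have small: "\<forall>\<^sub>F T in at_top. C * exp (\<delta> / 2 * T) * (2 * M) < \<epsilon>" if "\<epsilon> > 0" for \<epsilon>
  proof -
    have "((\<lambda>T. C * exp (\<delta> / 2 * T) * (2 * M)) \<longlongrightarrow> C * 0 * (2 * M)) at_top"
      using growth(2)
      by (intro tendsto_intros filterlim_compose[OF exp_at_bot]
          filterlim_tendsto_neg_mult_at_bot[OF tendsto_const _ filterlim_ident]) auto
    then show ?thesis
      using that by (auto intro: order_tendstoD)
  qed
  \<comment> \<open>Each pole has its own threshold for T; a common one exists because only finitely
    many poles lie in the strip \<bar>Re s\<bar> \<le> M.\<close>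
  have wn: "\<forall>\<^sub>F T in at_top. \<forall>p\<in>{p \<in> P. \<bar>Re p\<bar> \<le> M}. p \<notin> path_image (trunc_loop \<gamma> c \<gamma>' c' T) \<and>
           winding_number (trunc_loop \<gamma> c \<gamma>' c' T) p = 0"
    by (intro eventually_ball_finite P ballI winding_number_trunc_loop[OF c c'] sides) auto
  have "norm (I - I') \<le> \<epsilon>" if "\<epsilon> > 0" for \<epsilon>
  proof -
    \<comment> \<open>Two tails and two horizontal edges share \<epsilon>.\<close>
    have e4: "\<epsilon> / 4 > 0" using that by simp
    obtain T where elim:
      "\<exists>z. ((\<lambda>t. f (c t) * vector_derivative c (at t)) has_integral z) {- T..T} \<and> norm (z - I) < \<epsilon> / 4"
      "\<exists>z. ((\<lambda>t. f (c' t) * vector_derivative c' (at t)) has_integral z) {- T..T} \<and> norm (z - I') < \<epsilon> / 4"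
      "C * exp (\<delta> / 2 * T) * (2 * M) < \<epsilon> / 4"
      "\<forall>p\<in>{p \<in> P. \<bar>Re p\<bar> \<le> M}. p \<notin> path_image (trunc_loop \<gamma> c \<gamma>' c' T) \<and>
           winding_number (trunc_loop \<gamma> c \<gamma>' c' T) p = 0"
      "c T = Complex \<gamma> T \<and> c (- T) = Complex \<gamma> (- T)" "c' T = Complex \<gamma>' T \<and> c' (- T) = Complex \<gamma>' (- T)"
      "T0 \<le> T" "0 < T"
      using eventually_happens'[OF trivial_limit_at_top_linorder
          eventually_conj[OF tail[OF I e4] eventually_conj[OF tail[OF I' e4] eventually_conj[OF small[OF e4]
          eventually_conj[OF wn eventually_conj[OF vertical_contour_eventually[OF c]
          eventually_conj[OF vertical_contour_eventually[OF c']
          eventually_conj[OF eventually_ge_at_top[of T0] eventually_gt_at_top[of 0]]]]]]]]]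
      by (elim exE conjE) blast
    let ?L = "trunc_loop \<gamma> c \<gamma>' c' T"
    let ?l1 = "linepath (Complex \<gamma> T) (Complex \<gamma>' T)" and ?l2 = "linepath (Complex \<gamma>' (- T)) (Complex \<gamma> (- T))"
    obtain J where J: "((\<lambda>t. f (c t) * vector_derivative c (at t)) has_integral J) {- T..T}" "norm (J - I) < \<epsilon> / 4"
      using elim \<open>\<epsilon> > 0\<close> by auto
    obtain J' where J': "((\<lambda>t. f (c' t) * vector_derivative c' (at t)) has_integral J') {- T..T}" "norm (J' - I') < \<epsilon> / 4"
      using elim \<open>\<epsilon> > 0\<close> by auto
    have ends: "c T = Complex \<gamma> T" "c (- T) = Complex \<gamma> (- T)" "c' T = Complex \<gamma>' T" "c' (- T) = Complex \<gamma>' (- T)"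
      using elim by auto
    have vp: "valid_path (trunc_path c T)" "valid_path (trunc_path c' T)"
      using valid_path_trunc_path c c' by auto
    have vL: "valid_path ?L"
      unfolding trunc_loop_def using vp ends by (intro valid_path_join) auto
    have im: "path_image ?L = path_image (trunc_path c T) \<union> (path_image ?l1 \<union> (path_image (trunc_path c' T) \<union> path_image ?l2))"
      by (simp add: trunc_loop_def path_image_join ends)
    have seg: "\<bar>Re s\<bar> \<le> M \<and> \<bar>Im s\<bar> = T" if "s \<in> path_image ?l1 \<union> path_image ?l2" for s
    proof -
      have "\<bar>Re s\<bar> \<le> M"
        using that \<gamma> by (auto intro: Re_closed_segment_le)
      moreover have "\<bar>Im s\<bar> = T"
        using that \<open>T > 0\<close> by (auto dest!: Im_closed_segment)
      ultimately show ?thesis by blast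
    qed
    have strip: "path_image ?L \<subseteq> {s. Re s \<le> M} \<inter> {s. Re s \<ge> - M}"
    proof
      fix s assume "s \<in> path_image ?L"
      then have "\<bar>Re s\<bar> \<le> M"
        unfolding im using seg M path_image_trunc_path[of c T] path_image_trunc_path[of c' T] by blast
      then show "s \<in> {s. Re s \<le> M} \<inter> {s. Re s \<ge> - M}" by auto
    qed
    \<comment> \<open>Poles outside the strip need no largeness of T: the loop lies in the convex
      strip.\<close>
    have P0: "p \<notin> path_image ?L \<and> winding_number ?L p = 0" if "p \<in> P" for p
    proof (cases "\<bar>Re p\<bar> \<le> M")
      case True
      with elim that show ?thesis by blast
    next
      case False
      have "path ?L" "pathfinish ?L = pathstart ?L"
        using vL by (auto intro: valid_path_imp_path simp: trunc_loop_def ends)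
      then have "winding_number ?L p = 0"
        using False strip
        by (intro winding_number_zero_outside[where s = "{s. Re s \<le> M} \<inter> {s. Re s \<ge> - M}"] convex_Int
             convex_halfspace_Re_le convex_halfspace_Re_ge) auto
      moreover have "p \<notin> {s. Re s \<le> M} \<inter> {s. Re s \<ge> - M}"
        using False by auto
      ultimately show ?thesis using strip by blast
    qed
    have zero: "(f has_contour_integral 0) ?L"
      using P0 P holo vL
      by (intro Cauchy_theorem_global[of "- P"]) (auto simp: trunc_loop_def ends open_Compl)
    have cont: "continuous_on S f" if "S \<subseteq> path_image ?L" for S
      using holo P0 that by (intro holomorphic_on_imp_continuous_on holomorphic_on_subset[OF holo]) auto
    define h1 h2 where "h1 = contour_integral ?l1 f" and "h2 = contour_integral ?l2 f"
    have h: "(f has_contour_integral h1) ?l1" "(f has_contour_integral h2) ?l2"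
      unfolding h1_def h2_def using im
      by (auto intro!: has_contour_integral_integral contour_integrable_continuous_linepath cont)
    have "(f has_contour_integral (J + (h1 + (- J' + h2)))) ?L"
      unfolding trunc_loop_def using vp ends J J' \<open>T > 0\<close>
      by (intro has_contour_integral_join has_contour_integral_reversepath h
           has_contour_integral_trunc_path[OF c] has_contour_integral_trunc_path[OF c'] valid_path_join) auto
    with zero have eq: "J + (h1 + (- J' + h2)) = 0"
      using contour_integral_unique by metis
    have bnd: "norm (f s) \<le> C * exp (\<delta> / 2 * T)" if "s \<in> path_image ?l1 \<union> path_image ?l2" for s
      using C(2)[of s] seg[OF that] elim by (auto simp: abs_le_iff)
    have "norm h1 \<le> C * exp (\<delta> / 2 * T) * norm (Complex \<gamma>' T - Complex \<gamma> T)"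
      using bnd C by (intro has_contour_integral_bound_linepath[OF h(1)]) auto
    also have "\<dots> \<le> C * exp (\<delta> / 2 * T) * (2 * M)"
      using C \<gamma> by (intro mult_left_mono) (auto simp: complex_diff cmod_eq_Re)
    finally have n1: "norm h1 < \<epsilon> / 4" using elim \<open>\<epsilon> > 0\<close> by linarith
    have "norm h2 \<le> C * exp (\<delta> / 2 * T) * norm (Complex \<gamma> (- T) - Complex \<gamma>' (- T))"
      using bnd C by (intro has_contour_integral_bound_linepath[OF h(2)]) auto
    also have "\<dots> \<le> C * exp (\<delta> / 2 * T) * (2 * M)"
      using C \<gamma> by (intro mult_left_mono) (auto simp: complex_diff cmod_eq_Re)
    finally have n2: "norm h2 < \<epsilon> / 4" using elim \<open>\<epsilon> > 0\<close> by linarith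
    have "I - I' = (J' - I') - (J - I) - h1 - h2"
      using eq by (simp add: algebra_simps)
    also have "norm \<dots> \<le> norm (J' - I') + norm (J - I) + norm h1 + norm h2"
      by (intro order_trans[OF norm_triangle_ineq4] add_mono order_refl)
    finally show ?thesis
      using n1 n2 J(2) J'(2) by linarith
  qed
  then have "norm (I - I') \<le> 0"
    by (rule field_le_epsilon[of _ 0, simplified])
  then show ?thesis by simp
qed

subsection \<open>A contour separating real poles\<close>

text \<open>Newton's step: add a multiple of the product that vanishes at the old nodes. It serves
  to prescribe on which side of the real axis the contour passes each pole, by a function that is
  smooth.\<close>

lemma ex_poly_interpolation:
  fixes f :: "real \<Rightarrow> real"
  assumes "finite S"
  shows "\<exists>p. \<forall>x\<in>S. poly p x = f x"
  using assms
proof induction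
  case (insert x S)
  then obtain p where p: "\<forall>y\<in>S. poly p y = f y" by auto
  define q where "q = (\<Prod>s\<in>S. [:- s, 1:])"
  have q: "poly q y = (\<Prod>s\<in>S. y - s)" for y
    by (simp add: q_def poly_prod)
  have "poly q x \<noteq> 0" "\<And>y. y \<in> S \<Longrightarrow> poly q y = 0"
    using insert by (auto simp: q)
  then have "\<forall>y\<in>insert x S. poly (p + smult ((f x - poly p x) / poly q x) q) y = f y"
    using p by auto
  then show ?case by blast
qed auto

lemma connected_component_segment:
  fixes x y :: complex
  shows "closed_segment x y \<subseteq> S \<Longrightarrow> connected_component S x y"
  unfolding connected_component_def by (rule exI[of _ "closed_segment x y"]) auto

lemma closed_segment_Complex:
  assumes "s \<in> closed_segment (Complex x y) (Complex x' y')"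
  obtains u where "0 \<le> u" "u \<le> 1" "Re s = x + u * (x' - x)" "Im s = y + u * (y' - y)"
proof -
  from assms obtain u where u: "0 \<le> u" "u \<le> 1" "s = (1 - u) *\<^sub>R Complex x y + u *\<^sub>R Complex x' y'"
    by (auto simp: in_segment)
  from u(3) have "Re s = (1 - u) * x + u * x'" "Im s = (1 - u) * y + u * y'"
    by simp_all
  with u that[of u] show ?thesis by (simp add: algebra_simps)
qed

text \<open>The curve follows the line \<open>Re s = a\<close> up to the real axis, continues as the graph of a small
  function \<open>q\<close> until \<open>Re s = a + w\<close>, and returns along the segment to \<open>Complex a 2\<close>. Points of the
  real interval lie to its left where \<open>q\<close> is negative and to its right where \<open>q\<close> is positive.\<close>

definition zigzag :: "real \<Rightarrow> real \<Rightarrow> real poly \<Rightarrow> real \<Rightarrow> complex" where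
  "zigzag a w q t =
     (if t \<le> 0 then Complex a t
      else if t \<le> 1 then Complex (a + t * w) (poly q t)
      else if t \<le> 2 then Complex (a + (2 - t) * w) (2 * (t - 1))
      else Complex a t)"

text \<open>An explicit Borel function, with arbitrary values at the break points 0, 1 and 2, to
  replace \<open>vector_derivative\<close> in Lebesgue integrals.\<close>

definition zigzag_deriv :: "real \<Rightarrow> real poly \<Rightarrow> real \<Rightarrow> complex" where
  "zigzag_deriv w q t =
     (if t \<le> 0 then \<i>
      else if t \<le> 1 then of_real w + \<i> * of_real (poly (pderiv q) t)
      else if t \<le> 2 then - of_real w + 2 * \<i>
      else \<i>)"

lemma zigzag_has_vector_derivative:
  assumes "t \<notin> {0, 1, 2}"
  shows "(zigzag a w q has_vector_derivative zigzag_deriv w q t) (at t)"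
proof -
  have C: "((\<lambda>t. Complex (f t) (g t)) has_vector_derivative (of_real f' + \<i> * of_real g')) (at t)"
    if "(f has_real_derivative f') (at t)" "(g has_real_derivative g') (at t)" for f g f' g'
    unfolding Complex_eq
    by (intro has_vector_derivative_add has_vector_derivative_mult_right has_vector_derivative_of_real that)
  consider "t < 0" | "0 < t" "t < 1" | "1 < t" "t < 2" | "t > 2"
    using assms by fastforce
  then show ?thesis
  proof cases
    case 1
    have "((\<lambda>t. Complex a t) has_vector_derivative (of_real 0 + \<i> * of_real 1)) (at t)"
      by (rule C) (auto intro!: derivative_eq_intros)
    then show ?thesis using 1
      by (auto simp: zigzag_def zigzag_deriv_def
          intro: has_vector_derivative_transform_within_open[where S = "{..<0}"])
  next
    case 2
    have "((\<lambda>t. Complex (a + t * w) (poly q t)) has_vector_derivative (of_real w + \<i> * of_real (poly (pderiv q) t))) (at t)"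
      by (rule C) (auto intro!: derivative_eq_intros)
    then show ?thesis using 2
      by (auto simp: zigzag_def zigzag_deriv_def
          intro: has_vector_derivative_transform_within_open[where S = "{0<..<1}"])
  next
    case 3
    have "((\<lambda>t. Complex (a + (2 - t) * w) (2 * (t - 1))) has_vector_derivative (of_real (- w) + \<i> * of_real 2)) (at t)"
      by (rule C) (auto intro!: derivative_eq_intros)
    then show ?thesis using 3
      by (auto simp: zigzag_def zigzag_deriv_def mult.commute
          intro: has_vector_derivative_transform_within_open[where S = "{1<..<2}"])
  next
    case 4
    have "((\<lambda>t. Complex a t) has_vector_derivative (of_real 0 + \<i> * of_real 1)) (at t)"
      by (rule C) (auto intro!: derivative_eq_intros)
    then show ?thesis using 4
      by (auto simp: zigzag_def zigzag_deriv_def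
          intro: has_vector_derivative_transform_within_open[where S = "{2<..}"])
  qed
qed

lemma continuous_on_zigzag_deriv: "continuous_on (UNIV - {0, 1, 2}) (zigzag_deriv w q)"
proof -
  have "UNIV - {0, 1, 2 :: real} = {..<0} \<union> {0<..<1} \<union> {1<..<2} \<union> {2<..}"
    by auto
  moreover have "continuous_on {..<0} (zigzag_deriv w q)" "continuous_on {2<..} (zigzag_deriv w q)"
    by (rule continuous_on_eq[of _ "\<lambda>_. \<i>"]; auto simp: zigzag_deriv_def)+
  moreover have "continuous_on {0<..<1} (zigzag_deriv w q)"
    by (rule continuous_on_eq[of _ "\<lambda>t. of_real w + \<i> * of_real (poly (pderiv q) t)"])
       (auto simp: zigzag_deriv_def intro!: continuous_intros)
  moreover have "continuous_on {1<..<2} (zigzag_deriv w q)"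
    by (rule continuous_on_eq[of _ "\<lambda>t. - of_real w + 2 * \<i>"]) (auto simp: zigzag_deriv_def)
  ultimately show ?thesis
    by (simp add: continuous_on_open_Un open_Un)
qed

lemma zigzag_deriv_measurable [measurable]: "zigzag_deriv w q \<in> borel_measurable borel"
proof -
  have [measurable]: "poly (pderiv q) \<in> borel_measurable borel"
    by (intro borel_measurable_continuous_onI continuous_intros)
  show ?thesis
    unfolding zigzag_deriv_def by measurable
qed

lemma zigzag_deriv_bounded: "\<exists>K. \<forall>t. norm (zigzag_deriv w q t) \<le> K"
proof -
  have "compact ((\<lambda>t. complex_of_real w + \<i> * of_real (poly (pderiv q) t)) ` {0..1})"
    by (intro compact_continuous_image continuous_intros) auto
  then obtain K where K: "\<And>t. 0 \<le> t \<Longrightarrow> t \<le> 1 \<Longrightarrow> norm (complex_of_real w + \<i> * of_real (poly (pderiv q) t)) \<le> K"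
    using compact_imp_bounded by (force simp: bounded_iff)
  show ?thesis
    using K by (intro exI[of _ "max K (max 1 (norm (- of_real w + 2 * \<i>)))"])
      (auto simp: zigzag_deriv_def le_max_iff_disj)
qed

text \<open>The bound on \<open>q\<close> keeps the graph below the returning segment, whose height
  over the scaled abscissa t is 2 (1 - t), with room for the line of height 1 - t between them. It
  also keeps the graph above the line \<open>Im = - 1\<close>. Both lines are escape routes for real
  points.\<close>

locale zigzag_contour =
  fixes a w :: real and q :: "real poly"
  assumes w: "w > 0" and q0: "poly q 0 = 0"
    and q_le: "\<And>t. 0 \<le> t \<Longrightarrow> t \<le> 1 \<Longrightarrow> \<bar>poly q t\<bar> \<le> (1 - t) / 2"
begin

abbreviation "c \<equiv> zigzag a w q"

lemma q1: "poly q 1 = 0"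
  using q_le[of 1] by simp

lemma continuous: "continuous_on UNIV c"
  unfolding zigzag_def Complex_eq using q0 q1
  by (intro continuous_on_cases_le continuous_intros) auto

lemma Re_bounds: "a \<le> Re (c t)" "Re (c t) \<le> a + w"
proof -
  have "0 \<le> t * w \<and> t * w \<le> w" if "0 \<le> t" "t \<le> 1" for t
    using that w by (simp add: mult_le_cancel_right1)
  from this[of t] this[of "2 - t"] w show "a \<le> Re (c t)" "Re (c t) \<le> a + w"
    by (auto simp: zigzag_def)
qed

lemma range_Re: "s \<in> range c \<Longrightarrow> a \<le> Re s \<and> Re s \<le> a + w"
  using Re_bounds by auto

lemma coordinates:
  "(Re (c t) - a) / w = (if t \<le> 0 then 0 else if t \<le> 1 then t else if t \<le> 2 then 2 - t else 0)"
  "Im (c t) = (if t \<le> 0 then t else if t \<le> 1 then poly q t else if t \<le> 2 then 2 * (t - 1) else t)"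
  using w by (auto simp: zigzag_def)

lemma range_cases:
  assumes "s \<in> range c"
  defines "r \<equiv> (Re s - a) / w"
  shows "r = 0 \<and> (Im s \<le> 0 \<or> Im s \<ge> 2) \<or> 0 < r \<and> r \<le> 1 \<and> Im s = poly q r \<or> 0 < r \<and> r < 1 \<and> Im s = 2 * (1 - r)"
proof -
  from assms(1) obtain t where t: "s = c t" by auto
  show ?thesis
    unfolding r_def t coordinates by auto
qed

lemma injective: "inj c"
proof (rule linorder_injI)
  fix s t :: real assume st: "s < t"
  show "c s \<noteq> c t"
  proof
    assume eq: "c s = c t"
    have Re: "(if s \<le> 0 then 0 else if s \<le> 1 then s else if s \<le> 2 then 2 - s else 0) =
      (if t \<le> 0 then 0 else if t \<le> 1 then t else if t \<le> 2 then 2 - t else 0)"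
      using arg_cong[OF eq, of "\<lambda>z. (Re z - a) / w"] by (simp only: coordinates)
    have Im: "(if s \<le> 0 then s else if s \<le> 1 then poly q s else if s \<le> 2 then 2 * (s - 1) else s) =
      (if t \<le> 0 then t else if t \<le> 1 then poly q t else if t \<le> 2 then 2 * (t - 1) else t)"
      using arg_cong[OF eq, of Im] by (simp only: coordinates)
    \<comment> \<open>The one coincidence that the coordinate formulas do not exclude by themselves
      is that of a graph point with a point of the returning segment; the bound on \<open>q\<close>
      excludes it.\<close>
    have "s \<le> 0 \<or> t \<le> 0 \<or> s > 1 \<or> t \<le> 1 \<or> \<bar>poly q s\<bar> \<le> (1 - s) / 2"
      using q_le[of s] by auto
    with Re Im st show False
      by (auto split: if_splits)
  qed
qed

lemma vertical_contour: "vertical_contour a c"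
  unfolding vertical_contour_def piecewise_C1_differentiable_on_def
proof (intro conjI exI)
  show "c C1_differentiable_on UNIV - {0, 1, 2}"
    unfolding C1_differentiable_on_def
    using zigzag_has_vector_derivative continuous_on_zigzag_deriv by blast
  show "\<forall>t. 3 \<le> \<bar>t\<bar> \<longrightarrow> c t = Complex a t"
    by (auto simp: zigzag_def)
qed (use continuous injective in auto)

lemma left_side_lt:
  assumes "p < a" shows "of_real p \<in> left_side c"
  unfolding left_side_def mem_Collect_eq
proof (rule eventually_mono[OF eventually_le_at_bot[of p]])
  fix x assume x: "x \<le> p"
  have "s \<notin> range c" if s: "s \<in> closed_segment (Complex x 0) (Complex p 0)" for s
  proof -
    from s obtain u where u: "0 \<le> u" "u \<le> 1" "Re s = x + u * (p - x)"
      by (rule closed_segment_Complex)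
    have "u * (p - x) \<le> 1 * (p - x)" using u x by (intro mult_right_mono) auto
    with u assms have "Re s < a" by simp
    then show ?thesis using range_Re[of s] by auto
  qed
  then show "connected_component (- range c) (of_real x) (of_real p)"
    by (intro connected_component_segment) (auto simp: complex_of_real_def)
qed

lemma right_side_gt:
  assumes "p > a + w" shows "of_real p \<in> right_side c"
  unfolding right_side_def mem_Collect_eq
proof (rule eventually_mono[OF eventually_ge_at_top[of p]])
  fix x assume x: "p \<le> x"
  have "s \<notin> range c" if s: "s \<in> closed_segment (Complex x 0) (Complex p 0)" for s
  proof -
    from s obtain u where u: "0 \<le> u" "u \<le> 1" "Re s = x + u * (p - x)"
      by (rule closed_segment_Complex)
    have "u * (x - p) \<le> 1 * (x - p)" using u x by (intro mult_right_mono) auto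
    with u assms have "Re s > a + w" by (simp add: algebra_simps)
    then show ?thesis using range_Re[of s] by auto
  qed
  then show "connected_component (- range c) (of_real x) (of_real p)"
    by (intro connected_component_segment) (auto simp: complex_of_real_def)
qed

text \<open>The point lies above the graph. It rises to height 1 - r and follows the line between
  graph and returning segment to the left, leaving through the gap in \<open>Re s = a\<close>
  between heights 0 and 2. From there a vertical segment leads to the real axis.\<close>

lemma left_side_negative:
  assumes r: "0 < r" "r < 1" "poly q r < 0"
  shows "of_real (a + r * w) \<in> left_side c"
  unfolding left_side_def mem_Collect_eq
proof (rule eventually_mono[OF eventually_gt_at_bot[of a]])
  fix x assume x: "x < a"
  let ?p = "a + r * w"
  have 1: "s \<notin> range c" if s: "s \<in> closed_segment (Complex ?p (1 - r)) (Complex ?p 0)" for s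
  proof -
    from s obtain u where u: "0 \<le> u" "u \<le> 1" "Re s = ?p + u * (?p - ?p)" "Im s = 1 - r + u * (0 - (1 - r))"
      by (rule closed_segment_Complex)
    then have R: "(Re s - a) / w = r" using w by simp
    have "Im s = (1 - r) - u * (1 - r)"
      using u(4) by (simp add: algebra_simps)
    moreover have "0 \<le> u * (1 - r)" "u * (1 - r) \<le> 1 * (1 - r)"
      using u r by (auto intro!: mult_right_mono)
    ultimately have "0 \<le> Im s" "Im s \<le> 1 - r"
      by simp_all
    with range_cases[of s] R r show ?thesis by auto
  qed
  \<comment> \<open>The height at \<open>Re s = x\<close> of the line
    \<open>Im s = 1 - (Re s - a) / w\<close>.\<close>
  define y where "y = 1 - (x - a) / w"
  have y: "y > 1" using x w by (simp add: y_def field_simps)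
  have 2: "s \<notin> range c" if s: "s \<in> closed_segment (Complex x y) (Complex ?p (1 - r))" for s
  proof -
    from s obtain u where u: "0 \<le> u" "u \<le> 1" "Re s = x + u * (?p - x)" "Im s = y + u * (1 - r - y)"
      by (rule closed_segment_Complex)
    define R where "R = (Re s - a) / w"
    define \<xi> where "\<xi> = (x - a) / w"
    have \<xi>w: "\<xi> * w = x - a" using w by (simp add: \<xi>_def)
    then have "(r - \<xi>) * w = ?p - x" by (simp add: algebra_simps)
    then have "Re s - a = \<xi> * w + u * ((r - \<xi>) * w)" using u(3) \<xi>w by simp
    also have "\<dots> = (\<xi> + u * (r - \<xi>)) * w" by (simp add: algebra_simps)
    finally have "R = \<xi> + u * (r - \<xi>)" using w by (simp add: R_def)
    then have I: "Im s = 1 - R" using u(4) by (simp add: y_def \<xi>_def[symmetric] algebra_simps)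
    have "0 < r * w" using r w by simp
    then have "u * (?p - x) \<le> 1 * (?p - x)" using u x by (intro mult_right_mono) auto
    with u have "Re s \<le> ?p" by simp
    then have "R \<le> r" using w by (simp add: R_def field_simps)
    then show ?thesis
      using range_cases[of s] I r q_le[of R] unfolding R_def[symmetric] by auto
  qed
  have 3: "s \<notin> range c" if s: "s \<in> closed_segment (Complex x 0) (Complex x y)" for s
  proof -
    have "Re s = x" using s by (rule Re_closed_segment)
    then show ?thesis using range_Re[of s] x by auto
  qed
  have "connected_component (- range c) (Complex x 0) (Complex x y)"
    "connected_component (- range c) (Complex x y) (Complex ?p (1 - r))"
    "connected_component (- range c) (Complex ?p (1 - r)) (Complex ?p 0)"
    using 1 2 3 by (intro connected_component_segment; blast)+
  then show "connected_component (- range c) (of_real x) (of_real ?p)"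
    unfolding complex_of_real_def by (blast intro: connected_component_trans)
qed

text \<open>The point lies below the graph. It descends to \<open>Im s = - 1\<close>, where it
  passes under the graph, whose height is at least - 1/2, and runs to the right beyond a +
  w.\<close>

lemma right_side_positive:
  assumes r: "0 < r" "r < 1" "poly q r > 0"
  shows "of_real (a + r * w) \<in> right_side c"
  unfolding right_side_def mem_Collect_eq
proof (rule eventually_mono[OF eventually_gt_at_top[of "a + w"]])
  fix x assume x: "x > a + w"
  let ?p = "a + r * w"
  have "r * w < 1 * w" using r w by (intro mult_strict_right_mono) auto
  then have px: "?p < x" using x by simp
  have 1: "s \<notin> range c" if s: "s \<in> closed_segment (Complex ?p (- 1)) (Complex ?p 0)" for s
  proof -
    from s obtain u where u: "0 \<le> u" "u \<le> 1" "Re s = ?p + u * (?p - ?p)" "Im s = - 1 + u * (0 - (- 1))"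
      by (rule closed_segment_Complex)
    then have R: "(Re s - a) / w = r" using w by simp
    have "Im s \<le> 0" using u by simp
    with range_cases[of s] R r show ?thesis by auto
  qed
  have 2: "s \<notin> range c" if s: "s \<in> closed_segment (Complex x (- 1)) (Complex ?p (- 1))" for s
  proof -
    from s obtain u where u: "0 \<le> u" "u \<le> 1" "Re s = x + u * (?p - x)" "Im s = - 1 + u * (- 1 - (- 1))"
      by (rule closed_segment_Complex)
    have "u * (x - ?p) \<le> 1 * (x - ?p)" using u px by (intro mult_right_mono) auto
    with u have "?p \<le> Re s" by (simp add: algebra_simps)
    moreover have "0 < r * w" using r w by simp
    ultimately have "0 < (Re s - a) / w" using w by simp
    moreover define R where "R = (Re s - a) / w"
    ultimately have "0 < R" by simp
    then show ?thesis
      using range_cases[of s] u(4) q_le[of R] unfolding R_def[symmetric] by auto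
  qed
  have 3: "s \<notin> range c" if s: "s \<in> closed_segment (Complex x 0) (Complex x (- 1))" for s
  proof -
    have "Re s = x" using s by (rule Re_closed_segment)
    then show ?thesis using range_Re[of s] x by auto
  qed
  have "connected_component (- range c) (Complex x 0) (Complex x (- 1))"
    "connected_component (- range c) (Complex x (- 1)) (Complex ?p (- 1))"
    "connected_component (- range c) (Complex ?p (- 1)) (Complex ?p 0)"
    using 1 2 3 by (intro connected_component_segment; blast)+
  then show "connected_component (- range c) (of_real x) (of_real ?p)"
    unfolding complex_of_real_def by (blast intro: connected_component_trans)
qed

end

text \<open>With [a, b] rescaled to the unit interval, a polynomial is chosen negative at the left
  poles and positive at the right poles there. Points of L beyond the interval lie left of
  \<open>a\<close>, points of R right of \<open>b\<close>, where the side is clear.\<close>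

theorem ex_separating_contour:
  fixes L R :: "real set"
  assumes ab: "a < b" and disj: "L \<inter> R = {}"
    and L: "L \<subseteq> {..<b}" "a \<notin> L" "finite (L \<inter> {a..b})"
    and R: "R \<subseteq> {a<..}" "b \<notin> R" "finite (R \<inter> {a..b})"
  obtains w q where "vertical_contour a (zigzag a w q)"
    "\<And>t. a \<le> Re (zigzag a w q t)" "\<And>t. Re (zigzag a w q t) \<le> b"
    "of_real ` L \<subseteq> left_side (zigzag a w q)" "of_real ` R \<subseteq> right_side (zigzag a w q)"
proof -
  define w where "w = b - a"
  have w: "w > 0" using ab by (simp add: w_def)
  define N where "N = (\<lambda>p. (p - a) / w)"
  have pN: "p = a + N p * w" for p using w by (simp add: N_def)
  obtain g where g: "\<forall>x\<in>N ` (L \<inter> {a..b}) \<union> N ` (R \<inter> {a..b}). poly g x = (if x \<in> N ` L then - 1 else 1)"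
    using ex_poly_interpolation[of "N ` (L \<inter> {a..b}) \<union> N ` (R \<inter> {a..b})" "\<lambda>x. if x \<in> N ` L then - 1 else 1"] L R
    by blast
  have "compact (poly g ` {0..1})"
    by (intro compact_continuous_image continuous_intros) auto
  then obtain K where K: "K > 0" "\<And>t. 0 \<le> t \<Longrightarrow> t \<le> 1 \<Longrightarrow> \<bar>poly g t\<bar> \<le> K"
    using compact_imp_bounded by (force simp: bounded_pos)
  \<comment> \<open>The factor t (1 - t) makes \<open>q\<close> vanish at both ends and supplies the
    factor 1 - t of the locale bound without changing signs inside; 1 / (2 K) supplies the constant
    1/2.\<close>
  define q where "q = smult (1 / (2 * K)) ([:0, 1:] * [:1, - 1:] * g)"
  have q: "poly q t = t * (1 - t) * (poly g t / (2 * K))" for t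
    using K by (simp add: q_def field_simps)
  interpret zigzag_contour a w q
  proof
    fix t :: real assume t: "0 \<le> t" "t \<le> 1"
    have "\<bar>poly q t\<bar> = (t * (1 - t)) * (\<bar>poly g t\<bar> / (2 * K))"
      using t K by (simp add: q abs_mult)
    also have "\<dots> \<le> (1 * (1 - t)) * (1 / 2)"
      using t K by (intro mult_mono) (auto simp: field_simps mult_left_le_one_le)
    finally show "\<bar>poly q t\<bar> \<le> (1 - t) / 2" by simp
  qed (use w in \<open>auto simp: q\<close>)
  have N01: "0 < N p \<and> N p < 1" if "a < p" "p < b" for p
    using that w by (simp add: N_def field_simps) (simp add: w_def)
  have "of_real p \<in> left_side c" if p: "p \<in> L" for p
  proof (cases "p < a")
    case True
    then show ?thesis by (rule left_side_lt)
  next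
    case False
    then have ap: "a < p" "p < b" using p L by (auto simp: less_le)
    then have "poly g (N p) = - 1" using p g by auto
    then have "poly q (N p) < 0"
      using N01[OF ap] K by (simp add: q mult_pos_pos)
    then show ?thesis
      using left_side_negative[of "N p"] N01[OF ap] pN[of p] by simp
  qed
  moreover have "of_real p \<in> right_side c" if p: "p \<in> R" for p
  proof (cases "p > b")
    case True
    then show ?thesis by (intro right_side_gt) (simp add: w_def)
  next
    case False
    then have ap: "a < p" "p < b" using p R by (auto simp: less_le)
    have "N p \<notin> N ` L" using disj p w by (auto simp: N_def)
    then have "poly g (N p) = 1" using p ap g by auto
    then have "poly q (N p) > 0"
      using N01[OF ap] K by (simp add: q)
    then show ?thesis
      using right_side_positive[of "N p"] N01[OF ap] pN[of p] by simp
  qed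
  ultimately show ?thesis
    using that[of w q] vertical_contour Re_bounds by (force simp: w_def)
qed

subsection \<open>Fox functions as contour integrals\<close>

text \<open>Stated through the argument of Gamma instead of \<open>is_pole\<close>, so that
  closedness and finiteness in strips can be read off. Negative second entries are allowed and
  describe sequences of poles going to the right.\<close>

definition gamma_poles :: "fox_list \<Rightarrow> complex set" where
  "gamma_poles ps = {s. \<exists>(\<beta>, B) \<in> set ps. \<beta> + of_real B * s \<in> \<int>\<^sub>\<le>\<^sub>0}"

lemma gamma_poles_Un: "gamma_poles (ps @ qs) = gamma_poles ps \<union> gamma_poles qs"
  by (auto simp: gamma_poles_def)

lemma gamma_poles_Cons: "gamma_poles ((\<beta>, B) # ps) = {s. \<beta> + of_real B * s \<in> \<int>\<^sub>\<le>\<^sub>0} \<union> gamma_poles ps"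
  by (auto simp: gamma_poles_def)

lemma gamma_poles_subset_iff:
  "gamma_poles ps \<subseteq> S \<longleftrightarrow> (\<forall>(\<beta>, B) \<in> set ps. {s. \<beta> + of_real B * s \<in> \<int>\<^sub>\<le>\<^sub>0} \<subseteq> S)"
  unfolding gamma_poles_def by blast

lemma closed_gamma_poles: "closed (gamma_poles ps)"
proof (induction ps)
  case (Cons p ps)
  have "closed ((\<lambda>s. fst p + of_real (snd p) * s) -` \<int>\<^sub>\<le>\<^sub>0)"
    by (intro closed_vimage closed_nonpos_Ints continuous_intros)
  with Cons show ?case
    by (cases p) (auto simp: gamma_poles_Cons vimage_def)
qed (simp add: gamma_poles_def)

lemma finite_gamma_poles_strip:
  assumes "\<And>\<beta> B. (\<beta>, B) \<in> set ps \<Longrightarrow> B \<noteq> 0"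
  shows "finite {s \<in> gamma_poles ps. \<bar>Re s\<bar> \<le> X}"
  using assms
proof (induction ps)
  case (Cons p ps)
  obtain \<beta> B where p: "p = (\<beta>, B)" by (cases p)
  have B: "B \<noteq> 0" using Cons.prems[of \<beta> B] by (simp add: p)
  let ?h = "\<lambda>s. \<beta> + of_real B * s"
  \<comment> \<open>In the strip the argument has real part at least - (\<bar>Re \<beta>\<bar> +
    \<bar>B\<bar> X), so only the integers from - Y to 0 can occur.\<close>
  define Y where "Y = \<lceil>\<bar>Re \<beta>\<bar> + \<bar>B\<bar> * X\<rceil>"
  have "{s. \<bar>Re s\<bar> \<le> X \<and> ?h s \<in> \<int>\<^sub>\<le>\<^sub>0} \<subseteq> ?h -` (of_int ` {- Y..0})"
  proof
    fix s assume s: "s \<in> {s. \<bar>Re s\<bar> \<le> X \<and> ?h s \<in> \<int>\<^sub>\<le>\<^sub>0}"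
    then obtain i where i: "i \<le> 0" "?h s = of_int i"
      by (auto elim!: nonpos_Ints_cases)
    then have "real_of_int i = Re \<beta> + B * Re s"
      by (metis Re_complex_of_real complex_Re_of_int plus_complex.simps(1) times_complex.simps(1) Im_complex_of_real mult_zero_left diff_zero)
    moreover have "\<bar>B * Re s\<bar> \<le> \<bar>B\<bar> * X"
      unfolding abs_mult using s by (intro mult_left_mono) auto
    ultimately have "- real_of_int i \<le> \<bar>Re \<beta>\<bar> + \<bar>B\<bar> * X" by linarith
    then have "- i \<le> Y" unfolding Y_def by (metis ceiling_mono ceiling_of_int of_int_minus)
    with i show "s \<in> ?h -` (of_int ` {- Y..0})" by auto
  qed
  moreover have "finite (?h -` (of_int ` {- Y..0}))"
    using B by (intro finite_vimageI finite_imageI) (auto intro!: injI)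
  ultimately have "finite {s. \<bar>Re s\<bar> \<le> X \<and> ?h s \<in> \<int>\<^sub>\<le>\<^sub>0}"
    by (rule finite_subset)
  moreover have "finite {s \<in> gamma_poles ps. \<bar>Re s\<bar> \<le> X}"
    using Cons.IH Cons.prems by auto
  moreover have "{s \<in> gamma_poles (p # ps). \<bar>Re s\<bar> \<le> X} =
      {s. \<bar>Re s\<bar> \<le> X \<and> ?h s \<in> \<int>\<^sub>\<le>\<^sub>0} \<union> {s \<in> gamma_poles ps. \<bar>Re s\<bar> \<le> X}"
    by (auto simp: p gamma_poles_Cons)
  ultimately show ?case by simp
qed (simp add: gamma_poles_def)

text \<open>The link between \<open>is_pole\<close> in the definition of \<open>fox_contour\<close>
  and membership in \<open>gamma_poles\<close>.\<close>

lemma is_pole_Gamma_affine_iff: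
  fixes \<beta> :: complex
  assumes B: "B \<noteq> 0"
  shows "is_pole (\<lambda>s. Gamma (\<beta> + of_real B * s)) s \<longleftrightarrow> \<beta> + of_real B * s \<in> \<int>\<^sub>\<le>\<^sub>0"
proof
  assume pole: "is_pole (\<lambda>s. Gamma (\<beta> + of_real B * s)) s"
  show "\<beta> + of_real B * s \<in> \<int>\<^sub>\<le>\<^sub>0"
  proof (rule ccontr)
    assume s: "\<beta> + of_real B * s \<notin> \<int>\<^sub>\<le>\<^sub>0"
    let ?A = "- gamma_poles [(\<beta>, B)]"
    have "open ?A" using closed_gamma_poles by (simp add: open_Compl)
    moreover have "s \<in> ?A" using s by (simp add: gamma_poles_def)
    moreover have "(\<lambda>s. Gamma (\<beta> + of_real B * s)) holomorphic_on ?A"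
      by (intro holomorphic_intros) (simp add: gamma_poles_def)
    ultimately show False
      using not_is_pole_holomorphic pole by blast
  qed
next
  assume "\<beta> + of_real B * s \<in> \<int>\<^sub>\<le>\<^sub>0"
  then obtain n where n: "\<beta> + of_real B * s = - of_nat n"
    by (auto elim!: nonpos_Ints_cases')
  show "is_pole (\<lambda>s. Gamma (\<beta> + of_real B * s)) s"
  proof (rule is_pole_compose[OF is_pole_Gamma[of n]])
    have "(\<lambda>s. \<beta> + of_real B * s) \<midarrow>s\<rightarrow> \<beta> + of_real B * s"
      by (intro tendsto_intros)
    then show "(\<lambda>s. \<beta> + of_real B * s) \<midarrow>s\<rightarrow> - of_nat n" by (simp add: n)
    show "\<forall>\<^sub>F z in at s. \<beta> + of_real B * z \<noteq> - of_nat n"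
      unfolding n[symmetric] using B by (auto simp: eventually_at_filter)
  qed
qed

section \<open>Gamma products, their growth, and evaluation of \<open>fox_H\<close>\<close>

text \<open>Brings \<open>Gamma (1 - \<alpha> - A s)\<close> into the form
  \<open>Gamma (\<beta> + B s)\<close>, so that one set of lemmas covers both kinds of
  factors.\<close>

definition refl_params :: "fox_list \<Rightarrow> fox_list" where
  "refl_params = map (\<lambda>(\<alpha>, A). (1 - \<alpha>, - A))"

definition Gamma_prod :: "fox_list \<Rightarrow> complex \<Rightarrow> complex" where
  "Gamma_prod ps s = (\<Prod>(\<beta>, B)\<leftarrow>ps. Gamma (\<beta> + of_real B * s))"

definition rGamma_prod :: "fox_list \<Rightarrow> complex \<Rightarrow> complex" where
  "rGamma_prod ps s = (\<Prod>(\<beta>, B)\<leftarrow>ps. rGamma (\<beta> + of_real B * s))"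

definition fox_chi :: "nat \<Rightarrow> nat \<Rightarrow> fox_list \<Rightarrow> fox_list \<Rightarrow> real" where
  "fox_chi m n as bs = (\<Sum>(\<alpha>, A)\<leftarrow>take n as. A) - (\<Sum>(\<alpha>, A)\<leftarrow>drop n as. A)
     + (\<Sum>(\<beta>, B)\<leftarrow>take m bs. B) - (\<Sum>(\<beta>, B)\<leftarrow>drop m bs. B)"

lemma Gamma_prod_append: "Gamma_prod (ps @ qs) s = Gamma_prod ps s * Gamma_prod qs s"
  by (simp add: Gamma_prod_def)

lemma Gamma_prod_refl_params:
  "Gamma_prod (refl_params ps) s = (\<Prod>(\<alpha>, A)\<leftarrow>ps. Gamma (1 - \<alpha> - of_real A * s))"
  by (simp add: Gamma_prod_def refl_params_def o_def case_prod_unfold)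

text \<open>Valid at the poles too: there \<open>Gamma\<close> and \<open>rGamma\<close> are 0, and
  so is the inverse of 0.\<close>

lemma rGamma_prod_eq: "rGamma_prod ps s = inverse (Gamma_prod ps s)"
  by (induction ps) (auto simp: rGamma_prod_def Gamma_prod_def rGamma_inverse_Gamma case_prod_unfold)

lemma fox_Xi_eq:
  "fox_Xi m n as bs s =
     Gamma_prod (take m bs @ refl_params (take n as)) s * rGamma_prod (refl_params (drop m bs) @ drop n as) s"
  unfolding fox_Xi_def rGamma_prod_eq Gamma_prod_append Gamma_prod_refl_params divide_inverse
  by (simp add: Gamma_prod_def)

lemma holomorphic_Gamma_prod: "Gamma_prod ps holomorphic_on - gamma_poles ps"
proof (induction ps)
  case (Cons p ps)
  obtain \<beta> B where p: "p = (\<beta>, B)" by (cases p)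
  have "(\<lambda>s. Gamma (\<beta> + of_real B * s) * Gamma_prod ps s) holomorphic_on - gamma_poles (p # ps)"
    using Cons by (intro holomorphic_intros holomorphic_on_subset[OF Cons])
      (auto simp: p gamma_poles_Cons)
  then show ?case
    by (rule holomorphic_transform) (simp add: p Gamma_prod_def)
qed (auto simp: Gamma_prod_def)

lemma holomorphic_rGamma_prod: "rGamma_prod ps holomorphic_on S"
proof (induction ps)
  case (Cons p ps)
  obtain \<beta> B where p: "p = (\<beta>, B)" by (cases p)
  have "(\<lambda>s. rGamma (\<beta> + of_real B * s) * rGamma_prod ps s) holomorphic_on S"
    using Cons by (intro holomorphic_intros)
  then show ?case
    by (rule holomorphic_transform) (simp add: p rGamma_prod_def)
qed (auto simp: rGamma_prod_def)

lemma vgrowth_Gamma_prod: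
  assumes "\<And>\<beta> B. (\<beta>, B) \<in> set ps \<Longrightarrow> B \<noteq> 0"
  shows "vgrowth (\<Sum>(\<beta>, B)\<leftarrow>ps. - pi / 2 * \<bar>B\<bar>) (Gamma_prod ps)"
  unfolding Gamma_prod_def
proof (rule vgrowth_prod_list)
  fix p assume p: "p \<in> set ps"
  obtain \<beta> B where [simp]: "p = (\<beta>, B)" by (cases p)
  have "vgrowth (- pi / 2 * \<bar>B\<bar>) (\<lambda>s. Gamma (\<beta> + of_real B * s))"
    using assms[of \<beta> B] p by (intro vgrowth_compose_affine vgrowth_Gamma) simp
  then show "vgrowth (case p of (\<beta>, B) \<Rightarrow> - pi / 2 * \<bar>B\<bar>) (\<lambda>s. case p of (\<beta>, B) \<Rightarrow> Gamma (\<beta> + of_real B * s))"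
    by (simp only: prod.case \<open>p = (\<beta>, B)\<close>)
qed

lemma vgrowth_rGamma_prod:
  assumes "\<And>\<beta> B. (\<beta>, B) \<in> set ps \<Longrightarrow> B \<noteq> 0"
  shows "vgrowth (\<Sum>(\<beta>, B)\<leftarrow>ps. pi / 2 * \<bar>B\<bar>) (rGamma_prod ps)"
  unfolding rGamma_prod_def
proof (rule vgrowth_prod_list)
  fix p assume p: "p \<in> set ps"
  obtain \<beta> B where [simp]: "p = (\<beta>, B)" by (cases p)
  have "vgrowth (pi / 2 * \<bar>B\<bar>) (\<lambda>s. rGamma (\<beta> + of_real B * s))"
    using assms[of \<beta> B] p by (intro vgrowth_compose_affine vgrowth_rGamma) simp
  then show "vgrowth (case p of (\<beta>, B) \<Rightarrow> pi / 2 * \<bar>B\<bar>) (\<lambda>s. case p of (\<beta>, B) \<Rightarrow> rGamma (\<beta> + of_real B * s))"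
    by (simp only: prod.case \<open>p = (\<beta>, B)\<close>)
qed

lemma sum_list_refl_params_abs:
  assumes "\<And>\<beta> B. (\<beta>, B) \<in> set ps \<Longrightarrow> B > 0"
  shows "(\<Sum>(\<beta>, B)\<leftarrow>refl_params ps. r * \<bar>B\<bar>) = r * (\<Sum>(\<beta>, B)\<leftarrow>ps. B)"
    "(\<Sum>(\<beta>, B)\<leftarrow>ps. r * \<bar>B\<bar>) = r * (\<Sum>(\<beta>, B)\<leftarrow>ps. B)"
  using assms by (induction ps) (force simp: refl_params_def algebra_simps)+

lemma fox_params_pos:
  assumes "fox_H_params m n as bs"
  shows "(\<beta>, B) \<in> set bs \<Longrightarrow> B > 0" "(\<alpha>, A) \<in> set as \<Longrightarrow> A > 0"
  using assms by (auto simp: fox_H_params_def)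

lemma refl_params_nonzero:
  assumes "\<And>\<beta> B. (\<beta>, B) \<in> set ps \<Longrightarrow> B > 0" "(\<alpha>, A) \<in> set (refl_params ps)"
  shows "A \<noteq> 0"
  using assms by (force simp: refl_params_def)

text \<open>A Gamma factor in the numerator contributes the rate - pi / 2 times the modulus of its
  coefficient of s, one in the denominator the opposite rate. The sum is - pi / 2 times
  \<chi>.\<close>

lemma vgrowth_fox_Xi:
  assumes par: "fox_H_params m n as bs"
  shows "vgrowth (- (pi / 2) * fox_chi m n as bs) (fox_Xi m n as bs)"
proof -
  note pos = fox_params_pos[OF par]
  have 1: "B > 0" if "(\<beta>, B) \<in> set (take m bs) \<or> (\<beta>, B) \<in> set (drop m bs)" for \<beta> B
    using that by (auto dest: in_set_takeD in_set_dropD intro: pos)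
  have 2: "A > 0" if "(\<alpha>, A) \<in> set (take n as) \<or> (\<alpha>, A) \<in> set (drop n as)" for \<alpha> A
    using that by (auto dest: in_set_takeD in_set_dropD intro: pos)
  have nz: "(\<beta>, B) \<in> set (take m bs @ refl_params (take n as)) \<Longrightarrow> B \<noteq> 0"
    "(\<beta>, B) \<in> set (refl_params (drop m bs) @ drop n as) \<Longrightarrow> B \<noteq> 0" for \<beta> B
  proof -
    have r: "B \<noteq> 0" if "(\<beta>, B) \<in> set (refl_params (take n as)) \<or> (\<beta>, B) \<in> set (refl_params (drop m bs))"
      using that
    proof
      assume "(\<beta>, B) \<in> set (refl_params (take n as))"
      then show ?thesis by (rule refl_params_nonzero[rotated]) (use 2 in blast)
    next
      assume "(\<beta>, B) \<in> set (refl_params (drop m bs))"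
      then show ?thesis by (rule refl_params_nonzero[rotated]) (use 1 in blast)
    qed
    show "(\<beta>, B) \<in> set (take m bs @ refl_params (take n as)) \<Longrightarrow> B \<noteq> 0"
      "(\<beta>, B) \<in> set (refl_params (drop m bs) @ drop n as) \<Longrightarrow> B \<noteq> 0"
      unfolding set_append Un_iff using 1[of \<beta> B] 2[of \<beta> B] r by (metis less_irrefl)+
  qed
  have "vgrowth ((\<Sum>(\<beta>, B)\<leftarrow>take m bs @ refl_params (take n as). - pi / 2 * \<bar>B\<bar>) +
       (\<Sum>(\<beta>, B)\<leftarrow>refl_params (drop m bs) @ drop n as. pi / 2 * \<bar>B\<bar>))
     (\<lambda>s. Gamma_prod (take m bs @ refl_params (take n as)) s * rGamma_prod (refl_params (drop m bs) @ drop n as) s)"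
    by (intro vgrowth_mult vgrowth_Gamma_prod vgrowth_rGamma_prod nz)
  also have "(\<Sum>(\<beta>, B)\<leftarrow>take m bs @ refl_params (take n as). - pi / 2 * \<bar>B\<bar>) +
       (\<Sum>(\<beta>, B)\<leftarrow>refl_params (drop m bs) @ drop n as. pi / 2 * \<bar>B\<bar>) = - (pi / 2) * fox_chi m n as bs"
  proof -
    have "(\<Sum>(\<beta>, B)\<leftarrow>take m bs. - pi / 2 * \<bar>B\<bar>) = - pi / 2 * (\<Sum>(\<beta>, B)\<leftarrow>take m bs. B)"
      "(\<Sum>(\<beta>, B)\<leftarrow>refl_params (drop m bs). pi / 2 * \<bar>B\<bar>) = pi / 2 * (\<Sum>(\<beta>, B)\<leftarrow>drop m bs. B)"
      "(\<Sum>(\<beta>, B)\<leftarrow>refl_params (take n as). - pi / 2 * \<bar>B\<bar>) = - pi / 2 * (\<Sum>(\<beta>, B)\<leftarrow>take n as. B)"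
      "(\<Sum>(\<beta>, B)\<leftarrow>drop n as. pi / 2 * \<bar>B\<bar>) = pi / 2 * (\<Sum>(\<beta>, B)\<leftarrow>drop n as. B)"
      using 1 2 by (intro sum_list_refl_params_abs; blast)+
    then show ?thesis
      unfolding map_append sum_list_append fox_chi_def by (simp only:) (simp add: algebra_simps)
  qed
  finally show ?thesis
    by (simp only: fox_Xi_eq[abs_def])
qed

lemma holomorphic_fox_Xi:
  "fox_Xi m n as bs holomorphic_on - gamma_poles (take m bs @ refl_params (take n as))"
  unfolding fox_Xi_eq[abs_def] using holomorphic_Gamma_prod holomorphic_rGamma_prod
  by (intro holomorphic_intros)

lemma fox_contour_iff:
  assumes par: "fox_H_params m n as bs"
  shows "fox_contour m n as bs c \<longleftrightarrow> (\<exists>\<gamma>. vertical_contour \<gamma> c) \<and>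
     gamma_poles (take m bs) \<subseteq> left_side c \<and> gamma_poles (refl_params (take n as)) \<subseteq> right_side c"
proof -
  have "(\<forall>(\<beta>, B) \<in> set (take m bs). {s. is_pole (\<lambda>s. Gamma (\<beta> + of_real B * s)) s} \<subseteq> left_side c) \<longleftrightarrow>
      gamma_poles (take m bs) \<subseteq> left_side c"
    unfolding gamma_poles_subset_iff
  proof (rule ball_cong[OF refl])
    fix p assume p: "p \<in> set (take m bs)"
    obtain \<beta> B where pB: "p = (\<beta>, B)" by (cases p)
    have "B > 0" using p fox_params_pos(1)[OF par, of \<beta> B] in_set_takeD pB by fast
    then have "{s. is_pole (\<lambda>s. Gamma (\<beta> + of_real B * s)) s} = {s. \<beta> + of_real B * s \<in> \<int>\<^sub>\<le>\<^sub>0}"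
      by (intro Collect_cong is_pole_Gamma_affine_iff) simp
    then show "(case p of (\<beta>, B) \<Rightarrow> {s. is_pole (\<lambda>s. Gamma (\<beta> + of_real B * s)) s} \<subseteq> left_side c) =
        (case p of (\<beta>, B) \<Rightarrow> {s. \<beta> + of_real B * s \<in> \<int>\<^sub>\<le>\<^sub>0} \<subseteq> left_side c)"
      by (simp only: pB prod.case)
  qed
  moreover have "(\<forall>(\<alpha>, A) \<in> set (take n as). {s. is_pole (\<lambda>s. Gamma (1 - \<alpha> - of_real A * s)) s} \<subseteq> right_side c) \<longleftrightarrow>
      gamma_poles (refl_params (take n as)) \<subseteq> right_side c"
    unfolding gamma_poles_subset_iff refl_params_def set_map ball_simps
  proof (rule ball_cong[OF refl])
    fix p assume p: "p \<in> set (take n as)"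
    obtain \<alpha> A where pA: "p = (\<alpha>, A)" by (cases p)
    have "A > 0" using p fox_params_pos(2)[OF par, of \<alpha> A] in_set_takeD pA by fast
    then have "{s. is_pole (\<lambda>s. Gamma (1 - \<alpha> + of_real (- A) * s)) s} = {s. 1 - \<alpha> + of_real (- A) * s \<in> \<int>\<^sub>\<le>\<^sub>0}"
      by (intro Collect_cong is_pole_Gamma_affine_iff) simp
    moreover have "1 - \<alpha> + of_real (- A) * s = 1 - \<alpha> - of_real A * s" for s
      by simp
    ultimately show "(case p of (\<alpha>, A) \<Rightarrow> {s. is_pole (\<lambda>s. Gamma (1 - \<alpha> - of_real A * s)) s} \<subseteq> right_side c) =
        (case (case p of (\<alpha>, A) \<Rightarrow> (1 - \<alpha>, - A)) of (\<beta>, B) \<Rightarrow> {s. \<beta> + of_real B * s \<in> \<int>\<^sub>\<le>\<^sub>0} \<subseteq> right_side c)"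
      by (simp only: pA prod.case)
  qed
  ultimately show ?thesis
    unfolding fox_contour_def by simp
qed

text \<open>A bound uniform over a vertical strip that holds on both sides of x = 1.\<close>

lemma powr_neg_le:
  fixes x :: real
  assumes "x > 0" "a \<le> r" "r \<le> b"
  shows "x powr (- r) \<le> x powr (- a) + x powr (- b)"
proof (cases "x \<ge> 1")
  case True
  then have "x powr (- r) \<le> x powr (- a)" using assms by (intro powr_mono) auto
  then show ?thesis by (simp add: add_increasing2)
next
  case False
  then have "x powr (- r) \<le> x powr (- b)" using assms by (intro powr_mono') auto
  then show ?thesis by (simp add: add_increasing)
qed

lemma vgrowth_powr:
  assumes "z > 0"
  shows "vgrowth 0 (\<lambda>s. of_real z powr (- s))"
proof (rule vgrowth_comparison)
  fix x1 x2 :: real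
  show "\<exists>g K T. vgrowth 0 g \<and> (\<forall>s. x1 \<le> Re s \<longrightarrow> Re s \<le> x2 \<longrightarrow> T \<le> \<bar>Im s\<bar> \<longrightarrow>
      norm (of_real z powr (- s)) \<le> K * norm (g s))"
    using assms powr_neg_le[OF assms, of x1 _ x2]
    by (intro exI[of _ "\<lambda>_. 1"] exI[of _ "z powr (- x1) + z powr (- x2)"])
      (auto simp: vgrowth_const norm_of_real_powr)
qed

text \<open>One admissible contour with a convergent integral determines the definite description,
  since \<open>line_integral_unique\<close> leaves no second value.\<close>

theorem fox_H_eq:
  assumes par: "fox_H_params m n as bs" and chi: "fox_chi m n as bs > 0" and z: "z > 0"
    and c: "fox_contour m n as bs c"
    and I: "has_line_integral (\<lambda>s. fox_Xi m n as bs s * of_real z powr (- s)) I c"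
  shows "fox_H m n as bs z = 1 / (2 * of_real pi * \<i>) * I"
  unfolding fox_H_def
proof (rule the_equality)
  let ?f = "\<lambda>s. fox_Xi m n as bs s * of_real z powr (- s)"
  let ?ps = "take m bs @ refl_params (take n as)"
  have gr: "vgrowth (- (pi / 2) * fox_chi m n as bs) ?f"
    using vgrowth_mult[OF vgrowth_fox_Xi[OF par] vgrowth_powr[OF z]] by simp
  have holo: "?f holomorphic_on - gamma_poles ?ps"
    using z by (intro holomorphic_intros holomorphic_fox_Xi) auto
  have nz: "B \<noteq> 0" if "(\<beta>, B) \<in> set ?ps" for \<beta> B
    using that fox_params_pos[OF par]
    by (force dest: in_set_takeD simp: refl_params_def)
  show "\<exists>c I'. fox_contour m n as bs c \<and> has_line_integral ?f I' c \<and>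
      1 / (2 * of_real pi * \<i>) * I = 1 / (2 * of_real pi * \<i>) * I'"
    using c I by blast
  fix h assume "\<exists>c I. fox_contour m n as bs c \<and> has_line_integral ?f I c \<and> h = 1 / (2 * of_real pi * \<i>) * I"
  then obtain c' I' where c': "fox_contour m n as bs c'" and I': "has_line_integral ?f I' c'"
    and h: "h = 1 / (2 * of_real pi * \<i>) * I'" by blast
  from c obtain \<gamma> where \<gamma>: "vertical_contour \<gamma> c" by (auto simp: fox_contour_def)
  from c' obtain \<gamma>' where \<gamma>': "vertical_contour \<gamma>' c'" by (auto simp: fox_contour_def)
  have "I' = I"
  proof (rule line_integral_unique[OF \<gamma>' \<gamma> closed_gamma_poles _ holo gr _ _ I' I])
    show "finite {p \<in> gamma_poles ?ps. \<bar>Re p\<bar> \<le> X}" for X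
      using nz by (rule finite_gamma_poles_strip)
    show "- (pi / 2) * fox_chi m n as bs < 0" using chi by simp
    fix p assume "p \<in> gamma_poles ?ps"
    with c c' show "p \<in> left_side c' \<and> p \<in> left_side c \<or> p \<in> right_side c' \<and> p \<in> right_side c"
      unfolding fox_contour_iff[OF par] gamma_poles_Un by blast
  qed
  with h show "h = 1 / (2 * of_real pi * \<i>) * I" by simp
qed

section \<open>Existence of an admissible contour to the left of a given bound\<close>

lemma countable_real_gamma_poles:
  assumes "\<And>\<beta> B. (\<beta>, B) \<in> set ps \<Longrightarrow> B \<noteq> 0"
  shows "countable {x :: real. of_real x \<in> gamma_poles ps}"
proof -
  have "countable (gamma_poles ps)"
  proof -
    have "gamma_poles ps = (\<Union>n. {s \<in> gamma_poles ps. \<bar>Re s\<bar> \<le> real n})"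
      using real_arch_simple by blast
    moreover have "countable {s \<in> gamma_poles ps. \<bar>Re s\<bar> \<le> real n}" for n
      by (rule countable_finite, rule finite_gamma_poles_strip, rule assms)
    then have "countable (\<Union>n. {s \<in> gamma_poles ps. \<bar>Re s\<bar> \<le> real n})"
      by (intro countable_UN) auto
    ultimately show ?thesis by simp
  qed
  then have "countable (Re ` gamma_poles ps)" by simp
  then show ?thesis
    by (rule countable_subset[rotated]) force
qed

text \<open>The rightmost pole of \<open>Gamma (\<beta> + B s)\<close> is - \<beta> / B, so all
  poles to be kept on the left are smaller than \<open>U\<close>. The contour can then be confined
  to a strip ending at some b < U, even if right poles occur further left.\<close>

theorem ex_fox_contour:
  assumes par: "fox_H_params m n as bs"
    and real: "\<And>\<alpha> A. (\<alpha>, A) \<in> set (take n as) \<Longrightarrow> \<alpha> \<in> \<real>" "\<And>\<beta> B. (\<beta>, B) \<in> set (take m bs) \<Longrightarrow> \<beta> \<in> \<real>"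
    and U: "\<And>\<beta> B. (\<beta>, B) \<in> set (take m bs) \<Longrightarrow> - Re \<beta> / B < U"
  obtains a b w q where "b < U" "fox_contour m n as bs (zigzag a w q)" "vertical_contour a (zigzag a w q)"
    "\<And>t. a \<le> Re (zigzag a w q t)" "\<And>t. Re (zigzag a w q t) \<le> b"
proof -
  let ?ls = "take m bs" and ?rs = "refl_params (take n as)"
  define L where "L = {x :: real. of_real x \<in> gamma_poles ?ls}"
  define R where "R = {x :: real. of_real x \<in> gamma_poles ?rs}"
  have lpos: "B > 0" if "(\<beta>, B) \<in> set ?ls" for \<beta> B
    using that fox_params_pos[OF par] by (auto dest: in_set_takeD)
  have rpos: "A > 0" if "(\<alpha>, A) \<in> set (take n as)" for \<alpha> A
    using that fox_params_pos[OF par] by (auto dest: in_set_takeD)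
  have lnz: "B \<noteq> 0" if "(\<beta>, B) \<in> set ?ls" for \<beta> B using lpos[OF that] by simp
  have rnz: "B \<noteq> 0" if "(\<beta>, B) \<in> set ?rs" for \<beta> B
    using rpos by (rule refl_params_nonzero[OF _ that])
  have cnt: "countable L" "countable R"
    unfolding L_def R_def by (rule countable_real_gamma_poles, rule lnz, assumption)
      (rule countable_real_gamma_poles, rule rnz, assumption)
  have fin: "finite {x :: real. of_real x \<in> gamma_poles ps \<and> x \<in> {a..b}}"
    if "\<And>\<beta> B. (\<beta>, B) \<in> set ps \<Longrightarrow> B \<noteq> 0" for ps a b
  proof -
    have "finite (Re ` {s \<in> gamma_poles ps. \<bar>Re s\<bar> \<le> \<bar>a\<bar> + \<bar>b\<bar>})"
      by (intro finite_imageI finite_gamma_poles_strip) (rule that)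
    moreover have "x \<in> Re ` {s \<in> gamma_poles ps. \<bar>Re s\<bar> \<le> \<bar>a\<bar> + \<bar>b\<bar>}"
      if "of_real x \<in> gamma_poles ps" "x \<in> {a..b}" for x
      using that by (intro image_eqI[of _ _ "of_real x"]) auto
    ultimately show ?thesis by (auto intro: finite_subset)
  qed
  have finL: "finite (L \<inter> {a..b})" and finR: "finite (R \<inter> {a..b})" for a b
    using fin[of ?ls a b] fin[of ?rs a b] lnz rnz unfolding L_def R_def Int_def mem_Collect_eq by blast+
  have realp: "\<exists>x. s = complex_of_real x" if "s \<in> gamma_poles ps" "\<And>\<beta> B. (\<beta>, B) \<in> set ps \<Longrightarrow> B \<noteq> 0"
    "\<And>\<beta> B. (\<beta>, B) \<in> set ps \<Longrightarrow> \<beta> \<in> \<real>" for s ps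
  proof -
    from that(1) obtain \<beta> B where bB: "(\<beta>, B) \<in> set ps" "\<beta> + of_real B * s \<in> \<int>\<^sub>\<le>\<^sub>0"
      by (auto simp: gamma_poles_def)
    have "Im (\<beta> + of_real B * s) = 0"
      using bB(2) by (elim nonpos_Ints_cases) (simp only: complex_Im_of_int)
    with that(2,3)[OF bB(1)] have "Im s = 0" by (auto simp: complex_is_Real_iff)
    then show ?thesis by (intro exI[of _ "Re s"]) (simp add: complex_eq_iff)
  qed
  have Lim: "gamma_poles ?ls = of_real ` L"
    using realp[of _ ?ls] lnz real(2) unfolding L_def by blast
  have "\<beta> \<in> \<real>" if "(\<beta>, B) \<in> set ?rs" for \<beta> B
    using that real(1) by (force simp: refl_params_def)
  then have Rim: "gamma_poles ?rs = of_real ` R"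
    using realp[of _ ?rs] rnz unfolding R_def by blast
  \<comment> \<open>At a common pole x the two arguments are - l and - l'. Eliminating x gives the
    equality that \<open>fox_H_params\<close> forbids.\<close>
  have disj: "L \<inter> R = {}"
  proof (rule ccontr)
    assume "L \<inter> R \<noteq> {}"
    then obtain x where "of_real x \<in> gamma_poles ?ls" "of_real x \<in> gamma_poles ?rs"
      by (auto simp: L_def R_def)
    then obtain \<beta> B \<alpha> A where bB: "(\<beta>, B) \<in> set ?ls" "\<beta> + of_real B * of_real x \<in> \<int>\<^sub>\<le>\<^sub>0"
      and aA: "(\<alpha>, A) \<in> set (take n as)" "1 - \<alpha> - of_real A * of_real x \<in> \<int>\<^sub>\<le>\<^sub>0"
      by (fastforce simp: gamma_poles_def refl_params_def)
    then obtain l l' where l: "\<beta> + of_real B * of_real x = - of_nat l" "1 - \<alpha> - of_real A * of_real x = - of_nat l'"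
      by (auto elim!: nonpos_Ints_cases')
    then have "of_nat l + \<beta> = - (of_real B * of_real x)" "\<alpha> - of_nat l' - 1 = - (of_real A * of_real x)"
      by (auto simp: algebra_simps) (metis add.commute add_diff_cancel_left' diff_minus_eq_add eq_neg_iff_add_eq_0)+
    then have "of_real A * (of_nat l + \<beta>) = of_real B * (\<alpha> - of_nat l' - 1)"
      by (simp add: mult_ac)
    with par bB(1) aA(1) show False
      by (fastforce simp: fox_H_params_def)
  qed
  have LU: "\<exists>V<U. \<forall>x\<in>L. x \<le> V"
  proof -
    \<comment> \<open>U - 1 keeps the set nonempty when m = 0 without spoiling V < U.\<close>
    define V where "V = Max (insert (U - 1) ((\<lambda>(\<beta>, B). - Re \<beta> / B) ` set ?ls))"
    have "V < U"
      unfolding V_def using U by (subst Max_less_iff) auto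
    moreover have "x \<le> V" if x: "x \<in> L" for x
    proof -
      from x obtain \<beta> B where bB: "(\<beta>, B) \<in> set ?ls" "\<beta> + of_real B * of_real x \<in> \<int>\<^sub>\<le>\<^sub>0"
        by (auto simp: L_def gamma_poles_def)
      have "Re \<beta> + B * x \<le> 0" using nonpos_Ints_Re_le[OF bB(2)] by simp
      then have "x \<le> - Re \<beta> / B" using lpos[OF bB(1)] by (simp add: field_simps)
      also have "\<dots> \<le> V" unfolding V_def using bB(1) by (intro Max_ge) force+
      finally show ?thesis .
    qed
    ultimately show ?thesis by blast
  qed
  then obtain V where V: "V < U" "\<And>x. x \<in> L \<Longrightarrow> x \<le> V" by blast
  have "\<exists>W. \<forall>x\<in>R. W \<le> x"
  proof -
    \<comment> \<open>The element 0 covers n = 0; any lower bound for the right poles will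
      do.\<close>
    define W where "W = Min (insert 0 ((\<lambda>(\<alpha>, A). (1 - Re \<alpha>) / A) ` set (take n as)))"
    have "W \<le> x" if x: "x \<in> R" for x
    proof -
      from x obtain \<alpha> A where aA: "(\<alpha>, A) \<in> set (take n as)" "1 - \<alpha> - of_real A * of_real x \<in> \<int>\<^sub>\<le>\<^sub>0"
        by (fastforce simp: R_def gamma_poles_def refl_params_def)
      have "1 - Re \<alpha> - A * x \<le> 0" using nonpos_Ints_Re_le[OF aA(2)] by simp
      then have "(1 - Re \<alpha>) / A \<le> x" using rpos[OF aA(1)] by (simp add: field_simps)
      moreover have "W \<le> (1 - Re \<alpha>) / A" unfolding W_def using aA(1) by (intro Min_le) force+
      ultimately show ?thesis by simp
    qed
    then show ?thesis by blast
  qed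
  then obtain W where W: "\<And>x. x \<in> R \<Longrightarrow> W \<le> x" by blast
  have gap: "\<exists>x\<in>{u<..<v}. x \<notin> S" if "u < v" "countable S" for u v :: real and S
  proof -
    have "\<not> {u<..<v} \<subseteq> S"
      using uncountable_open_interval[of u v] that countable_subset by auto
    then show ?thesis by blast
  qed
  \<comment> \<open>\<open>b\<close> lies beyond all left poles but must dodge right ones;
    \<open>a\<close> lies before all right poles but must dodge left ones.\<close>
  obtain b where b: "V < b" "b < U" "b \<notin> R" using gap[OF V(1) cnt(2)] by auto
  obtain a where a: "a < min W V" "a \<notin> L"
  proof -
    have "m - 1 < m" for m :: real by simp
    from gap[OF this[of "min W V"] cnt(1)] that show thesis by (metis greaterThanLessThan_iff)
  qed
  have "a < b" "L \<subseteq> {..<b}" "R \<subseteq> {a<..}"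
    using a b V W by (force, force, force)
  then obtain w q where z: "vertical_contour a (zigzag a w q)"
    "\<And>t. a \<le> Re (zigzag a w q t)" "\<And>t. Re (zigzag a w q t) \<le> b"
    "of_real ` L \<subseteq> left_side (zigzag a w q)" "of_real ` R \<subseteq> right_side (zigzag a w q)"
    using ex_separating_contour[of a b L R] disj a(2) b(3) finL finR by metis
  then have "fox_contour m n as bs (zigzag a w q)"
    unfolding fox_contour_iff[OF par] Lim Rim by blast
  with b(2) z show ?thesis by (intro that)
qed

subsection \<open>Positivity of Beta averages\<close>

lemma integrable_exp_neg_abs:
  assumes "e > (0::real)"
  shows "integrable lborel (\<lambda>t::real. exp (- e * \<bar>t\<bar>))"
proof -
  have "(\<lambda>t. exp (- e * t)) absolutely_integrable_on {0..}"
    using assms by (intro nonnegative_absolutely_integrable_1 integrable_on_exp_minus_to_infinity) auto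
  then have pos: "integrable lborel (\<lambda>t. indicator {0..} t *\<^sub>R exp (- e * t))"
    unfolding set_integrable_def by (subst (asm) integrable_completion) auto
  have neg: "integrable lborel (\<lambda>t. indicator {0..} (- t) *\<^sub>R exp (- e * (- t)))"
    using lborel_integrable_real_affine[OF pos, of "- 1" 0] by simp
  show ?thesis
    by (rule Bochner_Integration.integrable_bound[OF Bochner_Integration.integrable_add[OF pos neg]])
       (auto intro!: AE_I2 simp: indicator_def)
qed

text \<open>Decay on the two vertical rays and continuity on the compact middle part are merged into
  one exponential majorant in t.\<close>

lemma integrable_zigzag:
  assumes vc: "vertical_contour a (zigzag a w q)"
    and ab: "\<And>t. a \<le> Re (zigzag a w q t)" "\<And>t. Re (zigzag a w q t) \<le> b"
    and f: "continuous_on (range (zigzag a w q)) f"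
    and gr: "vgrowth \<delta> f" "\<delta> < 0"
  shows "integrable lborel (\<lambda>t. f (zigzag a w q t) * zigzag_deriv w q t)"
proof -
  let ?c = "zigzag a w q"
  have cont: "continuous_on UNIV (\<lambda>t. f (?c t))"
    using continuous_on_compose[OF vertical_contour_continuous[OF vc] f] by (simp add: o_def)
  then have [measurable]: "(\<lambda>t. f (?c t)) \<in> borel_measurable borel"
    by (rule borel_measurable_continuous_onI)
  obtain C T0 where C: "C \<ge> 0"
    "\<And>s. a \<le> Re s \<Longrightarrow> Re s \<le> b \<Longrightarrow> T0 \<le> \<bar>Im s\<bar> \<Longrightarrow> norm (f s) \<le> C * exp (\<delta> / 2 * \<bar>Im s\<bar>)"
    using gr by (elim vgrowthE[where e = "\<delta> / 2" and ?x1.0 = a and ?x2.0 = b]) auto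
  \<comment> \<open>For \<bar>t\<bar> > 3 the curve is vertical with
    \<open>Im (zigzag a w q t) = t\<close>, so decay in \<open>Im s\<close> is decay in t.\<close>
  define T where "T = max T0 3"
  have "compact ((\<lambda>t. f (?c t)) ` {- T..T})"
    by (intro compact_continuous_image continuous_on_subset[OF cont]) auto
  then obtain K1 where K1: "\<And>t. \<bar>t\<bar> \<le> T \<Longrightarrow> norm (f (?c t)) \<le> K1"
    using compact_imp_bounded by (force simp: bounded_iff abs_le_iff)
  obtain K2 where K2: "\<And>t. norm (zigzag_deriv w q t) \<le> K2"
    using zigzag_deriv_bounded by blast
  \<comment> \<open>The second entry compensates for the factor
    \<open>exp (\<delta> / 2 * \<bar>t\<bar>)\<close>, which is at least
    \<open>exp (\<delta> / 2 * T)\<close> on the middle part.\<close>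
  define K where "K = max C (K1 * exp (- \<delta> / 2 * T))"
  have bnd: "norm (f (?c t)) \<le> K * exp (\<delta> / 2 * \<bar>t\<bar>)" for t
  proof (cases "\<bar>t\<bar> \<le> T")
    case True
    have "norm (f (?c 0)) \<le> K1" by (intro K1) (simp add: T_def)
    then have "0 \<le> K1" using norm_ge_zero order_trans by blast
    have "norm (f (?c t)) \<le> K1" by (rule K1[OF True])
    also have "\<dots> \<le> K1 * exp (\<delta> / 2 * (\<bar>t\<bar> - T))"
      using \<open>0 \<le> K1\<close> True gr(2) by (simp add: mult_le_cancel_left1 mult_nonpos_nonpos)
    also have "\<dots> = (K1 * exp (- \<delta> / 2 * T)) * exp (\<delta> / 2 * \<bar>t\<bar>)"
      by (simp add: algebra_simps diff_divide_distrib flip: exp_add)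
    also have "\<dots> \<le> K * exp (\<delta> / 2 * \<bar>t\<bar>)"
      by (intro mult_right_mono) (auto simp: K_def)
    finally show ?thesis .
  next
    case False
    then have "?c t = Complex a t" by (auto simp: zigzag_def T_def)
    then have "norm (f (?c t)) \<le> C * exp (\<delta> / 2 * \<bar>t\<bar>)"
      using C(2)[of "?c t"] ab[of t] False by (auto simp: T_def)
    also have "\<dots> \<le> K * exp (\<delta> / 2 * \<bar>t\<bar>)"
      by (intro mult_right_mono) (auto simp: K_def)
    finally show ?thesis .
  qed
  show ?thesis
  proof (rule Bochner_Integration.integrable_bound)
    show "integrable lborel (\<lambda>t::real. (K * K2) * exp (- (- \<delta> / 2) * \<bar>t\<bar>))"
      using gr(2) by (intro integrable_mult_right integrable_exp_neg_abs) auto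
    have "norm (f (?c t) * zigzag_deriv w q t) \<le> (K * exp (\<delta> / 2 * \<bar>t\<bar>)) * K2" for t
      unfolding norm_mult using bnd[of t] K2[of t] order_trans[OF norm_ge_zero bnd[of t]]
      by (intro mult_mono) auto
    then show "AE t in lborel. norm (f (?c t) * zigzag_deriv w q t) \<le> norm ((K * K2) * exp (- (- \<delta> / 2) * \<bar>t\<bar>))"
      by (intro AE_I2) (auto simp: mult_ac intro: order_trans[OF _ abs_ge_self])
  qed measurable
qed

lemma has_line_integral_zigzag:
  assumes "integrable lborel (\<lambda>t. f (zigzag a w q t) * zigzag_deriv w q t)"
  shows "has_line_integral f (\<integral>t. f (zigzag a w q t) * zigzag_deriv w q t \<partial>lborel) (zigzag a w q)"
  unfolding has_line_integral_def
  by (rule has_integral_spike_finite[OF _ _ has_integral_integral_lborel[OF assms], of "{0, 1, 2}"])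
     (auto simp: vector_derivative_at zigzag_has_vector_derivative)

text \<open>Strictness comes from measure: a nonnegative function with integral 0 vanishes almost
  everywhere, but (0, 1) is not a null set.\<close>

lemma integral_complex_pos:
  assumes int: "integrable lborel (h :: real \<Rightarrow> complex)"
    and pos: "\<And>u. 0 < u \<Longrightarrow> u < 1 \<Longrightarrow> 0 < h u" and zero: "\<And>u. \<not> (0 < u \<and> u < 1) \<Longrightarrow> h u = 0"
  shows "0 < (\<integral>u. h u \<partial>lborel)"
proof -
  have Re: "Re (h u) \<ge> 0" and Im: "Im (h u) = 0" for u
    using pos[of u] zero[of u] by (cases "0 < u \<and> u < 1"; force simp: less_complex_def)+
  have "Im (\<integral>u. h u \<partial>lborel) = 0"
    using integral_Im[OF int] Im by simp
  moreover have "Re (\<integral>u. h u \<partial>lborel) > 0"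
  proof -
    have eq: "Re (\<integral>u. h u \<partial>lborel) = (\<integral>u. Re (h u) \<partial>lborel)"
      using integral_Re[OF int] by simp
    have "(\<integral>u. Re (h u) \<partial>lborel) \<noteq> 0"
    proof
      assume "(\<integral>u. Re (h u) \<partial>lborel) = 0"
      then have "AE u in lborel. Re (h u) = 0"
        using Re int by (subst (asm) integral_nonneg_eq_0_iff_AE) auto
      then have "AE u in lborel. u \<notin> {0<..<1::real}"
      proof eventually_elim
        case (elim u)
        then show ?case using pos[of u] by (auto simp: less_complex_def)
      qed
      then have "emeasure lborel {0<..<1::real} = 0"
        by (subst (asm) AE_iff_measurable[of "{0<..<1}"]) auto
      then show False by simp
    qed
    moreover have "(\<integral>u. Re (h u) \<partial>lborel) \<ge> 0"
      using Re by (intro integral_nonneg_AE) auto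
    ultimately show ?thesis using eq by simp
  qed
  ultimately show ?thesis by (simp add: less_complex_def)
qed

text \<open>Inserting the Beta integral and exchanging the integrations exhibits the new function as
  an average of the positive values of the old one at the points
  \<open>x * u powr \<omega>2 * (1 - u) powr \<mu>2\<close>, \<open>0 < u < 1\<close>.\<close>

lemma Beta_multiplier_positive:
  fixes g c :: "real \<Rightarrow> complex" and K :: complex
  assumes g: "integrable lborel g" and c [measurable]: "c \<in> borel_measurable borel"
    and ab: "\<And>t. a \<le> Re (c t)" "\<And>t. Re (c t) \<le> b"
    and par: "\<omega>2 > 0" "\<mu>2 > 0" "\<omega>1 - \<omega>2 * b > 0" "\<mu>1 - \<mu>2 * b > 0"
    and pos: "\<And>x. x > 0 \<Longrightarrow> 0 < K * (\<integral>t. g t * of_real x powr (- c t) \<partial>lborel)"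
  defines "G \<equiv> \<lambda>t. g t * Beta (of_real \<omega>1 - of_real \<omega>2 * c t) (of_real \<mu>1 - of_real \<mu>2 * c t)"
  shows "integrable lborel G"
    and "\<And>x. x > 0 \<Longrightarrow> 0 < K * (\<integral>t. G t * of_real x powr (- c t) \<partial>lborel)"
proof -
  let ?z = "\<lambda>t. of_real \<omega>1 - of_real \<omega>2 * c t" and ?w = "\<lambda>t. of_real \<mu>1 - of_real \<mu>2 * c t"
  let ?zb = "complex_of_real (\<omega>1 - \<omega>2 * b)" and ?wb = "complex_of_real (\<mu>1 - \<mu>2 * b)"
  note [measurable] = borel_measurable_integrable[OF g]
  have zw: "\<omega>1 - \<omega>2 * b \<le> Re (?z t)" "\<mu>1 - \<mu>2 * b \<le> Re (?w t)" for t
    using par ab[of t] by (auto intro: mult_left_mono)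
  have zw0: "Re (?z t) > 0" "Re (?w t) > 0" for t
    using zw[of t] par by linarith+
  \<comment> \<open>For 0 < u < 1 the powers of u and 1 - u grow as their exponents fall, so the
    kernel for \<open>Re s = b\<close> dominates. This majorant is free of t, which separates the
    variables.\<close>
  have kernel_le: "norm (Beta_kernel (?z t) (?w t) u) \<le> norm (Beta_kernel ?zb ?wb u)" for t u
    unfolding norm_Beta_kernel using zw[of t] by (auto intro!: mult_mono powr_mono')
  define k where "k = (\<lambda>x t u. g t * of_real x powr (- c t) * Beta_kernel (?z t) (?w t) u)"
  have int_k: "integrable (lborel \<Otimes>\<^sub>M lborel) (\<lambda>(t, u). k x t u)" if x: "x > 0" for x
  proof (rule Bochner_Integration.integrable_bound)
    let ?M = "x powr (- a) + x powr (- b)"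
    show "integrable (lborel \<Otimes>\<^sub>M lborel) (\<lambda>(t, u). (norm (g t) * ?M) * norm (Beta_kernel ?zb ?wb u))"
    proof (rule lborel_pair.Fubini_integrable)
      have B0: "integrable lborel (\<lambda>u. norm (Beta_kernel ?zb ?wb u))"
        using par by (intro integrable_norm integrable_Beta_kernel) auto
      then show "AE t in lborel. integrable lborel (\<lambda>u. case (t, u) of (t, u) \<Rightarrow> (norm (g t) * ?M) * norm (Beta_kernel ?zb ?wb u))"
        by simp
      show "integrable lborel (\<lambda>t. \<integral>u. norm (case (t, u) of (t, u) \<Rightarrow> (norm (g t) * ?M) * norm (Beta_kernel ?zb ?wb u)) \<partial>lborel)"
        using g by (simp add: abs_mult)
    qed measurable
    show "(\<lambda>(t, u). k x t u) \<in> borel_measurable (lborel \<Otimes>\<^sub>M lborel)"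
      unfolding k_def Beta_kernel_def powr_def by measurable
    have "norm (k x t u) \<le> (norm (g t) * ?M) * norm (Beta_kernel ?zb ?wb u)" for t u
      unfolding k_def norm_mult using x ab[of t] kernel_le[of t u] powr_neg_le[OF x ab(1) ab(2)]
      by (intro mult_mono) (auto simp: norm_of_real_powr)
    then show "AE p in lborel \<Otimes>\<^sub>M lborel. norm (case p of (t, u) \<Rightarrow> k x t u) \<le>
        norm (case p of (t, u) \<Rightarrow> (norm (g t) * ?M) * norm (Beta_kernel ?zb ?wb u))"
      by (intro AE_I2) (auto intro: order_trans[OF _ abs_ge_self])
  qed
  have inner: "(\<integral>u. k x t u \<partial>lborel) = G t * of_real x powr (- c t)" for x t
    using integral_Beta_kernel[OF zw0[of t]] by (simp add: k_def G_def mult_ac)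
  show "integrable lborel G"
    \<comment> \<open>At x = 1 the power of x disappears and the inner integral is \<open>G\<close>
      itself.\<close>
    using lborel_pair.integrable_fst'[OF int_k[of 1]] by (simp add: inner)
  fix x :: real assume x: "x > 0"
  define h where "h = (\<lambda>u. K * (\<integral>t. k x t u \<partial>lborel))"
  have "0 < (\<integral>u. h u \<partial>lborel)"
  proof (rule integral_complex_pos)
    show "integrable lborel h"
      unfolding h_def using lborel_pair.integrable_snd[OF int_k[OF x]] by simp
    show "h u = 0" if "\<not> (0 < u \<and> u < 1)" for u
      using that by (auto simp: h_def k_def Beta_kernel_def)
    fix u :: real assume u: "0 < u" "u < 1"
    define y where "y = x * (u powr \<omega>2 * (1 - u) powr \<mu>2)"
    define v where "v = u powr (\<omega>1 - 1) * (1 - u) powr (\<mu>1 - 1)"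
    have y: "y > 0" and v: "v > 0" using u x by (auto simp: y_def v_def)
    \<comment> \<open>All powers with exponent proportional to \<open>c t\<close> are gathered into
      one power of y; what remains is the positive weight v, free of t.\<close>
    have "k x t u = of_real v * (g t * of_real y powr (- c t))" for t
    proof -
      have P: "complex_of_real r powr s = exp (s * of_real (ln r))" if "r > 0" for r s
        using that by (simp add: powr_def Ln_of_real)
      have "of_real x powr (- c t) * (of_real u powr (?z t - 1) * of_real (1 - u) powr (?w t - 1)) = of_real v * of_real y powr (- c t)"
      proof -
        have "complex_of_real v = exp ((of_real \<omega>1 - 1) * of_real (ln u) + (of_real \<mu>1 - 1) * of_real (ln (1 - u)))"
          using u by (simp add: v_def powr_def exp_add flip: exp_of_real)
        moreover have "ln y = ln x + (\<omega>2 * ln u + \<mu>2 * ln (1 - u))"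
          using u x by (simp add: y_def ln_mult ln_powr)
        moreover have "0 < 1 - u" using u by simp
        ultimately show ?thesis
          using u x y by (simp only: P flip: exp_add) (simp add: algebra_simps)
      qed
      then show ?thesis using u by (simp add: k_def Beta_kernel_def mult_ac)
    qed
    then have "h u = of_real v * (K * (\<integral>t. g t * of_real y powr (- c t) \<partial>lborel))"
      by (simp add: h_def)
    moreover have "0 < complex_of_real v" using v by (simp add: less_complex_def)
    ultimately show "0 < h u"
      using pos[OF y] v by (auto simp: less_complex_def)
  qed
  also have "(\<integral>u. h u \<partial>lborel) = K * (\<integral>u. (\<integral>t. k x t u \<partial>lborel) \<partial>lborel)"
    by (simp add: h_def)
  also have "(\<integral>u. (\<integral>t. k x t u \<partial>lborel) \<partial>lborel) = (\<integral>t. (\<integral>u. k x t u \<partial>lborel) \<partial>lborel)"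
    using lborel_pair.Fubini_integral[OF int_k[OF x]] .
  also have "\<dots> = (\<integral>t. G t * of_real x powr (- c t) \<partial>lborel)"
    by (simp add: inner)
  finally show "0 < K * (\<integral>t. G t * of_real x powr (- c t) \<partial>lborel)" .
qed

text \<open>The conclusions of \<open>Beta_multiplier_positive\<close>, integrability and positivity
  at every x > 0, are again its hypotheses, so the Beta factors can be inserted one at a
  time.\<close>

lemma Beta_product_positive:
  fixes g c :: "real \<Rightarrow> complex" and K :: complex
  assumes g: "integrable lborel g" and c: "c \<in> borel_measurable borel"
    and ab: "\<And>t. a \<le> Re (c t)" "\<And>t. Re (c t) \<le> b"
    and J: "finite J"
    and par: "\<And>j. j \<in> J \<Longrightarrow> \<omega>2 j > 0 \<and> \<mu>2 j > 0 \<and> \<omega>1 j - \<omega>2 j * b > 0 \<and> \<mu>1 j - \<mu>2 j * b > 0"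
    and pos: "\<And>x. x > 0 \<Longrightarrow> 0 < K * (\<integral>t. g t * of_real x powr (- c t) \<partial>lborel)"
  defines "G \<equiv> \<lambda>J t. g t * (\<Prod>j\<in>J. Beta (of_real (\<omega>1 j) - of_real (\<omega>2 j) * c t) (of_real (\<mu>1 j) - of_real (\<mu>2 j) * c t))"
  shows "integrable lborel (G J) \<and> (\<forall>x>0. 0 < K * (\<integral>t. G J t * of_real x powr (- c t) \<partial>lborel))"
  using J par
proof (induction J)
  case empty
  then show ?case using g pos by (simp add: G_def)
next
  case (insert j J)
  have "G (insert j J) = (\<lambda>t. G J t * Beta (of_real (\<omega>1 j) - of_real (\<omega>2 j) * c t) (of_real (\<mu>1 j) - of_real (\<mu>2 j) * c t))"
    using insert.hyps by (simp add: G_def fun_eq_iff mult_ac)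
  moreover from insert have "integrable lborel (G J)" "\<And>x. x > 0 \<Longrightarrow> 0 < K * (\<integral>t. G J t * of_real x powr (- c t) \<partial>lborel)"
    by auto
  ultimately show ?case
    using Beta_multiplier_positive[OF _ c ab, of "G J" "\<omega>2 j" "\<mu>2 j" "\<omega>1 j" "\<mu>1 j" K] insert.prems by simp
qed

subsection \<open>Parameter lists\<close>

text \<open>The factor \<open>x powr (- s)\<close> is kept apart because the averaging argument
  needs one integrable function, independent of x, for all x > 0.\<close>

lemma fox_H_zigzag:
  assumes par: "fox_H_params m n as bs" and chi: "fox_chi m n as bs > 0"
    and con: "fox_contour m n as bs (zigzag a w q)" and vc: "vertical_contour a (zigzag a w q)"
    and ab: "\<And>t. a \<le> Re (zigzag a w q t)" "\<And>t. Re (zigzag a w q t) \<le> b"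
  shows "integrable lborel (\<lambda>t. fox_Xi m n as bs (zigzag a w q t) * zigzag_deriv w q t)"
    and "x > 0 \<Longrightarrow> fox_H m n as bs x = 1 / (2 * of_real pi * \<i>) *
      (\<integral>t. fox_Xi m n as bs (zigzag a w q t) * zigzag_deriv w q t * of_real x powr (- zigzag a w q t) \<partial>lborel)"
proof -
  let ?c = "zigzag a w q" and ?\<delta> = "- (pi / 2) * fox_chi m n as bs"
  have \<delta>: "?\<delta> < 0" using chi by simp
  have "range ?c \<subseteq> - gamma_poles (take m bs @ refl_params (take n as))"
    using con side_not_range unfolding fox_contour_iff[OF par] gamma_poles_Un by blast
  then have cont: "continuous_on (range ?c) (fox_Xi m n as bs)"
    by (intro holomorphic_on_imp_continuous_on holomorphic_on_subset[OF holomorphic_fox_Xi])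
  show "integrable lborel (\<lambda>t. fox_Xi m n as bs (?c t) * zigzag_deriv w q t)"
    by (rule integrable_zigzag[OF vc ab cont vgrowth_fox_Xi[OF par] \<delta>])
  assume x: "x > 0"
  let ?f = "\<lambda>s. fox_Xi m n as bs s * of_real x powr (- s)"
  have "vgrowth ?\<delta> ?f"
    using vgrowth_mult[OF vgrowth_fox_Xi[OF par] vgrowth_powr[OF x]] by simp
  moreover have "continuous_on (range ?c) ?f"
    using x by (intro continuous_intros cont) auto
  ultimately have "integrable lborel (\<lambda>t. ?f (?c t) * zigzag_deriv w q t)"
    using \<delta> by (intro integrable_zigzag[OF vc ab])
  from fox_H_eq[OF par chi x con has_line_integral_zigzag[OF this]]
  show "fox_H m n as bs x = 1 / (2 * of_real pi * \<i>) *
      (\<integral>t. fox_Xi m n as bs (?c t) * zigzag_deriv w q t * of_real x powr (- ?c t) \<partial>lborel)"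
    by (simp add: mult_ac)
qed

lemma take_pair_list: "n \<le> l \<Longrightarrow> take n (pair_list l x X) = pair_list n x X"
  by (simp add: pair_list_def take_map take_upt del: upt_Suc)

lemma set_pair_list: "set (pair_list l x X) = (\<lambda>j. (of_real (x j), X j)) ` {1..l}"
  by (auto simp: pair_list_def)

lemma length_pair_list [simp]: "length (pair_list l x X) = l"
  by (simp add: pair_list_def)

lemma sum_list_pair_list: "(\<Sum>(\<alpha>, A)\<leftarrow>pair_list l x X. A) = (\<Sum>j=1..l. X j)"
  by (simp add: pair_list_def o_def interv_sum_list_conv_sum_set_nat atLeastLessThanSuc_atLeastAtMost del: upt_Suc)

lemma sum_list_drop_pair_list: "(\<Sum>(\<alpha>, A)\<leftarrow>drop n (pair_list l x X). A) = (\<Sum>j=n+1..l. X j)"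
  by (simp add: pair_list_def o_def drop_map interv_sum_list_conv_sum_set_nat atLeastLessThanSuc_atLeastAtMost del: upt_Suc)

lemma fox_chi_pair_list:
  assumes "n \<le> p" "m \<le> q"
  shows "fox_chi m n (pair_list p \<alpha> A) (pair_list q \<beta> B) =
    (\<Sum>j=1..n. A j) - (\<Sum>j=n+1..p. A j) + (\<Sum>j=1..m. B j) - (\<Sum>j=m+1..q. B j)"
  using assms unfolding fox_chi_def sum_list_drop_pair_list by (simp add: take_pair_list sum_list_pair_list)

section \<open>The added parameters and their Beta factors\<close>

text \<open>The index pairs occur in descending order: with i = k - j + 1 the entries use the
  indices 2 i - 1 and 2 i. Since j \<le> k, the subtraction on \<open>nat\<close> is not
  truncated.\<close>

definition Beta_params :: "nat \<Rightarrow> (nat \<Rightarrow> real) \<Rightarrow> (nat \<Rightarrow> real) \<Rightarrow> fox_list" where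
  "Beta_params k \<omega> l = concat (map (\<lambda>j.
      [(complex_of_real (1 - \<omega> (2 * (k - j) + 1)), \<omega> (2 * (k - j + 1))),
       (complex_of_real (1 - l (2 * (k - j) + 1)), l (2 * (k - j + 1)))]) [1..<Suc k])"

lemma length_Beta_params: "length (Beta_params k \<omega> l) = 2 * k"
  by (simp add: Beta_params_def length_concat o_def sum_list_triv del: upt_Suc)

lemma set_Beta_params:
  "set (Beta_params k \<omega> l) = (\<Union>i\<in>{1..k}. {(complex_of_real (1 - \<omega> (2 * i - 1)), \<omega> (2 * i)),
     (complex_of_real (1 - l (2 * i - 1)), l (2 * i))})"
proof -
  let ?F = "\<lambda>i. {(complex_of_real (1 - \<omega> (2 * i - 1)), \<omega> (2 * i)), (complex_of_real (1 - l (2 * i - 1)), l (2 * i))}"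
  have "set (Beta_params k \<omega> l) = (\<Union>j\<in>{1..k}. ?F (k - j + 1))"
    by (simp add: Beta_params_def atLeastLessThanSuc_atLeastAtMost del: upt_Suc)
  also have "\<dots> = (\<Union>i\<in>(\<lambda>j. k - j + 1) ` {1..k}. ?F i)"
    by simp
  also have "(\<lambda>j. k - j + 1) ` {1..k} = {1..k}"
  proof (intro equalityI subsetI)
    fix i assume "i \<in> {1..k}"
    then show "i \<in> (\<lambda>j. k - j + 1) ` {1..k}"
      by (intro image_eqI[of _ _ "k - i + 1"]) auto
  qed auto
  finally show ?thesis .
qed

lemma reverse_index:
  fixes f :: "nat \<Rightarrow> 'a :: comm_monoid_add" and g :: "nat \<Rightarrow> 'b :: comm_monoid_mult"
  shows "(\<Sum>j=1..k. f (k - j + 1)) = (\<Sum>j=1..k. f j)" "(\<Prod>j=1..k. g (k - j + 1)) = (\<Prod>j=1..k. g j)"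
proof -
  show "(\<Sum>j=1..k. f (k - j + 1)) = (\<Sum>j=1..k. f j)"
    by (subst (2) sum.atLeastAtMost_rev) (auto intro!: sum.cong arg_cong[of _ _ f])
  show "(\<Prod>j=1..k. g (k - j + 1)) = (\<Prod>j=1..k. g j)"
    by (subst (2) prod.atLeastAtMost_rev) (auto intro!: prod.cong arg_cong[of _ _ g])
qed

lemma sum_list_Beta_params: "(\<Sum>(\<alpha>, A)\<leftarrow>Beta_params k \<omega> l. A) = (\<Sum>j=1..k. \<omega> (2 * j) + l (2 * j))"
proof -
  have "(\<Sum>(\<alpha>, A)\<leftarrow>concat (map (\<lambda>j. [(x j, X j), (y j, Y j)]) js). A) = (\<Sum>j\<leftarrow>js. X j + Y j)"
    for js :: "nat list" and x y :: "nat \<Rightarrow> complex" and X Y :: "nat \<Rightarrow> real"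
    by (induction js) auto
  then have "(\<Sum>(\<alpha>, A)\<leftarrow>Beta_params k \<omega> l. A) = (\<Sum>j\<leftarrow>[1..<Suc k]. \<omega> (2 * (k - j + 1)) + l (2 * (k - j + 1)))"
    unfolding Beta_params_def .
  also have "\<dots> = (\<Sum>j=1..k. \<omega> (2 * (k - j + 1)) + l (2 * (k - j + 1)))"
    by (simp add: interv_sum_list_conv_sum_set_nat atLeastLessThanSuc_atLeastAtMost del: upt_Suc)
  also have "\<dots> = (\<Sum>j=1..k. \<omega> (2 * j) + l (2 * j))"
    by (rule reverse_index(1)[of "\<lambda>j. \<omega> (2 * j) + l (2 * j)"])
  finally show ?thesis .
qed

lemma Gamma_prod_Beta_params:
  "Gamma_prod (refl_params (Beta_params k \<omega> l)) s =
    (\<Prod>j=1..k. Gamma (of_real (\<omega> (2 * j - 1)) - of_real (\<omega> (2 * j)) * s) * Gamma (of_real (l (2 * j - 1)) - of_real (l (2 * j)) * s))"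
proof -
  let ?f = "\<lambda>i. Gamma (of_real (\<omega> (2 * i - 1)) - of_real (\<omega> (2 * i)) * s) * Gamma (of_real (l (2 * i - 1)) - of_real (l (2 * i)) * s)"
  have "(\<Prod>(\<alpha>, A)\<leftarrow>concat (map (\<lambda>j. [(x j, X j), (y j, Y j)]) js). Gamma (1 - \<alpha> - of_real A * s)) =
      (\<Prod>j\<leftarrow>js. Gamma (1 - x j - of_real (X j) * s) * Gamma (1 - y j - of_real (Y j) * s))"
    for js :: "nat list" and x y :: "nat \<Rightarrow> complex" and X Y :: "nat \<Rightarrow> real"
    by (induction js) (auto simp: mult_ac)
  then have "Gamma_prod (refl_params (Beta_params k \<omega> l)) s = (\<Prod>j\<leftarrow>[1..<Suc k]. ?f (k - j + 1))"
    unfolding Beta_params_def Gamma_prod_refl_params by simp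
  also have "\<dots> = (\<Prod>j\<in>set [1..<Suc k]. ?f (k - j + 1))"
    by (rule prod.distinct_set_conv_list[symmetric]) simp
  also have "set [1..<Suc k] = {1..k}" by auto
  also have "(\<Prod>j=1..k. ?f (k - j + 1)) = (\<Prod>j=1..k. ?f j)"
    by (rule reverse_index(2)[of ?f])
  finally show ?thesis .
qed

lemma rGamma_prod_pair_list:
  "rGamma_prod (refl_params (pair_list k x X)) s = (\<Prod>j=1..k. rGamma (1 - of_real (x j) - of_real (X j) * s))"
proof -
  have "rGamma_prod (refl_params (pair_list k x X)) s = (\<Prod>j\<leftarrow>[1..<Suc k]. rGamma (1 - of_real (x j) - of_real (X j) * s))"
    by (simp add: rGamma_prod_def refl_params_def pair_list_def o_def del: upt_Suc)
  also have "\<dots> = (\<Prod>j\<in>set [1..<Suc k]. rGamma (1 - of_real (x j) - of_real (X j) * s))"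
    by (rule prod.distinct_set_conv_list[symmetric]) simp
  also have "set [1..<Suc k] = {1..k}" by auto
  finally show ?thesis .
qed

lemma refl_params_append: "refl_params (ps @ qs) = refl_params ps @ refl_params qs"
  by (simp add: refl_params_def)

lemma rGamma_prod_append: "rGamma_prod (ps @ qs) s = rGamma_prod ps s * rGamma_prod qs s"
  by (simp add: rGamma_prod_def)

text \<open>The added upper parameters give the two Gamma factors of Beta. The added lower ones
  stand behind position m and give the reciprocal of Gamma at the sum of the two arguments.\<close>

lemma fox_Xi_Beta:
  assumes "n \<le> length as" "m \<le> length bs"
  shows "fox_Xi m (n + 2 * k) (Beta_params k \<omega> l @ as)
       (bs @ pair_list k (\<lambda>j. 1 - \<omega> (2 * j - 1) - l (2 * j - 1)) (\<lambda>j. \<omega> (2 * j) + l (2 * j))) s =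
     fox_Xi m n as bs s *
       (\<Prod>j=1..k. Beta (of_real (\<omega> (2 * j - 1)) - of_real (\<omega> (2 * j)) * s) (of_real (l (2 * j - 1)) - of_real (l (2 * j)) * s))"
proof -
  have "(\<Prod>j=1..k. Beta (of_real (\<omega> (2 * j - 1)) - of_real (\<omega> (2 * j)) * s) (of_real (l (2 * j - 1)) - of_real (l (2 * j)) * s)) =
    Gamma_prod (refl_params (Beta_params k \<omega> l)) s *
    rGamma_prod (refl_params (pair_list k (\<lambda>j. 1 - \<omega> (2 * j - 1) - l (2 * j - 1)) (\<lambda>j. \<omega> (2 * j) + l (2 * j)))) s"
    unfolding Gamma_prod_Beta_params rGamma_prod_pair_list prod.distrib[symmetric]
    by (intro prod.cong refl) (simp add: Beta_altdef algebra_simps)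
  then show ?thesis
    using assms unfolding fox_Xi_eq
    by (simp add: length_Beta_params refl_params_append Gamma_prod_append rGamma_prod_append mult_ac)
qed

section \<open>One contour for the old and the new function\<close>

theorem corollary5p3:
  fixes m' n' p' q' k :: nat
    and \<alpha>' A' \<beta>' B' :: "nat \<Rightarrow> real"
    and \<omega> lam :: "nat \<Rightarrow> real"
  assumes H'_defined: "fox_H_params m' n' (pair_list p' \<alpha>' A') (pair_list q' \<beta>' B')"
    and H'_pos: "\<And>t::real. t > 0 \<Longrightarrow> 0 < fox_H m' n' (pair_list p' \<alpha>' A') (pair_list q' \<beta>' B') t"
    and mn_pos: "m' * n' > 0"
    and chi_pos: "(\<Sum>j=1..n'. A' j) - (\<Sum>j=n'+1..p'. A' j)
                  + (\<Sum>j=1..m'. B' j) - (\<Sum>j=m'+1..q'. B' j) > 0"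
    and k_pos: "k \<ge> 1"
    and even_pos: "\<And>j. j \<in> {1..k} \<Longrightarrow> \<omega> (2 * j) > 0 \<and> lam (2 * j) > 0"
    and omega_min: "\<And>j. j \<in> {1..k} \<Longrightarrow>
          \<omega> (2 * j - 1) + \<omega> (2 * j) * Min ((\<lambda>l. \<beta>' l / B' l) ` {1..m'}) > 0"
    and lam_min: "\<And>j. j \<in> {1..k} \<Longrightarrow>
          lam (2 * j - 1) + lam (2 * j) * Min ((\<lambda>l. \<beta>' l / B' l) ` {1..m'}) > 0"
  shows "let as'' = concat (map (\<lambda>j.
                  [(complex_of_real (1 - \<omega> (2 * (k - j) + 1)), \<omega> (2 * (k - j + 1))),
                   (complex_of_real (1 - lam (2 * (k - j) + 1)), lam (2 * (k - j + 1)))])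
                  [1..<Suc k]) @ pair_list p' \<alpha>' A';
             bs'' = pair_list q' \<beta>' B' @
                  pair_list k (\<lambda>j. 1 - \<omega> (2 * j - 1) - lam (2 * j - 1))
                              (\<lambda>j. \<omega> (2 * j) + lam (2 * j))
         in fox_H_params m' (n' + 2 * k) as'' bs'' \<and>
            (\<forall>t::real. t > 0 \<longrightarrow> 0 < fox_H m' (n' + 2 * k) as'' bs'' t)"
proof -
  define as' bs' where "as' = pair_list p' \<alpha>' A'" and "bs' = pair_list q' \<beta>' B'"
  define E where "E = pair_list k (\<lambda>j. 1 - \<omega> (2 * j - 1) - lam (2 * j - 1)) (\<lambda>j. \<omega> (2 * j) + lam (2 * j))"
  define as'' bs'' where "as'' = Beta_params k \<omega> lam @ as'" and "bs'' = bs' @ E"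
  have par': "fox_H_params m' n' as' bs'"
    using H'_defined by (simp add: as'_def bs'_def)
  have len: "n' \<le> p'" "m' \<le> q'"
    using H'_defined by (auto simp: fox_H_params_def)
  have take_as: "take (n' + 2 * k) as'' = Beta_params k \<omega> lam @ take n' as'"
    and drop_as: "drop (n' + 2 * k) as'' = drop n' as'"
    by (simp_all add: as''_def length_Beta_params)
  have take_bs: "take m' bs'' = take m' bs'" and drop_bs: "drop m' bs'' = drop m' bs' @ E"
    using len by (simp_all add: bs''_def bs'_def)
  have Bpos: "B' l > 0" if "l \<in> {1..m'}" for l
    using fox_params_pos(1)[OF par', of "of_real (\<beta>' l)" "B' l"] that len by (auto simp: bs'_def set_pair_list)
  have Min_le: "Min ((\<lambda>l. \<beta>' l / B' l) ` {1..m'}) \<le> \<beta>' l / B' l" if "l \<in> {1..m'}" for l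
    using that by (intro Min_le) auto
  have key: "x + y * (\<beta>' l / B' l) > 0"
    if "x + y * Min ((\<lambda>l. \<beta>' l / B' l) ` {1..m'}) > 0" "y > 0" "l \<in> {1..m'}" for x y l
    using that(1) mult_left_mono[OF Min_le[OF that(3)], of y] that(2) by linarith
  have new: "\<exists>x y. \<alpha> = of_real (1 - x) \<and> A = y \<and> y > 0 \<and> (\<forall>l\<in>{1..m'}. x + y * (\<beta>' l / B' l) > 0)"
    if "(\<alpha>, A) \<in> set (Beta_params k \<omega> lam)" for \<alpha> A
  proof -
    from that obtain i where i: "i \<in> {1..k}" "(\<alpha> = of_real (1 - \<omega> (2 * i - 1)) \<and> A = \<omega> (2 * i)) \<or>
        (\<alpha> = of_real (1 - lam (2 * i - 1)) \<and> A = lam (2 * i))"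
      unfolding set_Beta_params by blast
    have "\<forall>l\<in>{1..m'}. \<omega> (2 * i - 1) + \<omega> (2 * i) * (\<beta>' l / B' l) > 0"
      using key[OF omega_min[OF i(1)]] even_pos[OF i(1)] by blast
    moreover have "\<forall>l\<in>{1..m'}. lam (2 * i - 1) + lam (2 * i) * (\<beta>' l / B' l) > 0"
      using key[OF lam_min[OF i(1)]] even_pos[OF i(1)] by blast
    ultimately show ?thesis using i even_pos[OF i(1)] by blast
  qed
  \<comment> \<open>Left poles satisfy s \<le> - \<beta>' / B', new right poles s \<ge> x / A, and
    the condition on the minimum says - \<beta>' / B' < x / A. The computation is this comparison
    with denominators cleared.\<close>
  have sep: "of_real A * (of_nat a + \<beta>) \<noteq> of_real B * (\<alpha> - of_nat b - 1)"
    if aA: "(\<alpha>, A) \<in> set (Beta_params k \<omega> lam)" and bB: "(\<beta>, B) \<in> set (take m' bs')" for \<alpha> A \<beta> B and a b :: nat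
  proof -
    from bB obtain l where l: "l \<in> {1..m'}" "\<beta> = of_real (\<beta>' l)" "B = B' l"
      using len by (auto simp: bs'_def take_pair_list set_pair_list)
    from new[OF aA] obtain x where x: "\<alpha> = of_real (1 - x)" "A > 0" "x + A * (\<beta>' l / B' l) > 0"
      using l(1) by blast
    have B: "B > 0" using Bpos l by simp
    have "0 < B * (x + A * (\<beta>' l / B))" using x B l by simp
    also have "\<dots> = B * x + A * \<beta>' l" using B by (simp add: field_simps)
    finally have "0 < B * x + A * \<beta>' l" .
    moreover have "0 \<le> A * real a" "0 \<le> B * real b" using x(2) B by auto
    ultimately have "0 < A * real a + B * real b + (B * x + A * \<beta>' l)"
      by linarith
    then have "A * (real a + \<beta>' l) \<noteq> B * (1 - x - real b - 1)"
      by (simp add: algebra_simps)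
    then have "complex_of_real (A * (real a + \<beta>' l)) \<noteq> of_real (B * (1 - x - real b - 1))"
      by (simp only: of_real_eq_iff not_False_eq_True)
    then show ?thesis by (simp add: l(2) x(1))
  qed
  have par'': "fox_H_params m' (n' + 2 * k) as'' bs''"
  proof -
    have "\<forall>(\<alpha>, A)\<in>set as''. A > 0"
      using new fox_params_pos(2)[OF par'] unfolding as''_def set_append by blast
    moreover have "\<forall>(\<beta>, B)\<in>set bs''. B > 0"
      using even_pos fox_params_pos(1)[OF par'] by (auto simp: bs''_def E_def set_pair_list intro!: add_pos_pos)
    moreover have "\<forall>(\<alpha>, A)\<in>set (take (n' + 2 * k) as''). \<forall>(\<beta>, B)\<in>set (take m' bs''). \<forall>a b :: nat.
        of_real A * (of_nat a + \<beta>) \<noteq> of_real B * (\<alpha> - of_nat b - 1)"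
      unfolding take_as take_bs set_append using sep par' unfolding fox_H_params_def by blast
    ultimately show ?thesis
      using len unfolding fox_H_params_def by (simp add: as''_def bs''_def as'_def bs'_def E_def length_Beta_params)
  qed
  have chi': "fox_chi m' n' as' bs' > 0"
    using chi_pos len by (simp add: as'_def bs'_def fox_chi_pair_list)
  \<comment> \<open>The sum of all \<omega> (2 j) + lam (2 j) enters with a plus sign from the upper
    list and with a minus sign from the lower list.\<close>
  have chi'': "fox_chi m' (n' + 2 * k) as'' bs'' > 0"
    using chi' unfolding fox_chi_def take_as drop_as take_bs drop_bs map_append sum_list_append
      sum_list_Beta_params E_def sum_list_pair_list by simp
  \<comment> \<open>\<open>Re s < U\<close> says exactly that both arguments of every Beta factor
    have positive real part.\<close>
  define U where "U = Min ((\<lambda>i. min (\<omega> (2 * i - 1) / \<omega> (2 * i)) (lam (2 * i - 1) / lam (2 * i))) ` {1..k})"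
  have U_less: "- Re \<beta> / B < U" if "(\<beta>, B) \<in> set (take m' bs'')" for \<beta> B
  proof -
    from that obtain l where l: "l \<in> {1..m'}" "\<beta> = of_real (\<beta>' l)" "B = B' l"
      using len by (auto simp: take_bs bs'_def take_pair_list set_pair_list)
    have "- (\<beta>' l / B' l) < x / y" if "x + y * Min ((\<lambda>l. \<beta>' l / B' l) ` {1..m'}) > 0" "y > 0" for x y
      using key[OF that l(1)] that(2) by (simp add: field_simps)
    then show ?thesis
      unfolding U_def l using k_pos even_pos omega_min lam_min by (subst Min_gr_iff) auto
  qed
  obtain a b w q where b: "b < U" and con'': "fox_contour m' (n' + 2 * k) as'' bs'' (zigzag a w q)"
    and vc: "vertical_contour a (zigzag a w q)"
    and ab: "\<And>t. a \<le> Re (zigzag a w q t)" "\<And>t. Re (zigzag a w q t) \<le> b"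
  proof (rule ex_fox_contour[OF par'' _ _ U_less])
    show "\<alpha> \<in> \<real>" if "(\<alpha>, A) \<in> set (take (n' + 2 * k) as'')" for \<alpha> A
    proof -
      from that consider "(\<alpha>, A) \<in> set (Beta_params k \<omega> lam)" | "(\<alpha>, A) \<in> set (take n' as')"
        unfolding take_as by auto
      then show ?thesis
      proof cases
        case 1
        from new[OF this] show ?thesis by auto
      next
        case 2
        then show ?thesis using len by (auto simp: as'_def take_pair_list set_pair_list)
      qed
    qed
    show "\<beta> \<in> \<real>" if "(\<beta>, B) \<in> set (take m' bs'')" for \<beta> B
      using that len unfolding take_bs by (auto simp: bs'_def take_pair_list set_pair_list)
  qed blast+
  let ?c = "zigzag a w q" and ?K = "1 / (2 * of_real pi * \<i>)"
  \<comment> \<open>The old pole families are among the new ones, on the same sides.\<close>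
  have con': "fox_contour m' n' as' bs' ?c"
    using con'' unfolding fox_contour_iff[OF par'] fox_contour_iff[OF par''] take_as take_bs
      refl_params_append gamma_poles_Un by blast
  define g where "g = (\<lambda>t. fox_Xi m' n' as' bs' (?c t) * zigzag_deriv w q t)"
  have g: "integrable lborel g"
    unfolding g_def by (rule fox_H_zigzag(1)[OF par' chi' con' vc ab])
  have pos: "0 < ?K * (\<integral>t. g t * of_real x powr (- ?c t) \<partial>lborel)" if "x > 0" for x
    using H'_pos[OF that] fox_H_zigzag(2)[OF par' chi' con' vc ab that]
    by (simp add: g_def as'_def bs'_def)
  have meas: "?c \<in> borel_measurable borel"
    by (rule borel_measurable_continuous_onI[OF vertical_contour_continuous[OF vc]])
  have Upar: "\<omega> (2 * j) > 0 \<and> lam (2 * j) > 0 \<and> \<omega> (2 * j - 1) - \<omega> (2 * j) * b > 0 \<and> lam (2 * j - 1) - lam (2 * j) * b > 0"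
    if j: "j \<in> {1..k}" for j
  proof -
    have "U \<le> min (\<omega> (2 * j - 1) / \<omega> (2 * j)) (lam (2 * j - 1) / lam (2 * j))"
      unfolding U_def using j by (intro Min.coboundedI) auto
    then have "b < \<omega> (2 * j - 1) / \<omega> (2 * j)" "b < lam (2 * j - 1) / lam (2 * j)" using b by auto
    then show ?thesis using even_pos[OF j] by (simp add: field_simps)
  qed
  have "0 < fox_H m' (n' + 2 * k) as'' bs'' x" if x: "x > 0" for x
  proof -
    have "0 < ?K * (\<integral>t. g t * (\<Prod>j\<in>{1..k}. Beta (of_real (\<omega> (2 * j - 1)) - of_real (\<omega> (2 * j)) * ?c t)
        (of_real (lam (2 * j - 1)) - of_real (lam (2 * j)) * ?c t)) * of_real x powr (- ?c t) \<partial>lborel)"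
      using Beta_product_positive[OF g meas ab, of "{1..k}" "\<lambda>j. \<omega> (2 * j)" "\<lambda>j. lam (2 * j)" "\<lambda>j. \<omega> (2 * j - 1)" "\<lambda>j. lam (2 * j - 1)" ?K]
        Upar pos x by blast
    also have "(\<lambda>t. g t * (\<Prod>j\<in>{1..k}. Beta (of_real (\<omega> (2 * j - 1)) - of_real (\<omega> (2 * j)) * ?c t)
        (of_real (lam (2 * j - 1)) - of_real (lam (2 * j)) * ?c t)) * of_real x powr (- ?c t)) =
      (\<lambda>t. fox_Xi m' (n' + 2 * k) as'' bs'' (?c t) * zigzag_deriv w q t * of_real x powr (- ?c t))"
    proof -
      have "n' \<le> length as'" "m' \<le> length bs'" using len by (simp_all add: as'_def bs'_def)
      from fox_Xi_Beta[OF this] show ?thesis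
        by (simp add: g_def as''_def bs''_def E_def mult_ac)
    qed
    also have "?K * (\<integral>t. fox_Xi m' (n' + 2 * k) as'' bs'' (?c t) * zigzag_deriv w q t * of_real x powr (- ?c t) \<partial>lborel) =
        fox_H m' (n' + 2 * k) as'' bs'' x"
      by (rule fox_H_zigzag(2)[OF par'' chi'' con'' vc ab x, symmetric])
    finally show ?thesis .
  qed
  with par'' show ?thesis
    unfolding Let_def as''_def bs''_def as'_def bs'_def E_def Beta_params_def by blast
qed

end
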